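(* Let $\tau\in(2,3)$ and let the weights be $w_i=c_F (n/i)^{\alpha}$, $i\in[n]$, as described in the context. Let $\pi_n=\lambda_n n^{-(3-\tau)/(\tau-1)}$, where $\lambda_n\to\infty$ and $\lambda_n=o(n^{(3-\tau)/(\tau-1)})$. Let $|\mathscr{C}_{(1)}(\pi_n)|\ge|\mathscr{C}_{(2)}(\pi_n)|\ge\cdots$ be the component sizes of the percolated multigraph $\mathrm{MNR}_n(\boldsymbol{w},\pi_n)$ in non-increasing order. Then, as $n\to\infty$, $$\frac{|\mathscr{C}_{(1)}(\pi_n)|}{n\pi_n^{1/(3-\tau)}}\xrightarrow{\ \mathbb{P}\ }\mu\,\kappa^{1/(3-\tau)},\qquad \kappa=c_F^{\tau-2}\,\Gamma(3-\tau),$$ where $\Gamma$ is the gamma function. Further, for any $j\ge 2$, $|\mathscr{C}_{(j)}(\pi_n)|=o_{\mathbb{P}}(n\pi_n^{1/(3-\tau)})$, i.e. $|\mathscr{C}_{(j)}(\pi_n)|/(n\pi_n^{1/(3-\tau)})\to0$ in probability.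
   Context: Fix $\tau\in(2,3)$ and $\alpha=1/(\tau-1)$. Let $F$ be the distribution function with $1-F(w)=Cw^{-(\tau-1)}$ (for $w\ge C^{1/(\tau-1)}$), $C>0$, and let $w_i=[1-F]^{-1}(i/n)=c_F(n/i)^{\alpha}$ for $i\in[n]=\{1,\dots,n\}$, with $c_F=C^{1/(\tau-1)}$. Write $\boldsymbol{w}=(w_i)_{i\in[n]}$, $\ell_n=\sum_{i\in[n]}w_i$, and $\mu=\lim_{n\to\infty}\ell_n/n=\mathbb{E}[W]$ with $W\sim F$. The Poissonian random graph (Norros–Reittu model) $\mathrm{MNR}_n(\boldsymbol{w})$ is the random multigraph on $[n]$ with $X_{ij}\sim\mathrm{Poisson}(w_iw_j/\ell_n)$ edges between $i$ and $j$, independently over pairs (self-loops are irrelevant for component sizes). The percolated multigraph $\mathrm{MNR}_n(\boldsymbol{w},\pi)$ is obtained by keeping each edge of the multigraph (each copy of a multi-edge separately) independently with probability $\pi$, independently of the graph. Component size means number of vertices; ties in the ordering are broken arbitrarily. *)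

theory Defs
  imports "HOL-Probability.Probability" "HOL-Probability.Product_PMF"
    "HOL-Library.Landau_Symbols"
begin

section \<open>Weights\<close>

text \<open>For the distribution function \<open>F\<close> with \<open>1 - F w = C * w powr (-(\<tau> - 1))\<close> on
  \<open>w \<ge> C powr (1 / (\<tau> - 1))\<close>, these are the quantiles \<open>w\<^sub>i = (1 - F)\<^sup>-\<^sup>1 (i / n)\<close>, in closed form.
  Only indices \<open>i \<in> {1..n}\<close> are meaningful.\<close>

definition c_F :: "real \<Rightarrow> real \<Rightarrow> real" where
  "c_F \<tau> C = C powr (1 / (\<tau> - 1))"

definition weight :: "real \<Rightarrow> real \<Rightarrow> nat \<Rightarrow> nat \<Rightarrow> real" where
  "weight \<tau> C n i = c_F \<tau> C * (real n / real i) powr (1 / (\<tau> - 1))"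

definition total_weight :: "nat \<Rightarrow> (nat \<Rightarrow> real) \<Rightarrow> real" where
  "total_weight n w = (\<Sum>i\<in>{1..n}. w i)"

definition mean_weight :: "real \<Rightarrow> real \<Rightarrow> real" where
  "mean_weight \<tau> C = lim (\<lambda>n. total_weight n (weight \<tau> C n) / real n)"

definition kappa :: "real \<Rightarrow> real \<Rightarrow> real" where
  "kappa \<tau> C = c_F \<tau> C powr (\<tau> - 2) * Gamma (3 - \<tau>)"

section \<open>The Norros--Reittu multigraph and its percolation\<close>

text \<open>A multigraph on \<open>{1..n}\<close> is given by its set of labelled edges: \<open>((i, j), k)\<close> is the
  \<open>k\<close>-th copy (counted from 0) of the edge between \<open>i\<close> and \<open>j\<close>, where \<open>i < j\<close>. Self-loops, which do not
  affect component sizes, are left out.\<close>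

type_synonym edge = "(nat \<times> nat) \<times> nat"

definition vertex_pairs :: "nat \<Rightarrow> (nat \<times> nat) set" where
  "vertex_pairs n = {(i, j). 1 \<le> i \<and> i < j \<and> j \<le> n}"

definition edge_counts :: "nat \<Rightarrow> (nat \<Rightarrow> real) \<Rightarrow> (nat \<times> nat \<Rightarrow> nat) pmf" where
  "edge_counts n w =
     Pi_pmf (vertex_pairs n) 0 (\<lambda>(i, j). poisson_pmf (w i * w j / total_weight n w))"

definition MNR :: "nat \<Rightarrow> (nat \<Rightarrow> real) \<Rightarrow> edge set pmf" where
  "MNR n w = map_pmf (\<lambda>X. SIGMA e:vertex_pairs n. {..<X e}) (edge_counts n w)"

text \<open>For \<open>p\<close> outside \<open>[0, 1]\<close>, \<open>bernoulli_pmf p\<close> truncates \<open>p\<close> to this interval.\<close>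

definition percolate :: "real \<Rightarrow> 'e set \<Rightarrow> 'e set pmf" where
  "percolate p E = map_pmf (\<lambda>kept. {e \<in> E. kept e}) (Pi_pmf E False (\<lambda>_. bernoulli_pmf p))"

definition MNR_percolated :: "nat \<Rightarrow> (nat \<Rightarrow> real) \<Rightarrow> real \<Rightarrow> edge set pmf" where
  "MNR_percolated n w p = bind_pmf (MNR n w) (percolate p)"

section \<open>Component sizes\<close>

definition adjacency :: "edge set \<Rightarrow> (nat \<times> nat) set" where
  "adjacency E = {(u, v). \<exists>k. ((u, v), k) \<in> E \<or> ((v, u), k) \<in> E}"

definition components :: "nat \<Rightarrow> edge set \<Rightarrow> nat set set" where
  "components n E = (\<lambda>u. {v \<in> {1..n}. (u, v) \<in> (adjacency E)\<^sup>*}) ` {1..n}"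

text \<open>The sizes are listed with multiplicity, so ties need no tie-breaking rule. The \<open>j\<close>-th largest size
  (\<open>j \<ge> 1\<close>) is 0 if there are fewer than \<open>j\<close> components.\<close>

definition ordered_component_sizes :: "nat \<Rightarrow> edge set \<Rightarrow> nat list" where
  "ordered_component_sizes n E =
     rev (sorted_list_of_multiset (image_mset card (mset_set (components n E))))"

definition component_size :: "nat \<Rightarrow> edge set \<Rightarrow> nat \<Rightarrow> nat" where
  "component_size n E j =
     (let s = ordered_component_sizes n E in if j \<le> length s then s ! (j - 1) else 0)"

section \<open>Convergence in probability to a constant\<close>

text \<open>The random variables \<open>X n\<close> may live on different probability spaces.\<close>

definition converges_in_probability ::
    "(nat \<Rightarrow> 'a measure) \<Rightarrow> (nat \<Rightarrow> 'a \<Rightarrow> real) \<Rightarrow> real \<Rightarrow> bool" where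
  "converges_in_probability M X c \<longleftrightarrow>
     (\<forall>\<epsilon>>0. (\<lambda>n. measure (M n) {x \<in> space (M n). \<bar>X n x - c\<bar> > \<epsilon>}) \<longlonglongrightarrow> 0)"

end

theory Submission
  imports Defs "HOL-Real_Asymp.Real_Asymp"
begin

text \<open>Percolation thins the Poissonian multigraph: as far as connectivity is concerned, the percolated graph is
the simple graph in which \<open>i\<close> and \<open>j\<close> are joined independently with probability
\<open>1 - exp (- (c * w i * w j))\<close>, where \<open>c\<close> is \<open>p\<close> divided by the total weight
(\<open>percolated_simple_graph_law\<close>). Explore such a graph one vertex at a time. A vertex \<open>j\<close> avoids all processed
vertices with probability \<open>exp (- (c * w j * s))\<close>, where \<open>s\<close> is their total weight. So the exploration may
just as well be driven by independent clocks that ring at exponential times with rates \<open>c * w j\<close>: with time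
measured by the processed weight, a vertex is discovered when its clock rings, unless it serves as a root
earlier (\<open>explore_law\<close>, \<open>dominant_class_prob_le\<close>). This is the idea of Aldous's exploration of rank-one
random graphs.

For the clocks the law of large numbers is elementary. Let \<open>A s\<close> be the weight of the vertices whose clocks
have rung by time \<open>s\<close>, a sum of independent terms. A component is completed only at times with
\<open>A s \<le> s\<close>. On the scale \<open>L = X * n * p powr (\<beta> / (1 - \<beta>))\<close> with \<open>\<beta> = \<tau> - 2\<close>, the function \<open>A (u * L) / L\<close> is close
to \<open>u powr \<beta>\<close> if \<open>X\<close> is chosen suitably. This limit is a Riemann sum that
evaluates to a gamma function (\<open>weight_profile_sum_limit\<close>), and the choice of \<open>X\<close> that places the fixed point at
\<open>u = 1\<close> is the constant of the theorem. Since \<open>u powr \<beta>\<close> is above the diagonal before 1 and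
below it after 1, one component lasts from near 0 until near \<open>L\<close>; since the slope is less than 1 from there
on, all later components are short (\<open>peels_found_by_dominant\<close>).

Sizes follow from weights, because the number of clocks that ring during an interval of length \<open>h\<close> is close to
\<open>p * h\<close> on this scale. The giant component therefore has about \<open>p * L = X * n * p powr (1 / (3 - \<tau>))\<close>
vertices, almost all of them light vertices that are attached to it directly. The relative errors are governed
by \<open>N = lam powr ((\<tau> - 1) / (3 - \<tau>))\<close>, the number of vertices that carry the main part of the rung weight; Chebyshev's
inequality suffices even for the whole time axis, because the variances over consecutive intervals
telescope (\<open>rung_increments_concentration\<close>).\<close>

section \<open>Products of independent coordinates\<close>

text \<open>Functions of disjoint blocks of independent coordinates are independent: the two cases that matter
below are the presence of an edge between two vertices (the block of its surviving copies) and the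
ringing of a clock (the block of its ticks).\<close>

lemma Pi_pmf_blocks:
  assumes "finite J" "\<And>j. j \<in> J \<Longrightarrow> finite (blk j)" "disjoint_family_on blk J"
    and "\<And>j f g. j \<in> J \<Longrightarrow> (\<And>i. i \<in> blk j \<Longrightarrow> f i = g i) \<Longrightarrow> G j f = G j g"
  shows "map_pmf (\<lambda>f j. if j \<in> J then G j f else d') (Pi_pmf (\<Union>j\<in>J. blk j) d p)
       = Pi_pmf J d' (\<lambda>j. map_pmf (G j) (Pi_pmf (blk j) d p))"
  using assms
proof (induction J rule: finite_induct)
  case empty
  then show ?case by simp
next
  case (insert x J)
  let ?U = "\<Union>j\<in>J. blk j"
  have dis: "blk x \<inter> ?U = {}"
    using insert.prems(2) insert.hyps(2) unfolding disjoint_family_on_def by auto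
  have IH: "map_pmf (\<lambda>f j. if j \<in> J then G j f else d') (Pi_pmf ?U d p)
       = Pi_pmf J d' (\<lambda>j. map_pmf (G j) (Pi_pmf (blk j) d p))"
  proof (rule insert.IH)
    show "finite (blk j)" if "j \<in> J" for j using insert.prems(1) that by simp
    show "disjoint_family_on blk J" using insert.prems(2) by (simp add: disjoint_family_on_def)
    show "G j f = G j g" if "j \<in> J" "\<And>i. i \<in> blk j \<Longrightarrow> f i = g i" for j f g
      by (rule insert.prems(3)) (use that in simp_all)
  qed
  have "Pi_pmf (\<Union>j\<in>insert x J. blk j) d p
      = map_pmf (\<lambda>(f, g) i. if i \<in> blk x then f i else g i) (pair_pmf (Pi_pmf (blk x) d p) (Pi_pmf ?U d p))"
    using Pi_pmf_union[of "blk x" ?U d p] dis insert.prems(1) insert.hyps(1) by simp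
  then have "map_pmf (\<lambda>f j. if j \<in> insert x J then G j f else d') (Pi_pmf (\<Union>j\<in>insert x J. blk j) d p)
     = map_pmf (\<lambda>z j. if j \<in> insert x J then G j (\<lambda>i. if i \<in> blk x then fst z i else snd z i) else d')
         (pair_pmf (Pi_pmf (blk x) d p) (Pi_pmf ?U d p))"
    by (simp add: pmf.map_comp o_def case_prod_unfold)
  also have "\<dots> = map_pmf (\<lambda>z. (\<lambda>j. if j \<in> J then G j (snd z) else d')(x := G x (fst z)))
         (pair_pmf (Pi_pmf (blk x) d p) (Pi_pmf ?U d p))"
  proof (rule map_pmf_cong[OF refl], rule ext)
    fix z :: "('b \<Rightarrow> 'c) \<times> ('b \<Rightarrow> 'c)" and j
    have 1: "G x (\<lambda>i. if i \<in> blk x then fst z i else snd z i) = G x (fst z)"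
      by (rule insert.prems(3)) auto
    have 2: "G j (\<lambda>i. if i \<in> blk x then fst z i else snd z i) = G j (snd z)" if "j \<in> J"
      by (rule insert.prems(3)) (use that dis in auto)
    show "(if j \<in> insert x J then G j (\<lambda>i. if i \<in> blk x then fst z i else snd z i) else d')
      = ((\<lambda>j. if j \<in> J then G j (snd z) else d')(x := G x (fst z))) j"
      using 1 2 by auto
  qed
  also have "\<dots> = map_pmf (\<lambda>(y, f). f(x := y)) (pair_pmf (map_pmf (G x) (Pi_pmf (blk x) d p))
         (map_pmf (\<lambda>f j. if j \<in> J then G j f else d') (Pi_pmf ?U d p)))"
    by (simp add: map_pair[symmetric] pmf.map_comp o_def case_prod_beta)
  also have "\<dots> = Pi_pmf (insert x J) d' (\<lambda>j. map_pmf (G j) (Pi_pmf (blk j) d p))"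
    unfolding IH by (rule Pi_pmf_insert[symmetric]) (use insert.hyps in auto)
  finally show ?case .
qed

lemma pmf_bool_False: "pmf L False = 1 - pmf (L :: bool pmf) True"
  using sum_pmf_eq_1[of "UNIV :: bool set" L] by (simp add: UNIV_bool add.commute subset_iff)

lemma bool_pmf_eqI:
  fixes M N :: "bool pmf"
  assumes "pmf M False = pmf N False" shows "M = N"
proof (rule pmf_eqI)
  fix b show "pmf M b = pmf N b"
    using assms pmf_bool_False[of M] pmf_bool_False[of N] by (cases b) auto
qed

lemma Bex_Pi_pmf_bernoulli:
  assumes "finite I" "\<And>i. i \<in> I \<Longrightarrow> 0 \<le> q i \<and> q i \<le> 1"
  shows "map_pmf (\<lambda>f. \<exists>i\<in>I. f i) (Pi_pmf I False (\<lambda>i. bernoulli_pmf (q i)))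
       = bernoulli_pmf (1 - (\<Prod>i\<in>I. 1 - q i))"
proof (rule bool_pmf_eqI)
  have p01: "0 \<le> (\<Prod>i\<in>I. 1 - q i)" "(\<Prod>i\<in>I. 1 - q i) \<le> 1"
    using assms by (auto intro!: prod_nonneg prod_le_1)
  have "pmf (map_pmf (\<lambda>f. \<exists>i\<in>I. f i) (Pi_pmf I False (\<lambda>i. bernoulli_pmf (q i)))) False
     = measure_pmf.prob (Pi_pmf I False (\<lambda>i. bernoulli_pmf (q i))) (Pi I (\<lambda>_. {False}))"
    unfolding pmf_map by (intro arg_cong[where f="measure _"]) auto
  also have "\<dots> = (\<Prod>i\<in>I. 1 - q i)"
    using assms by (auto simp: measure_Pi_pmf_Pi measure_pmf_single intro!: prod.cong)
  finally show "pmf (map_pmf (\<lambda>f. \<exists>i\<in>I. f i) (Pi_pmf I False (\<lambda>i. bernoulli_pmf (q i)))) False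
      = pmf (bernoulli_pmf (1 - (\<Prod>i\<in>I. 1 - q i))) False"
    using p01 by simp
qed

lemma Bex_blocks_Pi_pmf_bernoulli:
  assumes "finite J" "\<And>j. j \<in> J \<Longrightarrow> finite (blk j)" "disjoint_family_on blk J"
    and q: "\<And>i. i \<in> (\<Union>j\<in>J. blk j) \<Longrightarrow> 0 \<le> q i \<and> q i \<le> 1"
  shows "map_pmf (\<lambda>f j. j \<in> J \<and> (\<exists>i\<in>blk j. f i)) (Pi_pmf (\<Union>j\<in>J. blk j) False (\<lambda>i. bernoulli_pmf (q i)))
       = Pi_pmf J False (\<lambda>j. bernoulli_pmf (1 - (\<Prod>i\<in>blk j. 1 - q i)))"
proof -
  have eq: "(\<lambda>(f :: _ \<Rightarrow> bool) j. j \<in> J \<and> (\<exists>i\<in>blk j. f i)) = (\<lambda>f j. if j \<in> J then \<exists>i\<in>blk j. f i else False)"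
    by auto
  have "map_pmf (\<lambda>f j. j \<in> J \<and> (\<exists>i\<in>blk j. f i)) (Pi_pmf (\<Union>j\<in>J. blk j) False (\<lambda>i. bernoulli_pmf (q i)))
     = Pi_pmf J False (\<lambda>j. map_pmf (\<lambda>f. \<exists>i\<in>blk j. f i) (Pi_pmf (blk j) False (\<lambda>i. bernoulli_pmf (q i))))"
    unfolding eq by (rule Pi_pmf_blocks) (use assms in auto)
  also have "\<dots> = Pi_pmf J False (\<lambda>j. bernoulli_pmf (1 - (\<Prod>i\<in>blk j. 1 - q i)))"
    by (intro Pi_pmf_cong refl Bex_Pi_pmf_bernoulli) (use assms in auto)
  finally show ?thesis .
qed

section \<open>The percolated multigraph as a simple graph\<close>

text \<open>A pair of vertices loses all its copies with probability \<open>\<Sum>k. r ^ k / fact k * exp (- r) * (1 - p) ^ k\<close>,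
which is an exponential series.\<close>

lemma poisson_thinning_none:
  assumes "0 < r" "0 \<le> p" "p \<le> 1"
  shows "bind_pmf (poisson_pmf r) (\<lambda>k. bernoulli_pmf (1 - (1 - p) ^ k)) = bernoulli_pmf (1 - exp (- (p * r)))"
proof (rule bool_pmf_eqI)
  have pw: "0 \<le> (1 - p) ^ k" "(1 - p) ^ k \<le> 1" for k
    using assms by (auto intro: power_le_one)
  have "ennreal (pmf (bind_pmf (poisson_pmf r) (\<lambda>k. bernoulli_pmf (1 - (1 - p) ^ k))) False)
     = (\<integral>\<^sup>+k. ennreal ((1 - p) ^ k) \<partial>measure_pmf (poisson_pmf r))"
    unfolding ennreal_pmf_bind using pw by simp
  also have "\<dots> = (\<integral>\<^sup>+k. ennreal (pmf (poisson_pmf r) k * (1 - p) ^ k) \<partial>count_space UNIV)"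
    by (subst nn_integral_measure_pmf) (use pw in \<open>simp add: ennreal_mult\<close>)
  also have "\<dots> = (\<Sum>k. ennreal (pmf (poisson_pmf r) k * (1 - p) ^ k))"
    by (rule nn_integral_count_space_nat)
  also have "\<dots> = ennreal (exp (- (p * r)))"
  proof (rule suminf_ennreal_eq)
    show "0 \<le> pmf (poisson_pmf r) k * (1 - p) ^ k" for k using pw by simp
    have "(\<lambda>k. ((1 - p) * r) ^ k /\<^sub>R fact k) sums exp ((1 - p) * r)"
      by (rule exp_converges)
    from sums_mult[OF this, of "exp (- r)"]
    have "(\<lambda>k. exp (- r) * (((1 - p) * r) ^ k /\<^sub>R fact k)) sums (exp (- r) * exp ((1 - p) * r))" .
    moreover have "exp (- r) * exp ((1 - p) * r) = exp (- (p * r))"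
      by (simp add: mult_exp_exp algebra_simps)
    moreover have "exp (- r) * (((1 - p) * r) ^ k /\<^sub>R fact k) = pmf (poisson_pmf r) k * (1 - p) ^ k" for k
      using assms(1) by (simp add: power_mult_distrib divide_inverse scaleR_conv_of_real)
    ultimately show "(\<lambda>k. pmf (poisson_pmf r) k * (1 - p) ^ k) sums exp (- (p * r))" by simp
  qed
  finally show "pmf (bind_pmf (poisson_pmf r) (\<lambda>k. bernoulli_pmf (1 - (1 - p) ^ k))) False
     = pmf (bernoulli_pmf (1 - exp (- (p * r)))) False"
    using assms by simp
qed

lemma finite_vertex_pairs: "finite (vertex_pairs n)"
  by (rule finite_subset[of _ "{1..n} \<times> {1..n}"]) (auto simp: vertex_pairs_def)

text \<open>Component sizes depend only on which pairs keep at least one copy. These events are independent,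
because both the multiplicities and the percolation are.\<close>

lemma percolated_simple_graph_law:
  assumes w: "\<And>i. i \<in> {1..n} \<Longrightarrow> 0 < w i" and p: "0 \<le> p" "p \<le> 1" and n: "0 < n"
  shows "map_pmf (\<lambda>E. (\<lambda>e. \<exists>k. (e, k) \<in> E)) (MNR_percolated n w p)
     = Pi_pmf (vertex_pairs n) False (\<lambda>(i, j). bernoulli_pmf (1 - exp (- (p * (w i * w j / total_weight n w)))))"
proof -
  let ?V = "vertex_pairs n"
  have tw: "0 < total_weight n w"
    unfolding total_weight_def using w n by (intro sum_pos) auto
  have step: "map_pmf (\<lambda>E. (\<lambda>e. \<exists>k. (e, k) \<in> E)) (percolate p (SIGMA e:?V. {..<X e}))
     = Pi_pmf ?V False (\<lambda>e. bernoulli_pmf (1 - (1 - p) ^ X e))" for X :: "nat \<times> nat \<Rightarrow> nat"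
  proof -
    have S: "(SIGMA e:?V. {..<X e}) = (\<Union>e\<in>?V. {e} \<times> {..<X e})" by auto
    have "map_pmf (\<lambda>E. (\<lambda>e. \<exists>k. (e, k) \<in> E)) (percolate p (SIGMA e:?V. {..<X e}))
       = map_pmf (\<lambda>f e. e \<in> ?V \<and> (\<exists>i\<in>{e} \<times> {..<X e}. f i)) (Pi_pmf (\<Union>e\<in>?V. {e} \<times> {..<X e}) False (\<lambda>i. bernoulli_pmf p))"
      unfolding percolate_def S pmf.map_comp by (rule map_pmf_cong) (auto simp: fun_eq_iff)
    also have "\<dots> = Pi_pmf ?V False (\<lambda>e. bernoulli_pmf (1 - (\<Prod>i\<in>{e} \<times> {..<X e}. 1 - p)))"
      by (rule Bex_blocks_Pi_pmf_bernoulli) (use p finite_vertex_pairs in \<open>auto simp: disjoint_family_on_def\<close>)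
    also have "\<dots> = Pi_pmf ?V False (\<lambda>e. bernoulli_pmf (1 - (1 - p) ^ X e))"
      by (simp add: card_cartesian_product)
    finally show ?thesis .
  qed
  have "map_pmf (\<lambda>E. (\<lambda>e. \<exists>k. (e, k) \<in> E)) (MNR_percolated n w p)
     = bind_pmf (Pi_pmf ?V 0 (\<lambda>(i, j). poisson_pmf (w i * w j / total_weight n w)))
         (\<lambda>X. Pi_pmf ?V False (\<lambda>e. bernoulli_pmf (1 - (1 - p) ^ X e)))"
    unfolding MNR_percolated_def MNR_def edge_counts_def map_bind_pmf bind_map_pmf step ..
  also have "\<dots> = Pi_pmf ?V False (\<lambda>e. bind_pmf (case e of (i, j) \<Rightarrow> poisson_pmf (w i * w j / total_weight n w))
         (\<lambda>k. bernoulli_pmf (1 - (1 - p) ^ k)))"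
    by (rule Pi_pmf_bind[OF finite_vertex_pairs, symmetric])
  also have "\<dots> = Pi_pmf ?V False (\<lambda>(i, j). bernoulli_pmf (1 - exp (- (p * (w i * w j / total_weight n w)))))"
  proof (intro Pi_pmf_cong refl)
    fix e assume e: "e \<in> ?V"
    obtain i j where ij: "e = (i, j)" by (cases e)
    have "0 < w i * w j / total_weight n w"
      using e w tw unfolding ij vertex_pairs_def by auto
    from poisson_thinning_none[OF this p] show "bind_pmf (case e of (i, j) \<Rightarrow> poisson_pmf (w i * w j / total_weight n w))
         (\<lambda>k. bernoulli_pmf (1 - (1 - p) ^ k))
       = (case e of (i, j) \<Rightarrow> bernoulli_pmf (1 - exp (- (p * (w i * w j / total_weight n w)))))"
      by (simp add: ij)
  qed
  finally show ?thesis .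
qed

section \<open>Exploring a graph one vertex at a time\<close>

text \<open>In the exploration below, \<open>P\<close> is the set of processed vertices, \<open>A\<close> the set of active ones (discovered
but not processed), \<open>U\<close> the set of undiscovered ones, and \<open>K\<close> the part of the current component that has
been discovered. If nothing is active, the current component is complete and the undiscovered vertex
of smallest index becomes the root of a new one. Since the weights decrease with the index, roots are
taken in order of decreasing weight, which keeps the number of roots small until the giant component
is found.\<close>

definition pick :: "nat set \<Rightarrow> nat set \<Rightarrow> nat" where
  "pick A U = (if A = {} then Min U else Min A)"

text \<open>The predicate \<open>h P v j\<close> tells whether \<open>j\<close> is discovered when \<open>v\<close> is processed after \<open>P\<close>. That it may
depend on \<open>P\<close> is what allows the same procedure to be run both on a graph and on a family of clocks.
The fuel \<open>m\<close> is the number of vertices still to be processed.\<close>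

fun explore :: "(nat set \<Rightarrow> nat \<Rightarrow> nat \<Rightarrow> bool) \<Rightarrow> nat \<Rightarrow> nat set \<Rightarrow> nat set \<Rightarrow> nat set \<Rightarrow> nat set \<Rightarrow> nat set list" where
  "explore h 0 P A U K = [K]"
| "explore h (Suc m) P A U K =
    (let v = pick A U; D = {j \<in> U - {v}. h P v j};
         Ks = explore h m (insert v P) (A - {v} \<union> D) (U - {v} - D) ((if A = {} then {v} else K) \<union> D)
     in if A = {} then K # Ks else Ks)"

text \<open>The exploration as a Markov chain: processing \<open>v\<close> discovers each remaining vertex \<open>j\<close> independently with
probability \<open>r v j\<close>.\<close>

fun explore_pmf :: "(nat \<Rightarrow> nat \<Rightarrow> real) \<Rightarrow> nat \<Rightarrow> nat set \<Rightarrow> nat set \<Rightarrow> nat set \<Rightarrow> nat set list pmf" where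
  "explore_pmf r 0 A U K = return_pmf [K]"
| "explore_pmf r (Suc m) A U K =
    (let v = pick A U in
     bind_pmf (Pi_pmf (U - {v}) False (\<lambda>j. bernoulli_pmf (r v j)))
       (\<lambda>g. let D = {j \<in> U - {v}. g j} in
         map_pmf (\<lambda>Ks. if A = {} then K # Ks else Ks)
           (explore_pmf r m (A - {v} \<union> D) (U - {v} - D) ((if A = {} then {v} else K) \<union> D))))"

lemma explore_step:
  assumes "v = pick A U" "D = {j \<in> U - {v}. h P v j}" "Kv = (if A = {} then {v} else K)"
  shows "explore h (Suc m) P A U K = (if A = {} then Cons K else id)
     (explore h m (insert v P) (A - {v} \<union> D) (U - {v} - D) (Kv \<union> D))"
  using assms by (simp add: Let_def)

declare explore.simps(2) [simp del]

definition exploration_state :: "nat set \<Rightarrow> nat set \<Rightarrow> nat set \<Rightarrow> nat set \<Rightarrow> bool" where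
  "exploration_state V P A U \<longleftrightarrow> finite V \<and> V = P \<union> A \<union> U \<and> P \<inter> A = {} \<and> P \<inter> U = {} \<and> A \<inter> U = {}"

lemma exploration_state_card:
  assumes "exploration_state V P A U" shows "card (V - P) = card A + card U"
proof -
  have "V - P = A \<union> U" "finite A" "finite U" "A \<inter> U = {}"
    using assms by (auto simp: exploration_state_def)
  then show ?thesis by (simp add: card_Un_disjoint)
qed

lemma exploration_state_empty:
  assumes "exploration_state V P A U" "card (V - P) = 0" shows "A = {}" "U = {}"
proof -
  have "finite A" "finite U" "card A = 0" "card U = 0"
    using assms exploration_state_card[OF assms(1)] by (auto simp: exploration_state_def)
  then show "A = {}" "U = {}" by auto
qed

lemma pick_in:
  assumes "exploration_state V P A U" "card (V - P) = Suc m"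
  shows "pick A U \<in> A \<union> U" "A \<noteq> {} \<Longrightarrow> pick A U \<in> A" "A = {} \<Longrightarrow> pick A U \<in> U" "pick A U \<in> V - P"
proof -
  have fin: "finite A" "finite U" using assms by (auto simp: exploration_state_def)
  have ne: "A \<noteq> {} \<or> U \<noteq> {}" using exploration_state_card[OF assms(1)] assms(2) by auto
  show 1: "A \<noteq> {} \<Longrightarrow> pick A U \<in> A" using fin by (simp add: pick_def)
  show 2: "A = {} \<Longrightarrow> pick A U \<in> U" using fin ne by (simp add: pick_def)
  show 3: "pick A U \<in> A \<union> U" using 1 2 by blast
  then show "pick A U \<in> V - P" using assms(1) by (auto simp: exploration_state_def)
qed

lemma exploration_state_step:
  assumes "exploration_state V P A U" "card (V - P) = Suc m" "v = pick A U"
  shows "D \<subseteq> U - {v} \<Longrightarrow> exploration_state V (insert v P) (A - {v} \<union> D) (U - {v} - D)"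
    and "card (V - insert v P) = m"
proof -
  note v = pick_in[OF assms(1,2), folded assms(3)]
  show "exploration_state V (insert v P) (A - {v} \<union> D) (U - {v} - D)" if "D \<subseteq> U - {v}"
    using assms(1) that v by (auto simp: exploration_state_def)
  have "V - insert v P = (V - P) - {v}" by auto
  then show "card (V - insert v P) = m" using v(4) assms(2) by (simp add: card_Diff_singleton)
qed

lemma explore_cong:
  assumes "exploration_state V P A U" "card (V - P) = m"
    and "\<And>P' v j. P \<subseteq> P' \<Longrightarrow> P' \<subseteq> V \<Longrightarrow> v \<in> V - P' \<Longrightarrow> j \<in> V - insert v P' \<Longrightarrow> h P' v j = h' P' v j"
  shows "explore h m P A U K = explore h' m P A U K"
  using assms
proof (induction m arbitrary: P A U K)
  case 0
  then show ?case by simp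
next
  case (Suc m)
  define v where "v = pick A U"
  note v = pick_in[OF Suc.prems(1,2), folded v_def]
  have UV: "U \<subseteq> V - P" "P \<subseteq> V" using Suc.prems(1) by (auto simp: exploration_state_def)
  have D: "{j \<in> U - {v}. h P v j} = {j \<in> U - {v}. h' P v j}"
    using Suc.prems(3)[of P v] v UV by auto
  define D where "D = {j \<in> U - {v}. h P v j}"
  have "explore h m (insert v P) (A - {v} \<union> D) (U - {v} - D) ((if A = {} then {v} else K) \<union> D)
      = explore h' m (insert v P) (A - {v} \<union> D) (U - {v} - D) ((if A = {} then {v} else K) \<union> D)"
  proof (rule Suc.IH)
    show "exploration_state V (insert v P) (A - {v} \<union> D) (U - {v} - D)" "card (V - insert v P) = m"
      by (rule exploration_state_step[OF Suc.prems(1,2) v_def]; auto simp: D_def)+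
    show "h P' v' j = h' P' v' j"
      if "insert v P \<subseteq> P'" "P' \<subseteq> V" "v' \<in> V - P'" "j \<in> V - insert v' P'" for P' v' j
      by (rule Suc.prems(3)) (use that in auto)
  qed
  then show ?case
    unfolding explore_step[where h = h, OF v_def D_def refl] explore_step[where h = h', OF v_def D_def[unfolded D] refl]
    by simp
qed

text \<open>An exploration that answers each query by looking at a fresh block of independent Bernoulli variables
is that Markov chain, because what was revealed earlier is independent of the block. Only the
probabilities \<open>r v j\<close> of the answers matter, so two explorations with different sources of randomness
but equal answer probabilities have the same law.\<close>

lemma explore_law:
  fixes blk :: "nat set \<Rightarrow> nat \<Rightarrow> nat \<Rightarrow> 'i set" and q :: "'i \<Rightarrow> real"
  assumes fin: "\<And>P v j. finite (blk P v j)"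
    and dis: "\<And>P v i j. i \<noteq> j \<Longrightarrow> blk P v i \<inter> blk P v j = {}"
    and q: "\<And>i. 0 \<le> q i \<and> q i \<le> 1"
    and pr: "\<And>P v j. P \<subseteq> V \<Longrightarrow> v \<in> V - P \<Longrightarrow> j \<in> V - insert v P \<Longrightarrow> (\<Prod>i\<in>blk P v j. 1 - q i) = 1 - r v j"
    and fresh: "\<And>P v j P' v' j'. insert v P \<subseteq> P' \<Longrightarrow> P' \<subseteq> V \<Longrightarrow> v \<notin> P \<Longrightarrow> j \<in> V - insert v P
        \<Longrightarrow> v' \<in> V - P' \<Longrightarrow> j' \<in> V - insert v' P' \<Longrightarrow> blk P v j \<inter> blk P' v' j' = {}"
    and I: "finite I" "\<And>P' v j. P \<subseteq> P' \<Longrightarrow> P' \<subseteq> V \<Longrightarrow> v \<in> V - P' \<Longrightarrow> j \<in> V - insert v P' \<Longrightarrow> blk P' v j \<subseteq> I"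
    and state: "exploration_state V P A U" "card (V - P) = m"
  shows "map_pmf (\<lambda>B. explore (\<lambda>P v j. \<exists>i\<in>blk P v j. B i) m P A U K) (Pi_pmf I False (\<lambda>i. bernoulli_pmf (q i)))
       = explore_pmf r m A U K"
  using I state
proof (induction m arbitrary: I P A U K)
  case 0
  then show ?case by (simp add: map_pmf_const)
next
  case (Suc m)
  define v where "v = pick A U"
  define H where "H = (\<lambda>B P v j. \<exists>i\<in>blk P v j. B i :: bool)"
  define W where "W = (\<Union>j\<in>U - {v}. blk P v j)"
  define Kv where "Kv = (if A = {} then {v} else K)"
  define emit where "emit = (\<lambda>Ks. if A = {} then K # Ks else Ks)"
  define nxt where "nxt = (\<lambda>g D. explore (H g) m (insert v P) (A - {v} \<union> D) (U - {v} - D) (Kv \<union> D))"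
  define bq where "bq = (\<lambda>i. bernoulli_pmf (q i))"
  note v = pick_in[OF Suc.prems(3,4), folded v_def]
  have UV: "U \<subseteq> V - P" "P \<subseteq> V" "finite U" using Suc.prems(3) by (auto simp: exploration_state_def)
  have W: "W \<subseteq> I" "finite W"
    unfolding W_def using Suc.prems(2)[of P v] v UV fin by (blast, auto)
  \<comment> \<open>The variables \<open>W\<close> queried in this step are split off; the rest of the exploration uses only the others.\<close>
  have dec: "Pi_pmf I False bq
      = map_pmf (\<lambda>(f, g) i. if i \<in> W then f i else g i) (pair_pmf (Pi_pmf W False bq) (Pi_pmf (I - W) False bq))"
    using Pi_pmf_union[of W "I - W" False bq] W Suc.prems(1) by (simp add: Un_absorb1)
  have step: "explore (H (\<lambda>i. if i \<in> W then f i else g i)) (Suc m) P A U K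
     = emit (nxt g {j \<in> U - {v}. \<exists>i\<in>blk P v j. f i})" for f g
  proof -
    let ?h = "\<lambda>i. if i \<in> W then f i else g i"
    have D: "{j \<in> U - {v}. H ?h P v j} = {j \<in> U - {v}. \<exists>i\<in>blk P v j. f i}" (is "_ = ?D")
      by (auto simp: H_def W_def)
    have "explore (H ?h) m (insert v P) (A - {v} \<union> ?D) (U - {v} - ?D) (Kv \<union> ?D) = nxt g ?D"
      unfolding nxt_def
    proof (rule explore_cong)
      show "exploration_state V (insert v P) (A - {v} \<union> ?D) (U - {v} - ?D)" "card (V - insert v P) = m"
        by (rule exploration_state_step[OF Suc.prems(3,4) v_def]; auto)+
      fix P' v' j assume *: "insert v P \<subseteq> P'" "P' \<subseteq> V" "v' \<in> V - P'" "j \<in> V - insert v' P'"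
      have "blk P v i \<inter> blk P' v' j = {}" if "i \<in> U - {v}" for i
        by (rule fresh) (use * v UV that in auto)
      then have "blk P' v' j \<inter> W = {}" unfolding W_def by blast
      then show "H ?h P' v' j = H g P' v' j" unfolding H_def by auto
    qed
    then show ?thesis
      unfolding explore_step[where h = "H ?h" and D = "?D" and P = P and A = A and U = U and K = K, OF v_def D[symmetric] Kv_def] by (simp add: emit_def)
  qed
  have IH: "map_pmf (\<lambda>g. nxt g D) (Pi_pmf (I - W) False bq)
      = explore_pmf r m (A - {v} \<union> D) (U - {v} - D) (Kv \<union> D)" if D: "D \<subseteq> U - {v}" for D
    unfolding nxt_def H_def bq_def
  proof (rule Suc.IH)
    show "finite (I - W)" using Suc.prems(1) by simp
    show "exploration_state V (insert v P) (A - {v} \<union> D) (U - {v} - D)" "card (V - insert v P) = m"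
      by (rule exploration_state_step[OF Suc.prems(3,4) v_def]; use D in simp)+
    fix P' v' j assume *: "insert v P \<subseteq> P'" "P' \<subseteq> V" "v' \<in> V - P'" "j \<in> V - insert v' P'"
    have "blk P v i \<inter> blk P' v' j = {}" if "i \<in> U - {v}" for i
      by (rule fresh) (use * v UV that in auto)
    then have "blk P' v' j \<inter> W = {}" unfolding W_def by blast
    moreover have "blk P' v' j \<subseteq> I" by (rule Suc.prems(2)) (use * in auto)
    ultimately show "blk P' v' j \<subseteq> I - W" by auto
  qed
  let ?g = "\<lambda>f j. j \<in> U - {v} \<and> (\<exists>i\<in>blk P v j. f i)"
  have "map_pmf (\<lambda>B. explore (H B) (Suc m) P A U K) (Pi_pmf I False bq)
     = bind_pmf (Pi_pmf W False bq) (\<lambda>f. map_pmf emit (map_pmf (\<lambda>g. nxt g {j \<in> U - {v}. \<exists>i\<in>blk P v j. f i}) (Pi_pmf (I - W) False bq)))"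
    unfolding dec pair_pmf_def map_bind_pmf map_pmf_comp map_return_pmf case_prod_conv step
    by (simp add: map_pmf_def o_def bind_assoc_pmf bind_return_pmf)
  also have "\<dots> = bind_pmf (Pi_pmf W False bq) (\<lambda>f. map_pmf emit
       (explore_pmf r m (A - {v} \<union> {j \<in> U - {v}. ?g f j}) (U - {v} - {j \<in> U - {v}. ?g f j}) (Kv \<union> {j \<in> U - {v}. ?g f j})))"
    by (subst IH) (auto simp: conj_commute cong: conj_cong)
  also have "\<dots> = bind_pmf (map_pmf ?g (Pi_pmf W False bq)) (\<lambda>g. map_pmf emit
       (explore_pmf r m (A - {v} \<union> {j \<in> U - {v}. g j}) (U - {v} - {j \<in> U - {v}. g j}) (Kv \<union> {j \<in> U - {v}. g j})))"
    by (simp only: bind_map_pmf)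
  also have "map_pmf ?g (Pi_pmf W False bq) = Pi_pmf (U - {v}) False (\<lambda>j. bernoulli_pmf (1 - (\<Prod>i\<in>blk P v j. 1 - q i)))"
    unfolding W_def bq_def
    by (rule Bex_blocks_Pi_pmf_bernoulli) (use UV fin q dis in \<open>auto simp: disjoint_family_on_def\<close>)
  also have "\<dots> = Pi_pmf (U - {v}) False (\<lambda>j. bernoulli_pmf (r v j))"
  proof (intro Pi_pmf_cong refl)
    fix j assume "j \<in> U - {v}"
    then have "(\<Prod>i\<in>blk P v j. 1 - q i) = 1 - r v j" by (intro pr) (use v UV in auto)
    then show "bernoulli_pmf (1 - (\<Prod>i\<in>blk P v j. 1 - q i)) = bernoulli_pmf (r v j)" by simp
  qed
  finally show ?case
    by (simp add: H_def bq_def Let_def v_def[symmetric] Kv_def[symmetric] emit_def)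
qed

section \<open>Reading the components off the exploration\<close>

text \<open>The exploration returns the components in the order of completion. \<open>peels \<Phi> V Q Ks\<close> says that \<open>Ks\<close> exhausts
\<open>V\<close> starting from the union \<open>Q\<close> of the components found earlier, and that \<open>\<Phi>\<close> holds for each
component together with the union of its predecessors.\<close>

fun peels :: "(nat set \<Rightarrow> nat set \<Rightarrow> bool) \<Rightarrow> nat set \<Rightarrow> nat set \<Rightarrow> nat set list \<Rightarrow> bool" where
  "peels \<Phi> V Q [] \<longleftrightarrow> Q = V"
| "peels \<Phi> V Q (K # Ks) \<longleftrightarrow> \<Phi> Q K \<and> peels \<Phi> V (Q \<union> K) Ks"

definition closed_class :: "('a \<Rightarrow> 'a \<Rightarrow> bool) \<Rightarrow> 'a set \<Rightarrow> 'a set \<Rightarrow> bool" where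
  "closed_class R Q K \<longleftrightarrow> Q \<inter> K = {} \<and> (\<exists>r\<in>K. K = {y. R\<^sup>*\<^sup>* r y})"

lemma closed_class_intro:
  assumes "r \<in> K" "\<And>y. y \<in> K \<Longrightarrow> R\<^sup>*\<^sup>* r y" "\<And>a b. a \<in> K \<Longrightarrow> R a b \<Longrightarrow> b \<in> K" "Q \<inter> K = {}"
  shows "closed_class R Q K"
proof -
  have "y \<in> K" if "R\<^sup>*\<^sup>* r y" for y
    using that by (induction rule: rtranclp_induct) (use assms in auto)
  then have "K = {y. R\<^sup>*\<^sup>* r y}" using assms(2) by auto
  then show ?thesis unfolding closed_class_def using assms(1,4) by blast
qed

text \<open>The invariants are that no edge leads from a processed to an undiscovered vertex and that the current
component consists of vertices reachable from its root \<open>r\<close>; so a component without active vertices is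
a full class of reachability.\<close>

lemma explore_components:
  assumes R: "\<And>a b. R a b \<Longrightarrow> R b a" "\<And>a b. R a b \<Longrightarrow> a \<in> V \<and> b \<in> V"
    and "exploration_state V P A U" "card (V - P) = m"
    and "P \<union> A = Q \<union> K" "Q \<inter> K = {}" "Q \<subseteq> P"
    and "\<And>a b. a \<in> P \<Longrightarrow> b \<in> U \<Longrightarrow> \<not> R a b" "\<And>a b. a \<in> Q \<Longrightarrow> b \<notin> Q \<Longrightarrow> \<not> R a b"
    and "r \<in> K" "\<And>y. y \<in> K \<Longrightarrow> R\<^sup>*\<^sup>* r y"
  shows "peels (closed_class R) V Q (explore (\<lambda>_. R) m P A U K)"
  using assms(3-)
proof (induction m arbitrary: P A U K Q r)
  case 0
  have AU: "A = {}" "U = {}" "V = Q \<union> K"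
    using exploration_state_empty[OF 0(1,2)] 0(1,3) by (auto simp: exploration_state_def)
  have "closed_class R Q K"
  proof (rule closed_class_intro)
    show "b \<in> K" if "a \<in> K" "R a b" for a b
      using that R(1)[of a b] R(2)[of a b] 0(7)[of b a] 0(4) AU by blast
  qed (use 0 in auto)
  then show ?case using AU by simp
next
  case (Suc m)
  define v where "v = pick A U"
  define D where "D = {j \<in> U - {v}. R v j}"
  note v = pick_in[OF Suc.prems(1,2), folded v_def]
  have st: "exploration_state V (insert v P) (A - {v} \<union> D) (U - {v} - D)" "card (V - insert v P) = m"
    by (rule exploration_state_step[OF Suc.prems(1,2) v_def]; auto simp: D_def)+
  have s: "V = P \<union> A \<union> U" "P \<inter> A = {}" "P \<inter> U = {}" "A \<inter> U = {}"
    using Suc.prems(1) by (auto simp: exploration_state_def)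
  show ?case
  proof (cases "A = {}")
    case True
    have PQ: "P = Q \<union> K" using Suc.prems(3) True by simp
    have PU: "b \<in> P" if "a \<in> P" "R a b" for a b
      using Suc.prems(6)[of a b] that R(2)[of a b] s True by blast
    have "closed_class R Q K"
    proof (rule closed_class_intro)
      show "b \<in> K" if "a \<in> K" "R a b" for a b
        using that R(1)[of a b] Suc.prems(7)[of b a] PU[of a b] Suc.prems(4) PQ by blast
    qed (use Suc.prems in auto)
    moreover have "peels (closed_class R) V (Q \<union> K) (explore (\<lambda>_. R) m (insert v P) (A - {v} \<union> D) (U - {v} - D) ({v} \<union> D))"
    proof (rule Suc.IH[OF st])
      show "insert v P \<union> (A - {v} \<union> D) = Q \<union> K \<union> ({v} \<union> D)" using PQ True by auto
      show "(Q \<union> K) \<inter> ({v} \<union> D) = {}" using v(4) s PQ by (auto simp: D_def)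
      show "Q \<union> K \<subseteq> insert v P" using PQ by auto
      show "\<not> R a b" if "a \<in> insert v P" "b \<in> U - {v} - D" for a b
        using that Suc.prems(6)[of a b] by (auto simp: D_def)
      show "\<not> R a b" if "a \<in> Q \<union> K" "b \<notin> Q \<union> K" for a b
        using that PU[of a b] PQ by auto
      show "v \<in> {v} \<union> D" by simp
      show "R\<^sup>*\<^sup>* v y" if "y \<in> {v} \<union> D" for y using that by (auto simp: D_def)
    qed
    ultimately show ?thesis unfolding explore_step[where h = "\<lambda>_. R", OF v_def D_def refl] using True by simp
  next
    case False
    have vA: "v \<in> A" "v \<in> K" using v(2)[OF False] Suc.prems(3,5) s by auto
    have "peels (closed_class R) V Q (explore (\<lambda>_. R) m (insert v P) (A - {v} \<union> D) (U - {v} - D) (K \<union> D))"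
    proof (rule Suc.IH[OF st])
      show "insert v P \<union> (A - {v} \<union> D) = Q \<union> (K \<union> D)" using Suc.prems(3) vA by auto
      show "Q \<inter> (K \<union> D) = {}" using Suc.prems(4,5) s by (auto simp: D_def)
      show "Q \<subseteq> insert v P" using Suc.prems(5) by auto
      show "\<not> R a b" if "a \<in> insert v P" "b \<in> U - {v} - D" for a b
        using that Suc.prems(6)[of a b] by (auto simp: D_def)
      show "\<not> R a b" if "a \<in> Q" "b \<notin> Q" for a b using that Suc.prems(7) by auto
      show "r \<in> K \<union> D" using Suc.prems(8) by simp
      show "R\<^sup>*\<^sup>* r y" if "y \<in> K \<union> D" for y
        using that Suc.prems(9)[of y] Suc.prems(9)[of v] vA by (auto simp: D_def intro: rtranclp.rtrancl_into_rtrancl)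
    qed
    then show ?thesis unfolding explore_step[where h = "\<lambda>_. R", OF v_def D_def refl] using False by simp
  qed
qed

lemma sum_Un_le:
  fixes w :: "'a \<Rightarrow> real"
  assumes "finite A" "finite B" "\<And>i. 0 \<le> w i"
  shows "sum w (A \<union> B) \<le> sum w A + sum w B"
  using assms by (simp add: sum_Un sum_nonneg)

text \<open>What a clock-driven exploration guarantees for a component \<open>K\<close> found after \<open>Q\<close>, where \<open>T s\<close> is the set of
vertices whose clock has rung by time \<open>s\<close> and time is the total weight of the processed vertices.
When a component is complete, all vertices whose clocks have rung are processed; this forces
\<open>sum w (T s) \<le> s\<close> at \<open>s = sum w (Q \<union> K)\<close>. Conversely, while the component is being explored,
the weight processed at any time \<open>x\<close> is paid for by \<open>Q\<close>, by the root and by the clocks that have rung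
by then.\<close>

definition found_by where
  "found_by w T V Q K \<longleftrightarrow> Q \<union> K \<subseteq> V \<and> Q \<inter> K = {} \<and> T (sum w Q) \<subseteq> Q \<and> T (sum w (Q \<union> K)) \<subseteq> Q \<union> K \<and>
    Min (V - Q) \<in> K \<and> K \<subseteq> {Min (V - Q)} \<union> T (sum w (Q \<union> K)) \<and>
    (\<forall>x. sum w Q \<le> x \<longrightarrow> x < sum w (Q \<union> K) \<longrightarrow> x \<le> sum w Q + w (Min (V - Q)) + sum w (T x - Q))"

lemma explore_found_by:
  fixes w :: "nat \<Rightarrow> real" and T :: "real \<Rightarrow> nat set"
  assumes w: "\<And>i. 0 \<le> w i"
    and T: "\<And>s s'. s \<le> s' \<Longrightarrow> T s \<subseteq> T s'" "\<And>s. T s \<subseteq> V"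
    and h: "\<And>P v j. P \<subseteq> V \<Longrightarrow> v \<in> V - P \<Longrightarrow> j \<in> V - insert v P \<Longrightarrow> j \<notin> T (sum w P) \<Longrightarrow> h P v j \<longleftrightarrow> j \<in> T (sum w P + w v)"
    and "exploration_state V P A U" "card (V - P) = m"
    and "P \<union> A = Q \<union> K" "Q \<inter> K = {}" "Q \<subseteq> P"
    and "Min (V - Q) \<in> K" "T (sum w Q) \<subseteq> Q" "T (sum w P) \<inter> U = {}" "K \<subseteq> {Min (V - Q)} \<union> T (sum w P)"
    and "\<And>x. sum w Q \<le> x \<Longrightarrow> x < sum w P \<Longrightarrow> x \<le> sum w Q + w (Min (V - Q)) + sum w (T x - Q)"
  shows "peels (found_by w T V) V Q (explore h m P A U K)"
  using assms(5-)
proof (induction m arbitrary: P A U K Q)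
  case 0
  have AU: "A = {}" "U = {}" "V = Q \<union> K" "P = Q \<union> K"
    using exploration_state_empty[OF 0(1,2)] 0(1,3) by (auto simp: exploration_state_def)
  have "found_by w T V Q K" unfolding found_by_def using 0 T(2) AU by auto
  then show ?case using AU by simp
next
  case (Suc m)
  define v where "v = pick A U"
  define D where "D = {j \<in> U - {v}. h P v j}"
  note v = pick_in[OF Suc.prems(1,2), folded v_def]
  have st: "exploration_state V (insert v P) (A - {v} \<union> D) (U - {v} - D)" "card (V - insert v P) = m"
    by (rule exploration_state_step[OF Suc.prems(1,2) v_def]; auto simp: D_def)+
  have s: "V = P \<union> A \<union> U" "P \<inter> A = {}" "P \<inter> U = {}" "A \<inter> U = {}" "finite V"
    using Suc.prems(1) by (auto simp: exploration_state_def)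
  have finP: "finite P" using s by auto
  have wP: "sum w (insert v P) = sum w P + w v" using v(4) finP by (simp add: add.commute)
  have TU: "j \<notin> T (sum w P)" if "j \<in> U" for j using Suc.prems(8) that by auto
  have Dh: "D = {j \<in> U - {v}. j \<in> T (sum w (insert v P))}"
  proof -
    have "h P v j \<longleftrightarrow> j \<in> T (sum w P + w v)" if "j \<in> U - {v}" for j
      by (rule h) (use that v(4) s TU in auto)
    then show ?thesis unfolding D_def wP by auto
  qed
  have TU': "T (sum w (insert v P)) \<inter> (U - {v} - D) = {}" using Dh by auto
  show ?case
  proof (cases "A = {}")
    case True
    have PQ: "P = Q \<union> K" using Suc.prems(3) True by simp
    have TP: "T (sum w P) \<subseteq> P" using T(2) TU s True by blast
    have vm: "v = Min (V - P)"
    proof -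
      have "V - P = U" using s True by auto
      then show ?thesis using True by (simp add: v_def pick_def)
    qed
    have "found_by w T V Q K"
      unfolding found_by_def using Suc.prems TP s(1) PQ by auto
    moreover have "peels (found_by w T V) V (Q \<union> K) (explore h m (insert v P) (A - {v} \<union> D) (U - {v} - D) ({v} \<union> D))"
    proof (rule Suc.IH[OF st])
      show "insert v P \<union> (A - {v} \<union> D) = Q \<union> K \<union> ({v} \<union> D)" using PQ True by auto
      show "(Q \<union> K) \<inter> ({v} \<union> D) = {}" using v(4) s PQ by (auto simp: D_def)
      show "Q \<union> K \<subseteq> insert v P" using PQ by auto
      show "Min (V - (Q \<union> K)) \<in> {v} \<union> D" using vm PQ by simp
      show "T (sum w (Q \<union> K)) \<subseteq> Q \<union> K" using TP PQ by simp
      show "T (sum w (insert v P)) \<inter> (U - {v} - D) = {}" by (rule TU')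
      show "{v} \<union> D \<subseteq> {Min (V - (Q \<union> K))} \<union> T (sum w (insert v P))" using vm PQ Dh by auto
      fix x assume x: "sum w (Q \<union> K) \<le> x" "x < sum w (insert v P)"
      have "0 \<le> sum w (T x - (Q \<union> K))" by (intro sum_nonneg) (use w in auto)
      then show "x \<le> sum w (Q \<union> K) + w (Min (V - (Q \<union> K))) + sum w (T x - (Q \<union> K))"
        using x wP vm PQ by auto
    qed
    ultimately show ?thesis unfolding explore_step[where h = h, OF v_def D_def refl] using True by simp
  next
    case False
    have vA: "v \<in> A" "v \<in> K" using v(2)[OF False] Suc.prems(3,5) s by auto
    have "peels (found_by w T V) V Q (explore h m (insert v P) (A - {v} \<union> D) (U - {v} - D) (K \<union> D))"
    proof (rule Suc.IH[OF st])
      have mono: "T (sum w P) \<subseteq> T (sum w (insert v P))" by (rule T(1)) (use wP w in auto)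
      show "insert v P \<union> (A - {v} \<union> D) = Q \<union> (K \<union> D)" using Suc.prems(3) vA by auto
      show "Q \<inter> (K \<union> D) = {}" using Suc.prems(4,5) s by (auto simp: D_def)
      show "Q \<subseteq> insert v P" using Suc.prems(5) by auto
      show "Min (V - Q) \<in> K \<union> D" using Suc.prems(6) by simp
      show "T (sum w Q) \<subseteq> Q" using Suc.prems(7) .
      show "T (sum w (insert v P)) \<inter> (U - {v} - D) = {}" by (rule TU')
      show "K \<union> D \<subseteq> {Min (V - Q)} \<union> T (sum w (insert v P))" using Suc.prems(9) mono Dh by auto
      fix x assume x: "sum w Q \<le> x" "x < sum w (insert v P)"
      show "x \<le> sum w Q + w (Min (V - Q)) + sum w (T x - Q)"
      proof (cases "x < sum w P")
        case True
        then show ?thesis using Suc.prems(10) x by simp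
      next
        case False
        then have "T (sum w P) \<subseteq> T x" by (intro T(1)) simp
        then have sub: "insert v P \<subseteq> Q \<union> ({Min (V - Q)} \<union> (T x - Q))" using Suc.prems(3,9) vA by blast
        have fT: "finite (T x)" using T(2) s(5) finite_subset by blast
        have fQ: "finite Q" using Suc.prems(5) finP finite_subset by blast
        have "sum w (insert v P) \<le> sum w (Q \<union> ({Min (V - Q)} \<union> (T x - Q)))"
          by (rule sum_mono2) (use sub fT fQ w in auto)
        also have "\<dots> \<le> sum w Q + sum w ({Min (V - Q)} \<union> (T x - Q))"
          by (rule sum_Un_le) (use fT fQ w in auto)
        also have "sum w ({Min (V - Q)} \<union> (T x - Q)) \<le> sum w {Min (V - Q)} + sum w (T x - Q)"
          by (rule sum_Un_le) (use fT fQ w in auto)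
        finally show ?thesis using x by simp
      qed
    qed
    then show ?thesis unfolding explore_step[where h = h, OF v_def D_def refl] using False by simp
  qed
qed

lemma peels_append:
  "peels \<Phi> V Q (Ks @ Ls) \<longleftrightarrow> peels \<Phi> (Q \<union> \<Union>(set Ks)) Q Ks \<and> peels \<Phi> V (Q \<union> \<Union>(set Ks)) Ls"
  by (induction Ks arbitrary: Q) (auto simp: Un_assoc)

lemma peels_split: "peels \<Phi> V Q (Ks @ K # Ls) \<Longrightarrow> \<Phi> (Q \<union> \<Union>(set Ks)) K"
  by (simp add: peels_append)

lemma peels_Union: "peels \<Phi> V Q Ks \<Longrightarrow> Q \<union> \<Union>(set Ks) = V"
  by (induction Ks arbitrary: Q) (auto simp: Un_assoc)

text \<open>Each component starts at the time at which its predecessor is completed, so every \<open>t\<close> up to the total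
weight is passed by some component.\<close>

lemma peels_crossing:
  fixes t :: real
  assumes "peels \<Phi> V Q Ks" "sum w Q < t" "t \<le> sum w V"
  obtains Ks1 K Ks2 where "Ks = Ks1 @ K # Ks2" "sum w (Q \<union> \<Union>(set Ks1)) < t" "t \<le> sum w (Q \<union> \<Union>(set Ks1) \<union> K)"
  using assms
proof (induction Ks arbitrary: Q thesis)
  case Nil
  then show ?case by simp
next
  case (Cons K Ks)
  show ?case
  proof (cases "t \<le> sum w (Q \<union> K)")
    case True
    then show ?thesis using Cons.prems(1)[of "[]" K Ks] Cons.prems(3) by simp
  next
    case False
    show ?thesis
    proof (rule Cons.IH[of "Q \<union> K"])
      show "peels \<Phi> V (Q \<union> K) Ks" using Cons.prems(2) by simp
      show "sum w (Q \<union> K) < t" "t \<le> sum w V" using False Cons.prems by auto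
      fix Ks1 K' Ks2
      assume "Ks = Ks1 @ K' # Ks2" "sum w (Q \<union> K \<union> \<Union> (set Ks1)) < t" "t \<le> sum w (Q \<union> K \<union> \<Union> (set Ks1) \<union> K')"
      then show ?thesis using Cons.prems(1)[of "K # Ks1" K' Ks2] by (simp add: Un_assoc)
    qed
  qed
qed

lemma peels_closed_class_distinct:
  assumes "peels (closed_class R) V Q Ks"
  shows "distinct Ks \<and> (\<forall>K\<in>set Ks. K \<noteq> {} \<and> K \<inter> Q = {})"
  using assms by (induction Ks arbitrary: Q) (fastforce simp: closed_class_def)+

lemma peels_closed_class:
  assumes R: "\<And>a b. R a b \<Longrightarrow> R b a" and p: "peels (closed_class R) V {} Ks"
  shows "distinct Ks" "set Ks = (\<lambda>u. {v \<in> V. R\<^sup>*\<^sup>* u v}) ` V"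
proof -
  show "distinct Ks" using peels_closed_class_distinct[OF p] by simp
  have V: "\<Union>(set Ks) = V" using peels_Union[OF p] by simp
  have cl: "\<exists>r\<in>K. K = {y. R\<^sup>*\<^sup>* r y}" if "K \<in> set Ks" for K
  proof -
    from that obtain a b where "Ks = a @ K # b" by (auto simp: in_set_conv_decomp)
    then show ?thesis using peels_split[of "closed_class R" V "{}" a K b] p by (auto simp: closed_class_def)
  qed
  have sym: "R\<^sup>*\<^sup>* b a" if "R\<^sup>*\<^sup>* a b" for a b
    using that by (induction rule: rtranclp_induct) (auto intro: converse_rtranclp_into_rtranclp R)
  have eq: "K = {v \<in> V. R\<^sup>*\<^sup>* u v}" if K: "K \<in> set Ks" "u \<in> K" for K u
  proof -
    obtain r where r: "K = {y. R\<^sup>*\<^sup>* r y}" using cl[OF K(1)] by auto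
    have "R\<^sup>*\<^sup>* r u" using K(2) r by simp
    then have "R\<^sup>*\<^sup>* r y \<longleftrightarrow> R\<^sup>*\<^sup>* u y" for y using sym by (meson rtranclp_trans)
    moreover have "K \<subseteq> V" using K(1) V by auto
    ultimately show ?thesis using r by auto
  qed
  show "set Ks = (\<lambda>u. {v \<in> V. R\<^sup>*\<^sup>* u v}) ` V"
  proof (rule set_eqI, rule iffI)
    fix K assume K: "K \<in> set Ks"
    obtain r where "r \<in> K" using cl[OF K] by auto
    then show "K \<in> (\<lambda>u. {v \<in> V. R\<^sup>*\<^sup>* u v}) ` V" using eq[OF K] K V by (metis (lifting) UnionI imageI)
  next
    fix K assume "K \<in> (\<lambda>u. {v \<in> V. R\<^sup>*\<^sup>* u v}) ` V"
    then obtain u where u: "u \<in> V" "K = {v \<in> V. R\<^sup>*\<^sup>* u v}" by auto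
    then obtain L where "L \<in> set Ks" "u \<in> L" using V by auto
    then show "K \<in> set Ks" using eq[of L u] u by simp
  qed
qed

section \<open>Recognising the giant component from the clocks\<close>

definition dominant_class :: "real \<Rightarrow> real \<Rightarrow> real \<Rightarrow> nat set set \<Rightarrow> bool" where
  "dominant_class lo hi B \<C> \<longleftrightarrow> (\<exists>K\<in>\<C>. lo \<le> real (card K) \<and> real (card K) \<le> hi \<and> (\<forall>K'\<in>\<C> - {K}. real (card K') \<le> B))"

text \<open>If one class dominates all others, sorting the sizes puts it first and leaves only sizes at most
\<open>B\<close> behind it.\<close>

lemma component_size_dominant:
  assumes dom: "dominant_class lo hi B (components n E)" and "B \<le> lo" "0 \<le> B"
  shows "lo \<le> real (component_size n E 1)" "real (component_size n E 1) \<le> hi"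
    and "j \<ge> 2 \<Longrightarrow> real (component_size n E j) \<le> B"
proof -
  obtain C where C: "C \<in> components n E" "lo \<le> real (card C)" "real (card C) \<le> hi"
    and B: "\<And>C'. C' \<in> components n E - {C} \<Longrightarrow> real (card C') \<le> B"
    using dom by (auto simp: dominant_class_def)
  have fin: "finite (components n E)" by (simp add: components_def)
  define s where "s = ordered_component_sizes n E"
  have ms: "mset s = add_mset (card C) (image_mset card (mset_set (components n E - {C})))"
    unfolding s_def ordered_component_sizes_def
    using mset_set.remove[OF fin C(1)] by simp
  have srt: "sorted (rev s)" by (simp add: s_def ordered_component_sizes_def)
  have others: "real x \<le> B" if "x \<in># image_mset card (mset_set (components n E - {C}))" for x
    using that B fin by auto
  have sets: "x = card C \<or> real x \<le> B" if "x \<in> set s" for x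
    using that others by (metis insert_iff ms set_mset_add_mset_insert set_mset_mset)
  obtain x xs where s: "s = x # xs" using ms by (cases s) auto
  have ge: "y \<le> x" if "y \<in> set s" for y
    using srt that unfolding s by (auto simp: sorted_append)
  have "card C \<in> set s" using ms by (metis set_mset_mset union_single_eq_member)
  then have "card C \<le> x" by (rule ge)
  moreover have "x \<in> set s" by (simp add: s)
  then have "x = card C \<or> real x \<le> B" by (rule sets)
  ultimately have x: "x = card C" using C(2) assms(2) by auto
  then show "lo \<le> real (component_size n E 1)" "real (component_size n E 1) \<le> hi"
    using C by (simp_all add: component_size_def s_def[symmetric] s)
  have xs: "mset xs = image_mset card (mset_set (components n E - {C}))" using ms x s by simp
  show "real (component_size n E j) \<le> B" if j: "j \<ge> 2"
  proof (cases "j \<le> length s")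
    case True
    then have "s ! (j - 1) \<in> set xs" using j by (cases "j - 1") (auto simp: s)
    then have "real (s ! (j - 1)) \<le> B" using others xs by (metis set_mset_mset)
    then show ?thesis using True by (simp add: component_size_def s_def[symmetric] Let_def)
  next
    case False
    then show ?thesis using assms(3) by (simp add: component_size_def s_def[symmetric])
  qed
qed

text \<open>The deterministic heart of the argument. Write \<open>A s = sum w (T s)\<close>. A component can only be completed at
a time \<open>s\<close> with \<open>A s \<le> s\<close>, so by \<open>H1\<close> none is completed between \<open>t0\<close> and \<open>t1\<close>: the component that
passes \<open>t0\<close> lasts at least until \<open>t1\<close>. By \<open>H2\<close> it cannot last beyond \<open>t2\<close>, because by then too few
clocks have rung to pay for the processed weight. It is the dominant class. Earlier components
consist of vertices that are found before \<open>t0\<close>. Later ones last less than \<open>d\<close>, since by \<open>H3\<close> the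
function \<open>A\<close> grows too slowly to sustain an exploration for that long.

For the lower bound on the dominant class, the vertices found before it are either rung by \<open>t0\<close> or roots;
a root with index above \<open>q\<close> would mean that all of \<open>{1..q}\<close>, and hence weight at least \<open>t0\<close>, had been
processed before.\<close>

lemma peels_found_by_dominant:
  fixes w :: "nat \<Rightarrow> real" and T :: "real \<Rightarrow> nat set" and n :: nat
  defines "V \<equiv> {1..n}"
  assumes w: "\<And>i. 0 \<le> w i" "\<And>i. i \<in> V \<Longrightarrow> w i \<le> W"
    and T: "\<And>s s'. s \<le> s' \<Longrightarrow> T s \<subseteq> T s'" "\<And>s. T s \<subseteq> V"
    and peels: "peels (found_by w T V) V {} Ks"
    and t: "0 < t0" "t0 < t1" "t0 \<le> sum w V" "0 < d"
    and H1: "\<And>s. t0 \<le> s \<Longrightarrow> s < t1 \<Longrightarrow> s < sum w (T s)"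
    and H2: "sum w (T t2) + t0 + W < t2"
    and H3: "\<And>s. t1 \<le> s \<Longrightarrow> s \<le> sum w V \<Longrightarrow> sum w (T (s + d)) - sum w (T s) + W < d"
    and N: "real (card (T t0)) + 1 \<le> B" "real (card (T t2)) + 1 \<le> hi"
       "\<And>s. t1 \<le> s \<Longrightarrow> s \<le> sum w V \<Longrightarrow> real (card (T (s + d))) - real (card (T s)) + 1 \<le> B"
    and low: "lo + real (card (T t0)) + real q \<le> real (card (T t1))" "t0 \<le> sum w {1..q}" "q \<le> n"
  shows "dominant_class lo hi B (set Ks)"
proof -
  have finT: "finite (T s)" for s using T(2)[of s] finite_subset unfolding V_def by blast
  have W0: "0 \<le> W" 
  proof -
    obtain i where "i \<in> V" using t by (cases "V = {}") auto
    then show ?thesis using w(1)[of i] w(2)[of i] by linarith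
  qed
  obtain Ks1 K Ks2 where Ks: "Ks = Ks1 @ K # Ks2"
    and lt: "sum w ({} \<union> \<Union>(set Ks1)) < t0" and le: "t0 \<le> sum w ({} \<union> \<Union>(set Ks1) \<union> K)"
    by (rule peels_crossing[OF peels, of w t0]) (use t in auto)
  define Q where "Q = \<Union>(set Ks1)"
  define S where "S = sum w (Q \<union> K)"
  have QS: "sum w Q < t0" "t0 \<le> S" using lt le by (simp_all add: Q_def S_def)
  have f: "found_by w T V Q K" using peels_split[of "found_by w T V" V "{}" Ks1 K Ks2] peels Ks by (simp add: Q_def)
  note f' = f[unfolded found_by_def, folded S_def]
  have finV: "finite V" by (simp add: V_def)
  have finQK: "finite Q" "finite K" using f' finV finite_subset by auto
  have rV: "Min (V - Q') \<in> V" if "found_by w T V Q' K'" for Q' K'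
    using that unfolding found_by_def by auto
  have wr: "w (Min (V - Q')) \<le> W" if "found_by w T V Q' K'" for Q' K'
    using rV[OF that] w(2) by simp
  have sumsub: "sum w X \<le> sum w Y" if "X \<subseteq> Y" "Y \<subseteq> V" for X Y
    by (rule sum_mono2) (use that finV finite_subset w in auto)
  have cardsub: "card X \<le> card Y" if "X \<subseteq> Y" "Y \<subseteq> V" for X Y
    by (rule card_mono) (use that finV finite_subset in auto)
  have cardK: "real (card K') \<le> 1 + card (T x - X)"
    if "found_by w T V Q' K'" "sum w (Q' \<union> K') \<le> x" "X \<inter> K' = {}" for Q' K' x X
  proof -
    have "K' \<subseteq> {Min (V - Q')} \<union> (T x - X)"
      using that T(1)[OF that(2)] unfolding found_by_def by blast
    then have "card K' \<le> card ({Min (V - Q')} \<union> (T x - X))" by (rule card_mono[rotated]) (use finT in auto)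
    also have "\<dots> \<le> card {Min (V - Q')} + card (T x - X)" by (rule card_Un_le)
    finally show ?thesis by simp
  qed
  have t02: "t0 < t2" using H2 W0 sum_nonneg[of "T t2" w] w by simp
  have S1: "t1 \<le> S"
  proof (rule ccontr)
    assume "\<not> t1 \<le> S"
    then have "S < sum w (T S)" using H1 QS by simp
    moreover have "sum w (T S) \<le> S" unfolding S_def[of] by (rule sumsub) (use f' S_def in auto)
    ultimately show False by simp
  qed
  have S2: "S \<le> t2"
  proof (rule ccontr)
    assume "\<not> S \<le> t2"
    then have "t2 \<le> sum w Q + w (Min (V - Q)) + sum w (T t2 - Q)"
      using f' QS t02 by auto
    moreover have "sum w (T t2 - Q) \<le> sum w (T t2)" by (rule sumsub) (use T in auto)
    ultimately show False using H2 QS wr[OF f] by simp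
  qed
  have hi: "real (card K) \<le> hi"
    using cardK[OF f, of t2 "{}"] S2 N(2) by (simp add: S_def)
  have early: "\<exists>Q'. found_by w T V Q' K' \<and> Q' \<union> K' \<subseteq> Q" if "K' \<in> set Ks1" for K'
  proof -
    from that obtain a b where ab: "Ks1 = a @ K' # b" by (auto simp: in_set_conv_decomp)
    then have "found_by w T V (\<Union>(set a)) K'"
      using peels_split[of "found_by w T V" V "{}" a K' "b @ K # Ks2"] peels Ks by simp
    then show ?thesis using ab by (auto simp: Q_def)
  qed
  have QV: "Q \<subseteq> V" using f' by auto
  have lo: "lo \<le> real (card K)"
  proof -
    have "x \<in> {1..q} \<union> T t0" if x: "x \<in> Q" for x
    proof -
      obtain K' where "K' \<in> set Ks1" "x \<in> K'" using x by (auto simp: Q_def)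
      then obtain Q' where Q': "found_by w T V Q' K'" "Q' \<union> K' \<subseteq> Q" using early by blast
      have le: "sum w (Q' \<union> K') \<le> t0" "sum w Q' < t0"
        using sumsub[of "Q' \<union> K'" Q] sumsub[of Q' Q] Q' QS QV by auto
      have "Min (V - Q') \<le> q"
      proof (rule ccontr)
        assume "\<not> Min (V - Q') \<le> q"
        then have "i \<in> Q'" if "i \<in> {1..q}" for i
        proof -
          have "finite (V - Q')" using finV by simp
          then have "Min (V - Q') \<le> i" if "i \<in> V - Q'" using that by (rule Min_le)
          then have "i \<notin> V - Q'" using that \<open>\<not> Min (V - Q') \<le> q\<close> by fastforce
          then show ?thesis using that low(3) by (auto simp: V_def)
        qed
        then have "sum w {1..q} \<le> sum w Q'" by (intro sumsub) (use Q' QV in auto)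
        then show False using le low(2) by simp
      qed
      moreover have "1 \<le> Min (V - Q')" using rV[OF Q'(1)] by (simp add: V_def)
      moreover have "x = Min (V - Q') \<or> x \<in> T (sum w (Q' \<union> K'))"
        using Q'(1) \<open>x \<in> K'\<close> unfolding found_by_def by blast
      ultimately show ?thesis using T(1)[OF le(1)] by auto
    qed
    then have "Q \<subseteq> {1..q} \<union> T t0" by blast
    then have "card Q \<le> card ({1..q} \<union> T t0)" by (rule card_mono[rotated]) (use finT in auto)
    also have "\<dots> \<le> q + card (T t0)" using card_Un_le[of "{1..q}" "T t0"] by simp
    finally have cQ: "card Q \<le> q + card (T t0)" .
    have "T t1 \<subseteq> Q \<union> K" using T(1)[OF S1] f' by blast
    then have "card (T t1) \<le> card (Q \<union> K)" by (rule card_mono[rotated]) (use finQK in auto)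
    also have "\<dots> \<le> card Q + card K" by (rule card_Un_le)
    finally show ?thesis using cQ low(1) by linarith
  qed
  have "real (card K') \<le> B" if K': "K' \<in> set Ks1" for K'
  proof -
    obtain Q' where Q': "found_by w T V Q' K'" "Q' \<union> K' \<subseteq> Q" using early[OF K'] by blast
    then have "sum w (Q' \<union> K') \<le> t0" using sumsub[of "Q' \<union> K'" Q] QS QV by auto
    then show ?thesis using cardK[OF Q'(1), of t0 "{}"] N(1) by simp
  qed
  moreover have "real (card K') \<le> B" if K': "K' \<in> set Ks2" for K'
  proof -
    from K' obtain a b where ab: "Ks2 = a @ K' # b" by (auto simp: in_set_conv_decomp)
    define Q' where "Q' = Q \<union> K \<union> \<Union>(set a)"
    have f2: "found_by w T V Q' K'"
      using peels_split[of "found_by w T V" V "{}" "Ks1 @ K # a" K' b] peels Ks ab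
      by (simp add: Q_def Q'_def Un_ac)
    note f2' = f2[unfolded found_by_def]
    define s where "s = sum w Q'"
    have "S \<le> s" unfolding S_def s_def by (rule sumsub) (use f2' in \<open>auto simp: Q'_def\<close>)
    then have s1: "t1 \<le> s" using S1 by simp
    have sV: "s \<le> sum w V" unfolding s_def by (rule sumsub) (use f2' in auto)
    have mono: "T s \<subseteq> T (s + d)" by (rule T(1)) (use t in simp)
    have "sum w (Q' \<union> K') \<le> s + d"
    proof (rule ccontr)
      assume "\<not> sum w (Q' \<union> K') \<le> s + d"
      then have "s + d \<le> s + w (Min (V - Q')) + sum w (T (s + d) - Q')"
        using f2' t by (auto simp: s_def)
      moreover have "sum w (T (s + d) - Q') \<le> sum w (T (s + d) - T s)"
        by (rule sumsub) (use f2' T in \<open>auto simp: s_def\<close>)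
      moreover have "sum w (T (s + d) - T s) = sum w (T (s + d)) - sum w (T s)"
        by (rule sum_diff[OF finT mono])
      ultimately show False using H3[OF s1 sV] wr[OF f2] by simp
    qed
    then have 1: "real (card K') \<le> 1 + card (T (s + d) - T s)"
      by (rule cardK[OF f2]) (use f2' in \<open>auto simp: s_def\<close>)
    have 2: "card (T (s + d) - T s) = card (T (s + d)) - card (T s)"
      by (rule card_Diff_subset[OF finT mono])
    have 3: "card (T s) \<le> card (T (s + d))"
      by (rule card_mono[OF finT mono])
    show ?thesis using 1 2 3 N(3)[OF s1 sV] by (simp add: of_nat_diff)
  qed
  ultimately show ?thesis unfolding dominant_class_def using hi lo Ks by auto
qed

section \<open>Clocks that ring at exponential times\<close>

text \<open>Conditionally on the other coordinates, the cross term with a single centred coordinate integrates to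
zero, so only the variances of the summands remain.\<close>

lemma nn_integral_centred_sum_squared:
  assumes "finite J" "\<And>j. j \<in> J \<Longrightarrow> 0 \<le> \<rho> j \<and> \<rho> j \<le> 1"
  shows "(\<integral>\<^sup>+g. ennreal ((\<Sum>j\<in>J. a j * (of_bool (g j) - \<rho> j))\<^sup>2) \<partial>measure_pmf (Pi_pmf J False (\<lambda>j. bernoulli_pmf (\<rho> j))))
      = ennreal (\<Sum>j\<in>J. (a j)\<^sup>2 * \<rho> j * (1 - \<rho> j))"
  using assms
proof (induction J rule: finite_induct)
  case empty
  then show ?case by simp
next
  case (insert x J)
  let ?P = "\<lambda>J. Pi_pmf J False (\<lambda>j. bernoulli_pmf (\<rho> j))"
  let ?Z = "\<lambda>J g. (\<Sum>j\<in>J. a j * (of_bool (g j) - \<rho> j))"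
  have \<rho>: "0 \<le> \<rho> x" "\<rho> x \<le> 1" using insert.prems by auto
  have upd: "?Z (insert x J) (g(x := y)) = a x * (of_bool y - \<rho> x) + ?Z J g" for g y
  proof -
    have "?Z J (g(x := y)) = ?Z J g" by (intro sum.cong refl) (use insert.hyps in auto)
    then show ?thesis using insert.hyps by simp
  qed
  have inner: "(\<integral>\<^sup>+y. ennreal ((a x * (of_bool y - \<rho> x) + z)\<^sup>2) \<partial>measure_pmf (bernoulli_pmf (\<rho> x)))
     = ennreal ((a x)\<^sup>2 * \<rho> x * (1 - \<rho> x)) + ennreal (z\<^sup>2)" for z
  proof -
    have "(\<integral>\<^sup>+y. ennreal ((a x * (of_bool y - \<rho> x) + z)\<^sup>2) \<partial>measure_pmf (bernoulli_pmf (\<rho> x)))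
       = ennreal ((a x * (1 - \<rho> x) + z)\<^sup>2 * \<rho> x + (a x * (0 - \<rho> x) + z)\<^sup>2 * (1 - \<rho> x))"
      using \<rho> by (simp add: ennreal_mult ennreal_plus)
    also have "(a x * (1 - \<rho> x) + z)\<^sup>2 * \<rho> x + (a x * (0 - \<rho> x) + z)\<^sup>2 * (1 - \<rho> x)
       = (a x)\<^sup>2 * \<rho> x * (1 - \<rho> x) + z\<^sup>2"
      by (simp add: power2_eq_square algebra_simps)
    finally show ?thesis using \<rho> by (simp add: ennreal_plus)
  qed
  have "(\<integral>\<^sup>+g. ennreal ((?Z (insert x J) g)\<^sup>2) \<partial>measure_pmf (?P (insert x J)))
     = (\<integral>\<^sup>+g. \<integral>\<^sup>+y. ennreal ((?Z (insert x J) (g(x := y)))\<^sup>2) \<partial>measure_pmf (bernoulli_pmf (\<rho> x)) \<partial>measure_pmf (?P J))"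
    unfolding Pi_pmf_insert'[OF insert.hyps(1,2)] by (subst bind_commute_pmf) simp
  also have "\<dots> = (\<integral>\<^sup>+g. ennreal ((a x)\<^sup>2 * \<rho> x * (1 - \<rho> x)) + ennreal ((?Z J g)\<^sup>2) \<partial>measure_pmf (?P J))"
    unfolding upd inner ..
  also have "\<dots> = ennreal ((a x)\<^sup>2 * \<rho> x * (1 - \<rho> x)) + ennreal (\<Sum>j\<in>J. (a j)\<^sup>2 * \<rho> j * (1 - \<rho> j))"
    using insert.IH insert.prems by (subst nn_integral_add) auto
  also have "\<dots> = ennreal (\<Sum>j\<in>insert x J. (a j)\<^sup>2 * \<rho> j * (1 - \<rho> j))"
    using insert \<rho> by (subst ennreal_plus[symmetric]) (auto intro!: sum_nonneg)
  finally show ?case .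
qed

lemma Chebyshev_Pi_bernoulli:
  fixes a \<rho> :: "'a \<Rightarrow> real"
  assumes J: "finite J" "\<And>j. j \<in> J \<Longrightarrow> 0 \<le> \<rho> j \<and> \<rho> j \<le> 1" and t: "0 < t"
  shows "measure_pmf.prob (Pi_pmf J False (\<lambda>j. bernoulli_pmf (\<rho> j))) {g. t \<le> \<bar>sum a {j \<in> J. g j} - (\<Sum>j\<in>J. a j * \<rho> j)\<bar>}
     \<le> (\<Sum>j\<in>J. (a j)\<^sup>2 * \<rho> j * (1 - \<rho> j)) / t\<^sup>2"
proof -
  let ?P = "Pi_pmf J False (\<lambda>j. bernoulli_pmf (\<rho> j))"
  let ?Z = "\<lambda>g. (\<Sum>j\<in>J. a j * (of_bool (g j) - \<rho> j))"
  let ?E = "{g. t \<le> \<bar>sum a {j \<in> J. g j} - (\<Sum>j\<in>J. a j * \<rho> j)\<bar>}"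
  have Z: "sum a {j \<in> J. g j} - (\<Sum>j\<in>J. a j * \<rho> j) = ?Z g" for g
  proof -
    have "sum a {j \<in> J. g j} = (\<Sum>j\<in>J. a j * of_bool (g j))"
      by (subst sum.inter_filter[OF J(1)]) (auto intro!: sum.cong)
    then show ?thesis by (simp add: sum_subtractf algebra_simps)
  qed
  have V0: "0 \<le> (\<Sum>j\<in>J. (a j)\<^sup>2 * \<rho> j * (1 - \<rho> j))" using J by (auto intro!: sum_nonneg)
  have "ennreal (t\<^sup>2 * measure_pmf.prob ?P ?E) = ennreal (t\<^sup>2) * emeasure (measure_pmf ?P) ?E"
    by (simp add: ennreal_mult measure_pmf.emeasure_eq_measure)
  also have "\<dots> = (\<integral>\<^sup>+g. ennreal (t\<^sup>2) * indicator ?E g \<partial>measure_pmf ?P)"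
    by (simp add: nn_integral_cmult_indicator)
  also have "\<dots> \<le> (\<integral>\<^sup>+g. ennreal ((?Z g)\<^sup>2) \<partial>measure_pmf ?P)"
  proof (rule nn_integral_mono)
    fix g
    have "t\<^sup>2 \<le> (?Z g)\<^sup>2" if "g \<in> ?E"
    proof -
      have "t \<le> \<bar>?Z g\<bar>" using that unfolding Z by simp
      then have "t\<^sup>2 \<le> \<bar>?Z g\<bar>\<^sup>2" using t by (intro power_mono) auto
      then show ?thesis by simp
    qed
    then show "ennreal (t\<^sup>2) * indicator ?E g \<le> ennreal ((?Z g)\<^sup>2)"
      by (auto simp: indicator_def intro!: ennreal_leI)
  qed
  also have "\<dots> = ennreal (\<Sum>j\<in>J. (a j)\<^sup>2 * \<rho> j * (1 - \<rho> j))"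
    by (rule nn_integral_centred_sum_squared[OF J])
  finally have "t\<^sup>2 * measure_pmf.prob ?P ?E \<le> (\<Sum>j\<in>J. (a j)\<^sup>2 * \<rho> j * (1 - \<rho> j))"
    using V0 by (simp add: ennreal_le_iff)
  then show ?thesis using t by (simp add: field_simps)
qed

text \<open>The exploration only asks about finitely many times, namely sums of weights and the points of a finite
grid. It therefore suffices to have clocks with values in a finite set \<open>S\<close> of times; the gap that
precedes a time in \<open>S\<close> plays the role of the infinitesimal interval in which an exponential clock may
ring.\<close>

definition predecessor :: "real set \<Rightarrow> real \<Rightarrow> real" where
  "predecessor S x = Max {y \<in> S. y < x}"

lemma sum_gaps:
  assumes S: "finite S" and "a \<in> S" "b \<in> S" "a \<le> b"
  shows "(\<Sum>x\<in>{x \<in> S. a < x \<and> x \<le> b}. x - predecessor S x) = b - a"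
  using assms(3,4)
proof (induction "card {x \<in> S. x < b}" arbitrary: b rule: less_induct)
  case less
  show ?case
  proof (cases "a = b")
    case True
    then have "{x \<in> S. a < x \<and> x \<le> b} = {}" by auto
    then show ?thesis using True by (simp only: sum.empty)
  next
    case False
    define p where "p = predecessor S b"
    have fin: "finite {y \<in> S. y < b}" using S by simp
    have ab: "a \<in> {y \<in> S. y < b}" using False less.prems assms(2) by auto
    have p: "p \<in> S" "p < b" using Max_in[OF fin] ab unfolding p_def predecessor_def by blast+
    have ap: "y \<le> p" if "y \<in> S" "y < b" for y
      using Max_ge[OF fin, of y] that unfolding p_def predecessor_def by simp
    have "card {x \<in> S. x < p} < card {x \<in> S. x < b}"
      by (rule psubset_card_mono[OF fin]) (use p in auto)
    then have IH: "(\<Sum>x\<in>{x \<in> S. a < x \<and> x \<le> p}. x - predecessor S x) = p - a"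
      using less.hyps[of p] p ap[of a] ab by auto
    have eq: "{x \<in> S. a < x \<and> x \<le> b} = insert b {x \<in> S. a < x \<and> x \<le> p}"
    proof (intro set_eqI iffI)
      fix x assume "x \<in> {x \<in> S. a < x \<and> x \<le> b}"
      then show "x \<in> insert b {x \<in> S. a < x \<and> x \<le> p}" using ap[of x] by (cases "x = b") auto
    next
      fix x assume "x \<in> insert b {x \<in> S. a < x \<and> x \<le> p}"
      then show "x \<in> {x \<in> S. a < x \<and> x \<le> b}" using p ab less.prems by auto
    qed
    have "b \<notin> {x \<in> S. a < x \<and> x \<le> p}" using p by auto
    then show ?thesis unfolding eq using S IH by (simp add: p_def)
  qed
qed

text \<open>The clock of \<open>j\<close> ticks at \<open>x\<close> with the probability that a Poisson process of rate \<open>c * w j\<close> has a point in the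
gap before \<open>x\<close>. Hence it has not ticked by time \<open>s \<in> S\<close> with probability \<open>exp (- (c * w j * s))\<close>, as for an
exponential variable, and ticks in disjoint time intervals are independent, which replaces the lack of
memory.\<close>

definition tick_prob :: "real \<Rightarrow> (nat \<Rightarrow> real) \<Rightarrow> real set \<Rightarrow> nat \<times> real \<Rightarrow> real" where
  "tick_prob c w S = (\<lambda>(j, x). if x \<in> S \<and> 0 < x then 1 - exp (- (c * w j * (x - predecessor S x))) else 0)"

definition ticks :: "real \<Rightarrow> (nat \<Rightarrow> real) \<Rightarrow> real set \<Rightarrow> nat \<Rightarrow> (nat \<times> real \<Rightarrow> bool) pmf" where
  "ticks c w S n = Pi_pmf ({1..n} \<times> {x \<in> S. 0 < x}) False (\<lambda>i. bernoulli_pmf (tick_prob c w S i))"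

definition rung :: "real set \<Rightarrow> nat \<Rightarrow> (nat \<times> real \<Rightarrow> bool) \<Rightarrow> real \<Rightarrow> nat set" where
  "rung S n B s = {j \<in> {1..n}. \<exists>x\<in>S. 0 < x \<and> x \<le> s \<and> B (j, x)}"

lemma rung_mono: "s \<le> s' \<Longrightarrow> rung S n B s \<subseteq> rung S n B s'"
  unfolding rung_def by force

lemma rung_subset: "rung S n B s \<subseteq> {1..n}"
  unfolding rung_def by auto

lemma tick_prob_bounds:
  assumes "finite S" "0 \<in> S" "0 \<le> c" "\<And>j. 0 \<le> w j"
  shows "0 \<le> tick_prob c w S i \<and> tick_prob c w S i \<le> 1"
proof -
  obtain j x where i: "i = (j, x)" by (cases i)
  have "predecessor S x < x" if "x \<in> S" "0 < x"
  proof -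
    have "finite {y \<in> S. y < x}" "0 \<in> {y \<in> S. y < x}" using assms that by auto
    then have "Max {y \<in> S. y < x} \<in> {y \<in> S. y < x}" by (intro Max_in) auto
    then show ?thesis unfolding predecessor_def by auto
  qed
  then show ?thesis using assms by (auto simp: i tick_prob_def)
qed

lemma prod_tick_prob:
  assumes S: "finite S" "S \<subseteq> {0..}" and ab: "a \<in> S" "b \<in> S" "a \<le> b"
  shows "(\<Prod>i\<in>{j} \<times> {x \<in> S. a < x \<and> x \<le> b}. 1 - tick_prob c w S i) = exp (- (c * w j * (b - a)))"
proof -
  have "(\<Prod>i\<in>{j} \<times> {x \<in> S. a < x \<and> x \<le> b}. 1 - tick_prob c w S i)
     = (\<Prod>x\<in>{x \<in> S. a < x \<and> x \<le> b}. 1 - tick_prob c w S (j, x))"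
    by (subst prod.reindex_bij_betw[of "Pair j" "{x \<in> S. a < x \<and> x \<le> b}", symmetric]) (auto simp: bij_betw_def inj_on_def)
  also have "\<dots> = (\<Prod>x\<in>{x \<in> S. a < x \<and> x \<le> b}. exp (- (c * w j * (x - predecessor S x))))"
    using S ab by (intro prod.cong) (auto simp: tick_prob_def)
  also have "\<dots> = exp (- (c * w j * (\<Sum>x\<in>{x \<in> S. a < x \<and> x \<le> b}. x - predecessor S x)))"
    using S(1) by (simp add: exp_sum[symmetric] sum_negf sum_distrib_left)
  finally show ?thesis using sum_gaps[OF S(1) ab] by simp
qed

lemma rung_increment_law:
  assumes S: "finite S" "0 \<in> S" "S \<subseteq> {0..}" and c: "0 \<le> c" and w: "\<And>j. 0 \<le> w j"
    and s: "s \<in> S" "s' \<in> S" "s \<le> s'"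
  shows "map_pmf (\<lambda>B j. j \<in> rung S n B s' - rung S n B s) (ticks c w S n)
       = Pi_pmf {1..n} False (\<lambda>j. bernoulli_pmf (exp (- (c * w j * s)) - exp (- (c * w j * s'))))"
proof -
  define blk where "blk = (\<lambda>j::nat. {j} \<times> {x \<in> S. 0 < x})"
  define G where "G = (\<lambda>j (B :: nat \<times> real \<Rightarrow> bool). (\<exists>x\<in>S. 0 < x \<and> x \<le> s' \<and> B (j, x)) \<and> \<not> (\<exists>x\<in>S. 0 < x \<and> x \<le> s \<and> B (j, x)))"
  have I: "{1..n} \<times> {x \<in> S. 0 < x} = (\<Union>j\<in>{1..n}. blk j)" by (auto simp: blk_def)
  have finb: "finite (blk j)" for j using S(1) by (simp add: blk_def)
  have "map_pmf (\<lambda>B j. j \<in> rung S n B s' - rung S n B s) (ticks c w S n)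
     = map_pmf (\<lambda>B j. if j \<in> {1..n} then G j B else False) (Pi_pmf (\<Union>j\<in>{1..n}. blk j) False (\<lambda>i. bernoulli_pmf (tick_prob c w S i)))"
    unfolding ticks_def I by (rule map_pmf_cong) (auto simp: rung_def G_def fun_eq_iff)
  also have "\<dots> = Pi_pmf {1..n} False (\<lambda>j. map_pmf (G j) (Pi_pmf (blk j) False (\<lambda>i. bernoulli_pmf (tick_prob c w S i))))"
    by (rule Pi_pmf_blocks) (use finb in \<open>auto simp: disjoint_family_on_def blk_def G_def\<close>)
  also have "\<dots> = Pi_pmf {1..n} False (\<lambda>j. bernoulli_pmf (exp (- (c * w j * s)) - exp (- (c * w j * s'))))"
  proof (intro Pi_pmf_cong refl bool_pmf_eqI)
    fix j
    let ?P = "Pi_pmf (blk j) False (\<lambda>i. bernoulli_pmf (tick_prob c w S i))"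
    define N where "N = (\<lambda>s. Pi (blk j) (\<lambda>i. if snd i \<le> s then {False} else UNIV))"
    have PN: "measure_pmf.prob ?P (N u) = exp (- (c * w j * u))" if "u \<in> S" for u
    proof -
      have u0: "0 \<le> u" using that S(3) by auto
      have "measure_pmf.prob ?P (N u) = (\<Prod>i\<in>blk j. if snd i \<le> u then 1 - tick_prob c w S i else 1)"
        unfolding N_def measure_Pi_pmf_Pi[OF finb]
        by (intro prod.cong refl) (use tick_prob_bounds[OF S(1,2) c w] in \<open>auto simp: measure_pmf_single\<close>)
      also have "\<dots> = (\<Prod>i\<in>{i \<in> blk j. snd i \<le> u}. 1 - tick_prob c w S i)"
        by (rule prod.inter_filter[OF finb, symmetric])
      also have "{i \<in> blk j. snd i \<le> u} = {j} \<times> {x \<in> S. 0 < x \<and> x \<le> u}" by (auto simp: blk_def)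
      finally show ?thesis using prod_tick_prob[OF S(1,3,2) that u0] by simp
    qed
    have sub: "N s' \<subseteq> N s" using s(3) by (fastforce simp: N_def Pi_def split: if_splits)
    have "pmf (map_pmf (G j) ?P) True = measure_pmf.prob ?P (N s - N s')"
      unfolding pmf_map by (intro arg_cong[where f = "measure_pmf.prob ?P"]) (auto simp: G_def N_def blk_def Pi_def split: if_splits)
    also have "\<dots> = exp (- (c * w j * s)) - exp (- (c * w j * s'))"
      using sub PN s by (subst measure_pmf.finite_measure_Diff) auto
    finally have T: "pmf (map_pmf (G j) ?P) True = exp (- (c * w j * s)) - exp (- (c * w j * s'))" .
    have b: "0 \<le> exp (- (c * w j * s)) - exp (- (c * w j * s'))" "exp (- (c * w j * s)) - exp (- (c * w j * s')) \<le> 1"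
      using pmf_nonneg[of "map_pmf (G j) ?P" True] pmf_le_1[of "map_pmf (G j) ?P" True] unfolding T by auto
    show "pmf (map_pmf (G j) ?P) False = pmf (bernoulli_pmf (exp (- (c * w j * s)) - exp (- (c * w j * s')))) False"
      unfolding pmf_bool_False[of "map_pmf (G j) ?P"] T using b by simp
  qed
  finally show ?thesis .
qed

text \<open>Whether a clock rings for the first time between \<open>s\<close> and \<open>s'\<close> is independent of the other clocks, so sums over
the vertices for which this happens concentrate.\<close>

lemma rung_Chebyshev:
  fixes a :: "nat \<Rightarrow> real"
  assumes S: "finite S" "0 \<in> S" "S \<subseteq> {0..}" and c: "0 \<le> c" and w: "\<And>j. 0 \<le> w j"
    and s: "s \<in> S" "s' \<in> S" "s \<le> s'" and t: "0 < t"
  defines "\<rho> \<equiv> \<lambda>j. exp (- (c * w j * s)) - exp (- (c * w j * s'))"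
  shows "measure_pmf.prob (ticks c w S n) {B. t \<le> \<bar>sum a (rung S n B s') - sum a (rung S n B s) - (\<Sum>j=1..n. a j * \<rho> j)\<bar>}
     \<le> (\<Sum>j=1..n. (a j)\<^sup>2 * \<rho> j * (1 - \<rho> j)) / t\<^sup>2"
proof -
  let ?E = "{g. t \<le> \<bar>sum a {j \<in> {1..n}. g j} - (\<Sum>j=1..n. a j * \<rho> j)\<bar>}"
  have "sum a (rung S n B s') - sum a (rung S n B s) = sum a {j \<in> {1..n}. j \<in> rung S n B s' - rung S n B s}" for B
  proof -
    have "{j \<in> {1..n}. j \<in> rung S n B s' - rung S n B s} = rung S n B s' - rung S n B s"
      using rung_subset[of S n B s'] by auto
    moreover have "finite (rung S n B s')" by (rule finite_subset[OF rung_subset]) simp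
    ultimately show ?thesis
      using sum_diff[of "rung S n B s'" "rung S n B s" a] rung_mono[OF s(3)] by simp
  qed
  then have "measure_pmf.prob (ticks c w S n) {B. t \<le> \<bar>sum a (rung S n B s') - sum a (rung S n B s) - (\<Sum>j=1..n. a j * \<rho> j)\<bar>}
     = measure_pmf.prob (map_pmf (\<lambda>B j. j \<in> rung S n B s' - rung S n B s) (ticks c w S n)) ?E"
    by simp
  also have "\<dots> = measure_pmf.prob (Pi_pmf {1..n} False (\<lambda>j. bernoulli_pmf (\<rho> j))) ?E"
    unfolding rung_increment_law[OF S c w s] \<rho>_def ..
  also have "\<dots> \<le> (\<Sum>j=1..n. (a j)\<^sup>2 * \<rho> j * (1 - \<rho> j)) / t\<^sup>2"
  proof (rule Chebyshev_Pi_bernoulli[OF _ _ t])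
    fix j
    have "0 \<le> c * w j * s" "c * w j * s \<le> c * w j * s'" using S s c w by (auto intro!: mult_left_mono)
    then show "0 \<le> \<rho> j \<and> \<rho> j \<le> 1" unfolding \<rho>_def
      by (smt (verit) exp_ge_zero exp_le_cancel_iff exp_zero)
  qed auto
  finally show ?thesis .
qed

text \<open>The two explorations meet here. Processing \<open>v\<close> in the graph discovers \<open>j\<close> if the edge between them is
present; processing \<open>v\<close> after \<open>P\<close> by clocks discovers \<open>j\<close> if its clock ticks in the interval of length \<open>w v\<close>
after \<open>sum w P\<close>. Both have probability \<open>1 - exp (- (c * w v * w j))\<close> and use fresh randomness, so the lists of
components have the same law.\<close>

lemma dominant_class_prob_le:
  fixes w :: "nat \<Rightarrow> real"
  assumes n: "0 < n" and w: "\<And>j. 0 \<le> w j" "\<And>i. i \<in> {1..n} \<Longrightarrow> 0 < w i" and p: "0 \<le> p" "p \<le> 1"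
    and S: "finite S" "0 \<in> S" "S \<subseteq> {0..}" "\<And>X. X \<subseteq> {1..n} \<Longrightarrow> sum w X \<in> S"
    and bad: "\<And>B Ks. B \<notin> bad \<Longrightarrow> peels (found_by w (rung S n B) {1..n}) {1..n} {} Ks \<Longrightarrow> dominant_class lo hi b (set Ks)"
  shows "measure_pmf.prob (MNR_percolated n w p) {E. \<not> dominant_class lo hi b (components n E)}
     \<le> measure_pmf.prob (ticks (p / total_weight n w) w S n) bad"
proof -
  define V where "V = {1..n}"
  define c where "c = p / total_weight n w"
  have tw: "0 < total_weight n w"
    unfolding total_weight_def using w n by (intro sum_pos) auto
  then have c0: "0 \<le> c" using p by (simp add: c_def)
  define r where "r = (\<lambda>i j. 1 - exp (- (c * w i * w j)))"
  define q where "q = (\<lambda>(i, j). r i j)"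
  have q01: "0 \<le> q e \<and> q e \<le> 1" for e
    using c0 w(1) by (auto simp: q_def r_def split: prod.split)
  define PG where "PG = Pi_pmf (vertex_pairs n) False (\<lambda>e. bernoulli_pmf (q e))"
  define R where "R = (\<lambda>(g :: nat \<times> nat \<Rightarrow> bool) a b. g (a, b) \<or> g (b, a))"
  define comps where "comps = (\<lambda>g. (\<lambda>u. {v \<in> V. (R g)\<^sup>*\<^sup>* u v}) ` V)"
  have state: "exploration_state V {} {1} {2..n}" "card (V - {}) = n"
    using n by (auto simp: exploration_state_def V_def)
  have "Min V = 1" using n by (intro Min_eqI) (auto simp: V_def)

  \<comment> \<open>An edge is queried when its first endpoint is processed, and not again afterwards.\<close>
  have law: "map_pmf (\<lambda>E. (\<lambda>e. \<exists>k. (e, k) \<in> E)) (MNR_percolated n w p) = PG"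
    by (rule trans[OF percolated_simple_graph_law[OF w(2) p n]])
       (auto simp: q_def r_def c_def PG_def mult.assoc intro!: Pi_pmf_cong)
  have comps_E: "components n E = comps (\<lambda>e. \<exists>k. (e, k) \<in> E)" for E
  proof -
    have "(u, v) \<in> (adjacency E)\<^sup>* \<longleftrightarrow> (R (\<lambda>e. \<exists>k. (e, k) \<in> E))\<^sup>*\<^sup>* u v" for u v
      unfolding rtranclp_rtrancl_eq adjacency_def R_def by (auto simp: ex_disj_distrib)
    then show ?thesis by (simp add: components_def comps_def V_def)
  qed
  have "measure_pmf.prob (MNR_percolated n w p) {E. \<not> dominant_class lo hi b (components n E)}
     = measure_pmf.prob (map_pmf comps PG) {C. \<not> dominant_class lo hi b C}"
    unfolding law[symmetric] by (simp add: comps_E vimage_def)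
  define blk :: "nat set \<Rightarrow> nat \<Rightarrow> nat \<Rightarrow> (nat \<times> nat) set" where "blk = (\<lambda>P v j. {(min v j, max v j)})"
  define h where "h = (\<lambda>g P v j. \<exists>i\<in>blk P v j. g i :: bool)"
  have graph: "map_pmf (\<lambda>g. explore (h g) n {} {1} {2..n} {1}) PG = explore_pmf r n {1} {2..n} {1}"
    unfolding PG_def h_def
  proof (rule explore_law[OF _ _ q01 _ _ finite_vertex_pairs _ state])
    show "finite (blk P v j)" for P v j by (simp add: blk_def)
    show "blk P v i \<inter> blk P v j = {}" if "i \<noteq> j" for P v i j
      using that by (auto simp: blk_def min_def max_def split: if_splits)
    show "(\<Prod>i\<in>blk P v j. 1 - q i) = 1 - r v j" if "P \<subseteq> V" "v \<in> V - P" "j \<in> V - insert v P" for P v j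
      by (cases "v \<le> j") (auto simp: blk_def q_def r_def mult_ac)
    show "blk P v j \<inter> blk P' v' j' = {}"
      if "insert v P \<subseteq> P'" "P' \<subseteq> V" "v \<notin> P" "j \<in> V - insert v P" "v' \<in> V - P'" "j' \<in> V - insert v' P'" for P v j P' v' j'
      using that by (auto simp: blk_def min_def max_def split: if_splits)
    show "blk P' v j \<subseteq> vertex_pairs n" if "{} \<subseteq> P'" "P' \<subseteq> V" "v \<in> V - P'" "j \<in> V - insert v P'" for P' v j
      using that by (auto simp: blk_def vertex_pairs_def V_def min_def max_def)
  qed
  have comps_explore: "comps g = set (explore (h g) n {} {1} {2..n} {1})" if "g \<in> set_pmf PG" for g
  proof -
    have g: "g e \<Longrightarrow> e \<in> vertex_pairs n" for e
      using that set_Pi_pmf_subset[OF finite_vertex_pairs, of n False] unfolding PG_def by blast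
    have hR: "h g = (\<lambda>_. R g)"
    proof (intro ext)
      fix P a b
      show "h g P a b = R g a b"
        using g[of "(a, b)"] g[of "(b, a)"] by (auto simp: h_def blk_def R_def vertex_pairs_def min_def max_def)
    qed
    have sym: "R g x y \<Longrightarrow> R g y x" for x y by (auto simp: R_def)
    have RV: "R g x y \<Longrightarrow> x \<in> V \<and> y \<in> V" for x y
      using g[of "(x, y)"] g[of "(y, x)"] by (auto simp: R_def V_def vertex_pairs_def)
    have "peels (closed_class (R g)) V {} (explore (\<lambda>_. R g) n {} {1} {2..n} {1})"
      by (rule explore_components[OF sym RV state, where r = 1]) auto
    from peels_closed_class(2)[OF sym this] show ?thesis by (simp add: comps_def hR)
  qed

  \<comment> \<open>Processing \<open>v\<close> uses the ticks in the time interval from \<open>sum w P\<close> to \<open>sum w P + w v\<close>.\<close>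
  define blk' where "blk' = (\<lambda>P v j. {j :: nat} \<times> {x \<in> S. sum w P < x \<and> x \<le> sum w P + w v})"
  define h' where "h' = (\<lambda>B P v j. \<exists>i\<in>blk' P v j. B i :: bool)"
  have wsum: "0 \<le> sum w P" for P using w(1) by (intro sum_nonneg)
  have wins: "sum w (insert v P) = sum w P + w v" if "P \<subseteq> V" "v \<notin> P" for v P
    using that finite_subset[of P V] by (simp add: V_def)
  have clock: "map_pmf (\<lambda>B. explore (h' B) n {} {1} {2..n} {1}) (ticks c w S n) = explore_pmf r n {1} {2..n} {1}"
    unfolding ticks_def h'_def
  proof (rule explore_law[OF _ _ tick_prob_bounds[OF S(1,2) c0 w(1)] _ _ _ _ state])
    show "finite (blk' P v j)" for P v j using S(1) by (simp add: blk'_def)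
    show "blk' P v i \<inter> blk' P v j = {}" if "i \<noteq> j" for P v i j
      using that by (auto simp: blk'_def)
    show "(\<Prod>i\<in>blk' P v j. 1 - tick_prob c w S i) = 1 - r v j" if "P \<subseteq> V" "v \<in> V - P" "j \<in> V - insert v P" for P v j
    proof -
      have "sum w P \<in> S" "sum w P + w v \<in> S" "sum w P \<le> sum w P + w v"
        using S(4)[of P] S(4)[of "insert v P"] wins[of P v] that w(1) by (auto simp: V_def)
      from prod_tick_prob[OF S(1,3) this, where j = j and c = c and w = w] show ?thesis by (simp add: blk'_def r_def mult_ac)
    qed
    show "blk' P v j \<inter> blk' P' v' j' = {}"
      if *: "insert v P \<subseteq> P'" "P' \<subseteq> V" "v \<notin> P" "j \<in> V - insert v P" "v' \<in> V - P'" "j' \<in> V - insert v' P'" for P v j P' v' j'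
    proof -
      have "sum w P + w v = sum w (insert v P)" using wins[of P v] * by auto
      also have "\<dots> \<le> sum w P'" by (rule sum_mono2) (use * w finite_subset[of P' V] in \<open>auto simp: V_def\<close>)
      finally show ?thesis by (auto simp: blk'_def)
    qed
    show "finite ({1..n} \<times> {x \<in> S. 0 < x})" using S(1) by simp
    show "blk' P' v j \<subseteq> {1..n} \<times> {x \<in> S. 0 < x}" if "{} \<subseteq> P'" "P' \<subseteq> V" "v \<in> V - P'" "j \<in> V - insert v P'" for P' v j
      using that wsum[of P'] by (auto simp: blk'_def V_def)
  qed
  have found: "peels (found_by w (rung S n B) V) V {} (explore (h' B) n {} {1} {2..n} {1})" for B
  proof (rule explore_found_by[OF w(1) rung_mono _ _ state])
    have r0: "rung S n B 0 = {}" by (auto simp: rung_def)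
    show "rung S n B s \<subseteq> V" for s using rung_subset by (simp add: V_def)
    show "h' B P v j \<longleftrightarrow> j \<in> rung S n B (sum w P + w v)"
      if *: "P \<subseteq> V" "v \<in> V - P" "j \<in> V - insert v P" "j \<notin> rung S n B (sum w P)" for P v j
    proof
      assume "h' B P v j"
      then obtain x where "x \<in> S" "sum w P < x" "x \<le> sum w P + w v" "B (j, x)"
        by (auto simp: h'_def blk'_def)
      moreover from this have "0 < x" using wsum[of P] by linarith
      ultimately show "j \<in> rung S n B (sum w P + w v)" using *(3) by (auto simp: rung_def V_def)
    next
      assume "j \<in> rung S n B (sum w P + w v)"
      then obtain x where x: "x \<in> S" "0 < x" "x \<le> sum w P + w v" "B (j, x)"
        by (auto simp: rung_def)
      then have "sum w P < x" using *(3,4) by (auto simp: rung_def V_def not_le[symmetric])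
      then show "h' B P v j" using x by (auto simp: h'_def blk'_def)
    qed
    show "Min (V - {}) \<in> {1}" using \<open>Min V = 1\<close> by simp
    show "rung S n B (sum w {}) \<subseteq> {}" "rung S n B (sum w {}) \<inter> {2..n} = {}" using r0 by auto
    show "{1} \<subseteq> {Min (V - {})} \<union> rung S n B (sum w {})" using \<open>Min V = 1\<close> by simp
  qed auto

  have "measure_pmf.prob (MNR_percolated n w p) {E. \<not> dominant_class lo hi b (components n E)}
     = measure_pmf.prob (map_pmf comps PG) {C. \<not> dominant_class lo hi b C}" by fact
  also have "map_pmf comps PG = map_pmf set (map_pmf (\<lambda>g. explore (h g) n {} {1} {2..n} {1}) PG)"
    unfolding pmf.map_comp by (rule map_pmf_cong) (auto simp: comps_explore)
  also have "\<dots> = map_pmf set (map_pmf (\<lambda>B. explore (h' B) n {} {1} {2..n} {1}) (ticks c w S n))"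
    unfolding graph clock ..
  also have "measure_pmf.prob \<dots> {C. \<not> dominant_class lo hi b C}
     = measure_pmf.prob (ticks c w S n) {B. \<not> dominant_class lo hi b (set (explore (h' B) n {} {1} {2..n} {1}))}"
    by (simp add: vimage_def)
  also have "\<dots> \<le> measure_pmf.prob (ticks c w S n) bad"
    by (rule measure_pmf.finite_measure_mono) (use bad found in \<open>auto simp: V_def\<close>)
  finally show ?thesis by (simp add: c_def)
qed

section \<open>Concentration of the clocks\<close>

definition mean_weight_rung :: "real \<Rightarrow> (nat \<Rightarrow> real) \<Rightarrow> nat \<Rightarrow> real \<Rightarrow> real" where
  "mean_weight_rung c w n s = (\<Sum>j=1..n. w j * (1 - exp (- (c * w j * s))))"

definition mean_card_rung :: "real \<Rightarrow> (nat \<Rightarrow> real) \<Rightarrow> nat \<Rightarrow> real \<Rightarrow> real" where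
  "mean_card_rung c w n s = (\<Sum>j=1..n. 1 - exp (- (c * w j * s)))"

lemma mult_exp_minus_le: "(y::real) * exp (- y) \<le> 1 - exp (- y)"
proof -
  have "(1 + y) * exp (- y) \<le> exp y * exp (- y)" by (intro mult_right_mono) auto
  then show ?thesis by (simp add: algebra_simps mult_exp_exp)
qed

text \<open>The left-hand side bounds the variance of the weight of the rung clocks. Heavy vertices contribute
little to it because their clocks have almost surely rung by time \<open>s\<close>; this is what makes Chebyshev's
inequality work although power-law weights with \<open>\<tau> < 3\<close> have no second moment.\<close>

lemma weighted_square_le_mean:
  assumes "0 < c" "\<And>j. 0 \<le> w j" "0 < s"
  shows "(\<Sum>j=1..n. (w j)\<^sup>2 * exp (- (c * w j * s))) \<le> mean_weight_rung c w n s / (c * s)"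
proof -
  have "(w j)\<^sup>2 * exp (- (c * w j * s)) \<le> w j * (1 - exp (- (c * w j * s))) / (c * s)" for j
  proof -
    have "w j * ((c * w j * s) * exp (- (c * w j * s))) \<le> w j * (1 - exp (- (c * w j * s)))"
      by (intro mult_left_mono mult_exp_minus_le assms)
    then show ?thesis using assms by (simp add: field_simps power2_eq_square)
  qed
  then show ?thesis unfolding mean_weight_rung_def sum_divide_distrib by (intro sum_mono)
qed

lemma mean_card_rung_le:
  shows "mean_card_rung c w n s \<le> c * total_weight n w * s"
proof -
  have "mean_card_rung c w n s \<le> (\<Sum>j=1..n. c * w j * s)"
    unfolding mean_card_rung_def
  proof (intro sum_mono)
    fix j show "1 - exp (- (c * w j * s)) \<le> c * w j * s" using exp_ge_add_one_self[of "- (c * w j * s)"] by simp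
  qed
  then show ?thesis by (simp add: total_weight_def sum_distrib_left sum_distrib_right)
qed

text \<open>From \<open>1 - exp (- y) \<ge> y * exp (- y)\<close>: the number of rung clocks is nearly linear in \<open>s\<close> as long as their
weight is a negligible part of the total weight.\<close>

lemma mean_card_rung_ge:
  "c * total_weight n w * s - c * s * mean_weight_rung c w n s \<le> mean_card_rung c w n s"
proof -
  have "c * w j * s - c * s * (w j * (1 - exp (- (c * w j * s)))) \<le> 1 - exp (- (c * w j * s))" for j
    using mult_exp_minus_le[of "c * w j * s"] by (simp add: algebra_simps)
  then have "(\<Sum>j=1..n. c * w j * s - c * s * (w j * (1 - exp (- (c * w j * s))))) \<le> mean_card_rung c w n s"
    unfolding mean_card_rung_def by (intro sum_mono)
  then show ?thesis
    by (simp add: total_weight_def mean_weight_rung_def sum_subtractf sum_distrib_left sum_distrib_right mult.assoc)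
qed

lemma mean_card_rung_increment:
  assumes "0 \<le> c" "\<And>j. 0 \<le> w j" "0 \<le> s" "0 \<le> h"
  shows "mean_card_rung c w n (s + h) - mean_card_rung c w n s \<le> c * total_weight n w * h"
proof -
  have "exp (- (c * w j * s)) - exp (- (c * w j * (s + h))) \<le> c * w j * h" for j
  proof -
    have "exp (- (c * w j * s)) - exp (- (c * w j * (s + h))) = exp (- (c * w j * s)) * (1 - exp (- (c * w j * h)))"
      by (simp add: algebra_simps mult_exp_exp)
    also have "\<dots> \<le> 1 * (c * w j * h)"
    proof (intro mult_mono)
      show "1 - exp (- (c * w j * h)) \<le> c * w j * h" using exp_ge_add_one_self[of "- (c * w j * h)"] by simp
    qed (use assms in auto)
    finally show ?thesis by simp
  qed
  then have "mean_card_rung c w n (s + h) - mean_card_rung c w n s \<le> (\<Sum>j=1..n. c * w j * h)"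
    unfolding mean_card_rung_def sum_subtractf[symmetric] by (intro sum_mono) (simp add: algebra_simps)
  then show ?thesis by (simp add: total_weight_def sum_distrib_left sum_distrib_right)
qed

text \<open>The mean is a concave function of \<open>s\<close>, so its increments after \<open>t\<close> are at most those of the chord over
\<open>t / 2\<close> and \<open>t\<close>.\<close>

lemma mean_weight_rung_secant:
  assumes c: "0 \<le> c" and w: "\<And>j. 0 \<le> w j" and s: "0 < t" "t \<le> s" "0 \<le> h"
  shows "mean_weight_rung c w n (s + h) - mean_weight_rung c w n s
     \<le> h / (t / 2) * (mean_weight_rung c w n t - mean_weight_rung c w n (t / 2))"
proof -
  have "w j * (exp (- (c * w j * s)) - exp (- (c * w j * (s + h))))
     \<le> h / (t / 2) * (w j * (exp (- (c * w j * (t / 2))) - exp (- (c * w j * t))))" for j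
  proof -
    define a where "a = c * w j"
    have a: "0 \<le> a" using c w by (simp add: a_def)
    have "exp (- (a * s)) - exp (- (a * (s + h))) = exp (- (a * s)) * (1 - exp (- (a * h)))"
      by (simp add: algebra_simps mult_exp_exp)
    also have "\<dots> \<le> exp (- (a * t)) * (a * h)"
    proof (intro mult_mono)
      show "1 - exp (- (a * h)) \<le> a * h" using exp_ge_add_one_self[of "- (a * h)"] by simp
      show "exp (- (a * s)) \<le> exp (- (a * t))" using a s by (simp add: mult_left_mono)
    qed (use a s in auto)
    also have "\<dots> = h / (t / 2) * (exp (- (a * t)) * (a * (t / 2)))" using s by simp
    also have "\<dots> \<le> h / (t / 2) * (exp (- (a * t)) * (exp (a * (t / 2)) - 1))"
    proof (intro mult_left_mono)
      show "a * (t / 2) \<le> exp (a * (t / 2)) - 1" using exp_ge_add_one_self[of "a * (t / 2)"] by linarith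
    qed (use s in auto)
    also have "exp (- (a * t)) * (exp (a * (t / 2)) - 1) = exp (- (a * (t / 2))) - exp (- (a * t))"
      by (simp add: algebra_simps mult_exp_exp)
    finally have "w j * (exp (- (a * s)) - exp (- (a * (s + h))))
       \<le> w j * (h / (t / 2) * (exp (- (a * (t / 2))) - exp (- (a * t))))"
      by (intro mult_left_mono w)
    then show ?thesis by (simp add: a_def mult_ac)
  qed
  then have "(\<Sum>j=1..n. w j * (exp (- (c * w j * s)) - exp (- (c * w j * (s + h)))))
     \<le> (\<Sum>j=1..n. h / (t / 2) * (w j * (exp (- (c * w j * (t / 2))) - exp (- (c * w j * t)))))"
    by (intro sum_mono)
  moreover have "mean_weight_rung c w n (s + h) - mean_weight_rung c w n s
     = (\<Sum>j=1..n. w j * (exp (- (c * w j * s)) - exp (- (c * w j * (s + h)))))"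
    unfolding mean_weight_rung_def sum_subtractf[symmetric] by (intro sum.cong refl) (simp add: algebra_simps)
  moreover have "mean_weight_rung c w n t - mean_weight_rung c w n (t / 2)
     = (\<Sum>j=1..n. w j * (exp (- (c * w j * (t / 2))) - exp (- (c * w j * t))))"
    unfolding mean_weight_rung_def sum_subtractf[symmetric] by (intro sum.cong refl) (simp add: algebra_simps)
  ultimately show ?thesis by (simp only: sum_distrib_left)
qed

lemma sum_shifted_differences_le:
  fixes h :: "nat \<Rightarrow> real"
  assumes "\<And>i j. i \<le> j \<Longrightarrow> h j \<le> h i"
  shows "(\<Sum>k<K. h k - h (k + L)) \<le> L * (h 0 - h (K + L))"
proof (induction L)
  case 0
  then show ?case by simp
next
  case (Suc L)
  have "(\<Sum>k<K. h k - h (k + Suc L)) = (\<Sum>k<K. h k - h (k + L)) + (\<Sum>k<K. h (k + L) - h (Suc (k + L)))"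
    by (simp add: sum.distrib[symmetric])
  also have "(\<Sum>k<K. h (k + L) - h (Suc (k + L))) = h L - h (K + L)"
    by (induction K) auto
  also have "(\<Sum>k<K. h k - h (k + L)) \<le> L * (h 0 - h (K + L))" by (rule Suc)
  also have "real L * (h 0 - h (K + L)) + (h L - h (K + L)) \<le> Suc L * (h 0 - h (K + Suc L))"
  proof -
    have "real L * (h 0 - h (K + L)) \<le> real L * (h 0 - h (K + Suc L))"
      by (intro mult_left_mono) (use assms[of "K + L" "K + Suc L"] in auto)
    moreover have "h L - h (K + L) \<le> h 0 - h (K + Suc L)"
      using assms[of 0 L] assms[of "K + L" "K + Suc L"] by simp
    ultimately show ?thesis by (simp add: algebra_simps)
  qed
  finally show ?case by simp
qed

context
  fixes S :: "real set" and c :: real and w :: "nat \<Rightarrow> real" and n :: nat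
  assumes S: "finite S" "0 \<in> S" "S \<subseteq> {0..}" and c: "0 < c" and w: "\<And>j. 0 \<le> w j"
begin

lemma rung_0: "rung S n B 0 = {}"
  by (auto simp: rung_def)

lemma rung_weight_concentration:
  assumes "s \<in> S" "0 < s" "0 < t"
  shows "measure_pmf.prob (ticks c w S n) {B. t \<le> \<bar>sum w (rung S n B s) - mean_weight_rung c w n s\<bar>}
     \<le> mean_weight_rung c w n s / (c * s) / t\<^sup>2"
proof -
  have c0: "0 \<le> c" using c by simp
  have "measure_pmf.prob (ticks c w S n) {B. t \<le> \<bar>sum w (rung S n B s) - mean_weight_rung c w n s\<bar>}
     \<le> (\<Sum>j=1..n. (w j)\<^sup>2 * (1 - exp (- (c * w j * s))) * exp (- (c * w j * s))) / t\<^sup>2"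
    using rung_Chebyshev[OF S c0 w S(2) assms(1) _ assms(3), where a = w and n = n] assms(2)
    by (simp add: rung_0 mean_weight_rung_def)
  also have "\<dots> \<le> (\<Sum>j=1..n. (w j)\<^sup>2 * exp (- (c * w j * s))) / t\<^sup>2"
  proof (intro divide_right_mono sum_mono)
    fix j
    have "0 \<le> c * w j * s" using c w assms by simp
    then show "(w j)\<^sup>2 * (1 - exp (- (c * w j * s))) * exp (- (c * w j * s)) \<le> (w j)\<^sup>2 * exp (- (c * w j * s))"
      by (intro mult_right_mono) (auto intro: mult_left_le)
  qed simp
  also have "\<dots> \<le> mean_weight_rung c w n s / (c * s) / t\<^sup>2"
    by (intro divide_right_mono weighted_square_le_mean c w assms) simp
  finally show ?thesis .
qed

lemma rung_card_concentration:
  assumes "s \<in> S" "0 < s" "0 < t"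
  shows "measure_pmf.prob (ticks c w S n) {B. t \<le> \<bar>real (card (rung S n B s)) - mean_card_rung c w n s\<bar>}
     \<le> c * total_weight n w * s / t\<^sup>2"
proof -
  have c0: "0 \<le> c" using c by simp
  have "measure_pmf.prob (ticks c w S n) {B. t \<le> \<bar>real (card (rung S n B s)) - mean_card_rung c w n s\<bar>}
     \<le> (\<Sum>j=1..n. (1 - exp (- (c * w j * s))) * exp (- (c * w j * s))) / t\<^sup>2"
    using rung_Chebyshev[OF S c0 w S(2) assms(1) _ assms(3), where a = "\<lambda>_. 1" and n = n] assms(2)
    by (simp add: rung_0 mean_card_rung_def)
  also have "\<dots> \<le> mean_card_rung c w n s / t\<^sup>2"
    unfolding mean_card_rung_def
    by (intro divide_right_mono sum_mono mult_left_le) (use c w assms in auto)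
  also have "\<dots> \<le> c * total_weight n w * s / t\<^sup>2"
    by (intro divide_right_mono mean_card_rung_le) simp
  finally show ?thesis .
qed

text \<open>A bound that is uniform in the number \<open>K\<close> of intervals: the variances of the increments telescope, so the
union bound costs only the factor \<open>L\<close> by which the intervals overlap. This allows the whole time axis up
to the total weight to be covered.\<close>

lemma rung_increments_concentration:
  fixes a :: "nat \<Rightarrow> real"
  assumes grid: "\<And>k. k \<le> K + L \<Longrightarrow> s0 + real k * h \<in> S" and h: "0 \<le> h" and t: "0 < t" and s0: "0 \<le> s0"
  shows "measure_pmf.prob (ticks c w S n) {B. \<exists>k<K. t \<le> \<bar>sum a (rung S n B (s0 + real (k + L) * h)) - sum a (rung S n B (s0 + real k * h))
       - (\<Sum>j=1..n. a j * (exp (- (c * w j * (s0 + real k * h))) - exp (- (c * w j * (s0 + real (k + L) * h)))))\<bar>}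
     \<le> L * (\<Sum>j=1..n. (a j)\<^sup>2 * (exp (- (c * w j * s0)) - exp (- (c * w j * (s0 + real (K + L) * h))))) / t\<^sup>2"
proof -
  have c0: "0 \<le> c" using c by simp
  define e where "e = (\<lambda>j k. exp (- (c * w j * (s0 + real k * h))))"
  define E where "E = (\<lambda>k. {B. t \<le> \<bar>sum a (rung S n B (s0 + real (k + L) * h)) - sum a (rung S n B (s0 + real k * h))
       - (\<Sum>j=1..n. a j * (e j k - e j (k + L)))\<bar>})"
  have emono: "e j k' \<le> e j k" if "k \<le> k'" for j k k'
    unfolding e_def using c w h that by (auto intro!: mult_left_mono mult_right_mono)
  have e01: "0 \<le> e j k" "e j k \<le> 1" for j k
    unfolding e_def using c w h s0 by auto
  have step: "measure_pmf.prob (ticks c w S n) (E k) \<le> (\<Sum>j=1..n. (a j)\<^sup>2 * (e j k - e j (k + L))) / t\<^sup>2" if "k < K" for k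
  proof -
    have "measure_pmf.prob (ticks c w S n) (E k) \<le> (\<Sum>j=1..n. (a j)\<^sup>2 * (e j k - e j (k + L)) * (1 - (e j k - e j (k + L)))) / t\<^sup>2"
      unfolding E_def e_def
      by (rule rung_Chebyshev[OF S c0 w _ _ _ t]) (use grid[of k] grid[of "k + L"] that h in \<open>auto intro!: mult_right_mono\<close>)
    also have "\<dots> \<le> (\<Sum>j=1..n. (a j)\<^sup>2 * (e j k - e j (k + L))) / t\<^sup>2"
      by (intro divide_right_mono sum_mono mult_left_le) (use emono[of k "k + L"] in \<open>auto intro!: mult_nonneg_nonneg\<close>)
    finally show ?thesis .
  qed
  have "measure_pmf.prob (ticks c w S n) (\<Union>k\<in>{..<K}. E k) \<le> (\<Sum>k<K. measure_pmf.prob (ticks c w S n) (E k))"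
    by (rule measure_pmf.finite_measure_subadditive_finite) auto
  also have "\<dots> \<le> (\<Sum>k<K. (\<Sum>j=1..n. (a j)\<^sup>2 * (e j k - e j (k + L))) / t\<^sup>2)"
    by (intro sum_mono step) auto
  also have "\<dots> = (\<Sum>j=1..n. (a j)\<^sup>2 * (\<Sum>k<K. e j k - e j (k + L))) / t\<^sup>2"
    by (simp add: sum_divide_distrib[symmetric] sum_distrib_left) (rule disjI2, rule sum.swap)
  also have "\<dots> \<le> (\<Sum>j=1..n. (a j)\<^sup>2 * (L * (e j 0 - e j (K + L)))) / t\<^sup>2"
    by (intro divide_right_mono sum_mono mult_left_mono sum_shifted_differences_le emono) auto
  also have "\<dots> = L * (\<Sum>j=1..n. (a j)\<^sup>2 * (e j 0 - e j (K + L))) / t\<^sup>2"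
    by (simp add: sum_distrib_left mult_ac)
  finally show ?thesis
    by (simp add: E_def e_def UNION_eq Bex_def lessThan_def conj_commute)
qed

end

section \<open>The dominant component at a fixed size\<close>

text \<open>Chebyshev's inequality applied to the hypotheses of \<open>peels_found_by_dominant\<close>, with times measured in
units of \<open>L\<close>. Here \<open>X\<close> is a grid of mesh \<open>\<eta>\<close> between \<open>u0\<close> and \<open>u1\<close>, which together with the monotonicity of the
rung weight controls all times in between, and the later components are controlled on the grid
\<open>u1 + k * \<eta>\<close> by increments over \<open>M + 1\<close> cells, so that an interval of length \<open>M * \<eta>\<close> fits into one of them.\<close>

lemma dominant_class_prob_bound:
  fixes w :: "nat \<Rightarrow> real" and n M q :: nat and L W p u0 u1 u2 \<eta> tol lo hi b :: real and X :: "real set"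
  defines "c \<equiv> p / total_weight n w"
  defines "f \<equiv> mean_weight_rung c w n" and "g \<equiv> mean_card_rung c w n"
  defines "var \<equiv> \<lambda>x. f (x * L) / (c * (x * L)) / (tol * L)\<^sup>2"
  assumes n: "0 < n" and w: "\<And>j. 0 \<le> w j" "\<And>i. i \<in> {1..n} \<Longrightarrow> 0 < w i" "\<And>i. i \<in> {1..n} \<Longrightarrow> w i \<le> W"
    and p: "0 < p" "p \<le> 1" and pos: "0 < L" "0 < \<eta>" "0 < tol"
    and u: "0 < u0" "u0 < u1" "0 < u2" "0 < M"
    and X: "finite X" "X \<subseteq> {0<..}" "\<And>x. u0 \<le> x \<Longrightarrow> x < u1 \<Longrightarrow> \<exists>y\<in>X. y \<le> x \<and> x < y + \<eta>"
    and h1: "\<And>x. x \<in> X \<Longrightarrow> (x + \<eta> + tol) * L \<le> f (x * L)"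
    and h2: "f (u2 * L) + tol * L + u0 * L + W \<le> u2 * L"
    and h3: "\<And>s. u1 * L \<le> s \<Longrightarrow> f (s + real (Suc M) * (\<eta> * L)) - f s + tol * L + W \<le> real M * (\<eta> * L)"
    and h4: "g (u0 * L) + tol * (p * L) + 1 \<le> b" "g (u2 * L) + tol * (p * L) + 1 \<le> hi"
       "real (Suc M) * \<eta> * (p * L) + tol * (p * L) + 1 \<le> b"
    and h5: "lo + g (u0 * L) + 2 * tol * (p * L) + real q \<le> g (u1 * L)" "u0 * L \<le> sum w {1..q}" "q \<le> n"
  shows "measure_pmf.prob (MNR_percolated n w p) {E. \<not> dominant_class lo hi b (components n E)}
     \<le> sum var X + var u2 + real (Suc M) * var u1 + p * ((u0 + u1 + u2) * L) / (tol * (p * L))\<^sup>2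
       + real (Suc M) * (p * (u1 * L + total_weight n w + real (M + 2) * (\<eta> * L))) / (tol * (p * L))\<^sup>2"
proof -
  define l where "l = total_weight n w"
  define m where "m = Suc M"
  define V where "V = {1..n}"
  have l: "0 < l" unfolding l_def total_weight_def using w n by (intro sum_pos) auto
  have lV: "l = sum w V" by (simp add: l_def total_weight_def V_def)
  have c: "0 < c" "c * l = p" using p l by (simp_all add: c_def l_def[symmetric])
  define e where "e = \<eta> * L"
  have e: "0 < e" using pos by (simp add: e_def)
  define K where "K = Suc (nat \<lfloor>l / e\<rfloor>)"
  have K: "l / e < K" "real K * e \<le> l + e"
  proof -
    have "0 \<le> \<lfloor>l / e\<rfloor>" using l e by simp
    then have r: "real K = of_int \<lfloor>l / e\<rfloor> + 1" by (simp add: K_def)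
    show "l / e < K" unfolding r by linarith
    have "real K \<le> l / e + 1" unfolding r by linarith
    then show "real K * e \<le> l + e" using e by (simp add: field_simps)
  qed
  define S where "S = sum w ` Pow {1..n} \<union> (\<lambda>x. x * L) ` X \<union> {u0 * L, u1 * L, u2 * L}
     \<union> (\<lambda>k. u1 * L + real k * e) ` {..K + m}"
  have S: "finite S" "S \<subseteq> {0..}"
  proof -
    show "finite S" using X(1) by (simp add: S_def)
    have "0 \<le> sum w Y" for Y using w(1) by (intro sum_nonneg)
    moreover have "0 \<le> x * L" if "x \<in> X \<union> {u0, u1, u2}" for x
    proof -
      have "0 \<le> x" using that X(2) u by (auto simp: less_imp_le)
      then show ?thesis using pos by simp
    qed
    moreover have "0 \<le> u1 * L + real k * e" for k using u pos e by simp
    ultimately show "S \<subseteq> {0..}" unfolding S_def by auto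
  qed
  have Ssum: "sum w Y \<in> S" if "Y \<subseteq> {1..n}" for Y using that by (auto simp: S_def)
  have S0: "0 \<in> S" using Ssum[of "{}"] by simp
  have Sg: "u1 * L + real k * e \<in> S" if "k \<le> K + m" for k using that by (auto simp: S_def)
  note SS = S(1) S0 S(2)
  define R where "R = rung S n"
  let ?P = "measure_pmf.prob (ticks c w S n)"
  define Ew where "Ew = (\<lambda>s. {B. tol * L \<le> \<bar>sum w (R B s) - f s\<bar>})"
  define Ec where "Ec = (\<lambda>s. {B. tol * (p * L) \<le> \<bar>real (card (R B s)) - g s\<bar>})"
  define Iw where "Iw = {B. \<exists>k<K. tol * L \<le> \<bar>sum w (R B (u1 * L + real (k + m) * e)) - sum w (R B (u1 * L + real k * e))
     - (f (u1 * L + real (k + m) * e) - f (u1 * L + real k * e))\<bar>}"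
  define Ic where "Ic = {B. \<exists>k<K. tol * (p * L) \<le> \<bar>real (card (R B (u1 * L + real (k + m) * e))) - real (card (R B (u1 * L + real k * e)))
     - (g (u1 * L + real (k + m) * e) - g (u1 * L + real k * e))\<bar>}"
  define bad where "bad = ((\<Union>x\<in>X. Ew (x * L)) \<union> Ew (u2 * L)) \<union> (Ec (u0 * L) \<union> Ec (u1 * L) \<union> Ec (u2 * L)) \<union> Iw \<union> Ic"

  have PEw: "?P (Ew (x * L)) \<le> var x" if "x * L \<in> S" "0 < x" for x
    unfolding Ew_def R_def var_def f_def
    by (rule rung_weight_concentration[OF SS c(1) w(1)]) (use that pos in auto)
  have PEc: "?P (Ec (x * L)) \<le> p * (x * L) / (tol * (p * L))\<^sup>2" if "x * L \<in> S" "0 < x" for x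
  proof -
    have "?P (Ec (x * L)) \<le> c * total_weight n w * (x * L) / (tol * (p * L))\<^sup>2"
      unfolding Ec_def R_def g_def
      by (rule rung_card_concentration[OF SS c(1) w(1)]) (use that pos p in auto)
    then show ?thesis using c by (simp add: l_def)
  qed
  have s0: "0 < u1 * L" using u pos by simp
  have PIw: "?P Iw \<le> real m * var u1"
  proof -
    have eq: "(\<Sum>j=1..n. w j * (exp (- (c * w j * s)) - exp (- (c * w j * s')))) = f s' - f s" for s s'
      unfolding f_def mean_weight_rung_def sum_subtractf[symmetric] by (intro sum.cong refl) (simp add: algebra_simps)
    have "?P Iw \<le> real m * (\<Sum>j=1..n. (w j)\<^sup>2 * (exp (- (c * w j * (u1 * L))) - exp (- (c * w j * (u1 * L + real (K + m) * e))))) / (tol * L)\<^sup>2"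
      unfolding Iw_def R_def eq[symmetric]
      by (rule rung_increments_concentration[OF SS c(1) w(1)]) (use Sg e pos s0 in auto)
    also have "\<dots> \<le> real m * (\<Sum>j=1..n. (w j)\<^sup>2 * exp (- (c * w j * (u1 * L)))) / (tol * L)\<^sup>2"
      by (intro divide_right_mono mult_left_mono sum_mono) auto
    also have "\<dots> \<le> real m * (f (u1 * L) / (c * (u1 * L))) / (tol * L)\<^sup>2"
      unfolding f_def by (intro divide_right_mono mult_left_mono weighted_square_le_mean c w s0) auto
    finally show ?thesis by (simp add: var_def)
  qed
  have PIc: "?P Ic \<le> real m * (p * (u1 * L + l + real (M + 2) * e)) / (tol * (p * L))\<^sup>2"
  proof -
    have eq: "(\<Sum>j=1..n. 1 * (exp (- (c * w j * s)) - exp (- (c * w j * s')))) = g s' - g s" for s s'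
      unfolding g_def mean_card_rung_def sum_subtractf[symmetric] by (intro sum.cong refl) simp
    have cs: "real (card (R B s)) = sum (\<lambda>_. 1) (rung S n B s)" for B s by (simp add: R_def)
    have "?P Ic \<le> real m * (\<Sum>j=1..n. 1\<^sup>2 * (exp (- (c * w j * (u1 * L))) - exp (- (c * w j * (u1 * L + real (K + m) * e))))) / (tol * (p * L))\<^sup>2"
      unfolding Ic_def cs eq[symmetric]
      by (rule rung_increments_concentration[OF SS c(1) w(1)]) (use Sg e pos s0 p in auto)
    also have "\<dots> \<le> real m * g (u1 * L + real (K + m) * e) / (tol * (p * L))\<^sup>2"
      unfolding g_def mean_card_rung_def
      by (intro divide_right_mono mult_left_mono sum_mono) (use c w s0 in auto)
    also have "\<dots> \<le> real m * (c * total_weight n w * (u1 * L + real (K + m) * e)) / (tol * (p * L))\<^sup>2"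
      unfolding g_def by (intro divide_right_mono mult_left_mono mean_card_rung_le) auto
    also have "\<dots> \<le> real m * (p * (u1 * L + l + real (M + 2) * e)) / (tol * (p * L))\<^sup>2"
    proof -
      have "u1 * L + real (K + m) * e \<le> u1 * L + l + real (M + 2) * e"
        using K(2) by (simp add: m_def algebra_simps)
      then show ?thesis using c p by (intro divide_right_mono mult_left_mono) (auto simp: l_def)
    qed
    finally show ?thesis .
  qed
  have "?P bad \<le> ?P ((\<Union>x\<in>X. Ew (x * L)) \<union> Ew (u2 * L)) + ?P (Ec (u0 * L) \<union> Ec (u1 * L) \<union> Ec (u2 * L)) + ?P Iw + ?P Ic"
    unfolding bad_def by (intro order_trans[OF measure_Un_le] add_mono order_refl) auto
  also have "?P ((\<Union>x\<in>X. Ew (x * L)) \<union> Ew (u2 * L)) \<le> sum var X + var u2"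
  proof (intro order_trans[OF measure_Un_le] add_mono)
    have "?P (\<Union>x\<in>X. Ew (x * L)) \<le> (\<Sum>x\<in>X. ?P (Ew (x * L)))"
      by (rule measure_pmf.finite_measure_subadditive_finite) (use X in auto)
    also have "\<dots> \<le> sum var X"
      by (intro sum_mono PEw) (use X in \<open>auto simp: S_def\<close>)
    finally show "?P (\<Union>x\<in>X. Ew (x * L)) \<le> sum var X" .
    show "?P (Ew (u2 * L)) \<le> var u2"
      by (rule PEw) (use u in \<open>auto simp: S_def\<close>)
  qed auto
  also have "?P (Ec (u0 * L) \<union> Ec (u1 * L) \<union> Ec (u2 * L)) \<le> p * ((u0 + u1 + u2) * L) / (tol * (p * L))\<^sup>2"
  proof -
    have "?P (Ec (u0 * L) \<union> Ec (u1 * L) \<union> Ec (u2 * L)) \<le> ?P (Ec (u0 * L)) + ?P (Ec (u1 * L)) + ?P (Ec (u2 * L))"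
      by (intro order_trans[OF measure_Un_le] add_mono order_refl) auto
    also have "\<dots> \<le> p * (u0 * L) / (tol * (p * L))\<^sup>2 + p * (u1 * L) / (tol * (p * L))\<^sup>2 + p * (u2 * L) / (tol * (p * L))\<^sup>2"
      by (intro add_mono PEc) (use u in \<open>auto simp: S_def\<close>)
    also have "\<dots> = p * ((u0 + u1 + u2) * L) / (tol * (p * L))\<^sup>2"
      by (simp add: add_divide_distrib[symmetric] algebra_simps)
    finally show ?thesis .
  qed
  also note PIw
  also note PIc
  finally have Pbad: "?P bad \<le> sum var X + var u2 + real m * var u1 + p * ((u0 + u1 + u2) * L) / (tol * (p * L))\<^sup>2
       + real m * (p * (u1 * L + l + real (M + 2) * e)) / (tol * (p * L))\<^sup>2"
    by simp

  have good: "dominant_class lo hi b (set Ks)"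
    if B: "B \<notin> bad" and Ks: "peels (found_by w (rung S n B) {1..n}) {1..n} {} Ks" for B Ks
  proof -
    have Bw: "\<bar>sum w (R B (x * L)) - f (x * L)\<bar> < tol * L" if "x \<in> X \<or> x = u2" for x
      using B that by (auto simp: bad_def Ew_def not_le)
    have Bc: "\<bar>real (card (R B (x * L))) - g (x * L)\<bar> < tol * (p * L)" if "x \<in> {u0, u1, u2}" for x
      using B that by (auto simp: bad_def Ec_def not_le)
    have BIw: "\<bar>sum w (R B (u1 * L + real (k + m) * e)) - sum w (R B (u1 * L + real k * e))
       - (f (u1 * L + real (k + m) * e) - f (u1 * L + real k * e))\<bar> < tol * L" if "k < K" for k
      using B that by (auto simp: bad_def Iw_def not_le)
    have BIc: "\<bar>real (card (R B (u1 * L + real (k + m) * e))) - real (card (R B (u1 * L + real k * e)))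
       - (g (u1 * L + real (k + m) * e) - g (u1 * L + real k * e))\<bar> < tol * (p * L)" if "k < K" for k
      using B that by (auto simp: bad_def Ic_def not_le)
    have mono: "R B s \<subseteq> R B s'" if "s \<le> s'" for s s' unfolding R_def using that by (rule rung_mono)
    have finR: "finite (R B s)" for s unfolding R_def by (rule finite_subset[OF rung_subset]) simp
    have wmono: "sum w (R B s) \<le> sum w (R B s')" if "s \<le> s'" for s s'
      by (rule sum_mono2[OF finR mono[OF that]]) (use w in auto)
    have cmono: "real (card (R B s)) \<le> real (card (R B s'))" if "s \<le> s'" for s s'
      using card_mono[OF finR mono[OF that]] by simp
    have cell: "\<exists>k<K. u1 * L + real k * e \<le> s \<and> s + real M * e \<le> u1 * L + real (k + m) * e"
      if s: "u1 * L \<le> s" "s \<le> l" for s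
    proof -
      define k where "k = nat \<lfloor>(s - u1 * L) / e\<rfloor>"
      have "0 \<le> \<lfloor>(s - u1 * L) / e\<rfloor>" using s e by simp
      then have k: "real k \<le> (s - u1 * L) / e" "(s - u1 * L) / e < real k + 1" unfolding k_def by linarith+
      have "(s - u1 * L) / e \<le> l / e" using s s0 e by (intro divide_right_mono) auto
      then have "k < K" using k K(1) by linarith
      moreover have "real k * e \<le> s - u1 * L" "s - u1 * L < (real k + 1) * e"
        using k e by (simp_all add: field_simps)
      ultimately show ?thesis by (intro exI[of _ k]) (auto simp: m_def algebra_simps)
    qed
    show ?thesis
    proof (rule peels_found_by_dominant[where T = "R B" and n = n and w = w and W = W and ?t0.0 = "u0 * L" and ?t1.0 = "u1 * L"
          and ?t2.0 = "u2 * L" and d = "real M * e" and q = q])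
      show "0 \<le> w i" for i by (rule w(1))
      show "w i \<le> W" if "i \<in> {1..n}" for i using that by (rule w(3))
      show "R B s \<subseteq> R B s'" if "s \<le> s'" for s s' by (rule mono[OF that])
      show "R B s \<subseteq> {1..n}" for s unfolding R_def by (rule rung_subset)
      show "peels (found_by w (R B) {1..n}) {1..n} {} Ks" using Ks by (simp add: R_def)
      show "0 < u0 * L" "u0 * L < u1 * L" "0 < real M * e" using u pos e by auto
      show "u0 * L \<le> sum w {1..n}"
        by (rule order_trans[OF h5(2)]) (rule sum_mono2, use h5(3) w in auto)
      show "s < sum w (R B s)" if s: "u0 * L \<le> s" "s < u1 * L" for s
      proof -
        have "u0 \<le> s / L" "s / L < u1" using s pos by (simp_all add: field_simps)
        then obtain y where y: "y \<in> X" "y \<le> s / L" "s / L < y + \<eta>" using X(3) by blast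
        have ys: "y * L \<le> s" "s < (y + \<eta>) * L" using y pos by (simp_all add: field_simps)
        have "s < (y + \<eta>) * L" by fact
        also have "\<dots> \<le> f (y * L) - tol * L" using h1[OF y(1)] by (simp add: algebra_simps)
        also have "\<dots> < sum w (R B (y * L))" using Bw[of y] y(1) by auto
        also have "\<dots> \<le> sum w (R B s)" by (rule wmono) (rule ys)
        finally show ?thesis .
      qed
      show "sum w (R B (u2 * L)) + u0 * L + W < u2 * L" using Bw[of u2] h2 by auto
      show "sum w (R B (s + real M * e)) - sum w (R B s) + W < real M * e"
        if s: "u1 * L \<le> s" "s \<le> sum w {1..n}" for s
      proof -
        obtain k where k: "k < K" "u1 * L + real k * e \<le> s" "s + real M * e \<le> u1 * L + real (k + m) * e"
          using cell[of s] s by (auto simp: lV V_def)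
        have "f (u1 * L + real (k + m) * e) - f (u1 * L + real k * e) + tol * L + W \<le> real M * e"
        proof -
          have eq: "u1 * L + real (k + m) * e = u1 * L + real k * e + real (Suc M) * (\<eta> * L)"
            by (simp add: e_def m_def algebra_simps)
          show ?thesis unfolding eq using h3[of "u1 * L + real k * e"] e by (simp add: e_def)
        qed
        then show ?thesis using BIw[OF k(1)] wmono[OF k(2)] wmono[OF k(3)] by linarith
      qed
      show "real (card (R B (u0 * L))) + 1 \<le> b" using Bc[of u0] h4 by auto
      show "real (card (R B (u2 * L))) + 1 \<le> hi" using Bc[of u2] h4 by auto
      show "real (card (R B (s + real M * e))) - real (card (R B s)) + 1 \<le> b"
        if s: "u1 * L \<le> s" "s \<le> sum w {1..n}" for s
      proof -
        obtain k where k: "k < K" "u1 * L + real k * e \<le> s" "s + real M * e \<le> u1 * L + real (k + m) * e"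
          using cell[of s] s by (auto simp: lV V_def)
        have "g (u1 * L + real (k + m) * e) - g (u1 * L + real k * e) \<le> c * total_weight n w * (real m * e)"
          using mean_card_rung_increment[of c w "u1 * L + real k * e" "real m * e" n] c w e s0
          by (simp add: g_def algebra_simps)
        also have "\<dots> = real (Suc M) * \<eta> * (p * L)" using c by (simp add: l_def e_def m_def mult_ac)
        finally show ?thesis using BIc[OF k(1)] cmono[OF k(2)] cmono[OF k(3)] h4(3) by linarith
      qed
      show "lo + real (card (R B (u0 * L))) + real q \<le> real (card (R B (u1 * L)))"
        using Bc[of u0] Bc[of u1] h5(1) by auto
      show "u0 * L \<le> sum w {1..q}" "q \<le> n" by fact+
    qed
  qed
  have "measure_pmf.prob (MNR_percolated n w p) {E. \<not> dominant_class lo hi b (components n E)} \<le> ?P bad"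
    unfolding c_def by (rule dominant_class_prob_le[OF n w(1,2) _ p(2) SS Ssum good]) (use p in auto)
  also note Pbad
  finally show ?thesis by (simp add: m_def e_def l_def)
qed

section \<open>Asymptotics of the dominant component\<close>

lemma powr_minus_self_ge:
  fixes x \<beta> :: real
  assumes "0 < x" "x < 1" "\<beta> < 1"
  shows "(1 - \<beta>) * x * (1 - x) \<le> x powr \<beta> - x"
proof -
  have "x powr \<beta> = x * x powr (\<beta> - 1)" using assms by (simp add: powr_diff)
  also have "x powr (\<beta> - 1) = exp ((1 - \<beta>) * (- ln x))" using assms by (simp add: powr_def algebra_simps)
  also have "x * exp ((1 - \<beta>) * (- ln x)) \<ge> x * (1 + (1 - \<beta>) * (1 - x))"
  proof (rule mult_left_mono)
    have "(1 - \<beta>) * (1 - x) \<le> (1 - \<beta>) * (- ln x)"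
      using ln_le_minus_one[of x] assms by (intro mult_left_mono) auto
    then show "1 + (1 - \<beta>) * (1 - x) \<le> exp ((1 - \<beta>) * (- ln x))"
      using exp_ge_add_one_self[of "(1 - \<beta>) * (- ln x)"] by linarith
  qed (use assms in simp)
  finally show ?thesis by (simp add: algebra_simps)
qed

lemma powr_le_tangent:
  fixes x \<beta> :: real
  assumes "0 < x" "0 < \<beta>" "\<beta> < 1"
  shows "x powr \<beta> \<le> 1 + \<beta> * (x - 1)"
  using Youngs_inequality_0[of \<beta> "1 - \<beta>" x 1] assms by (simp add: algebra_simps)

text \<open>The chord of \<open>u powr \<beta>\<close> over \<open>1 / 2\<close> and \<open>1\<close> has slope \<open>2 - 2 powr (1 - \<beta>) < 1\<close>, and this persists for \<open>u\<close> near 1.\<close>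

lemma powr_secant_less_one:
  fixes \<beta> \<delta> :: real
  assumes "0 < \<beta>" "\<beta> < 1" "0 < \<delta>"
  obtains u \<rho> where "1 - \<delta> < u" "1 / 2 < u" "u < 1" "0 < \<rho>" "\<rho> < 1" "(u powr \<beta> - (u / 2) powr \<beta>) / (u / 2) < \<rho>"
proof -
  define \<phi> :: "real \<Rightarrow> real" where "\<phi> = (\<lambda>u. (u powr \<beta> - (u / 2) powr \<beta>) / (u / 2))"
  have "(1/2) powr \<beta> > (1/2::real) powr 1" using assms by (intro powr_less_mono') auto
  then have \<phi>1: "\<phi> 1 < 1" by (simp add: \<phi>_def)
  have "(1/2::real) powr \<beta> < (1/2) powr 0" using assms by (intro powr_less_mono') auto
  then have \<phi>0: "0 < \<phi> 1" by (simp add: \<phi>_def)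
  define \<rho> where "\<rho> = (\<phi> 1 + 1) / 2"
  have \<rho>: "\<phi> 1 < \<rho>" "0 < \<rho>" "\<rho> < 1" using \<phi>0 \<phi>1 by (auto simp: \<rho>_def)
  have "isCont \<phi> 1" unfolding \<phi>_def by (intro continuous_intros) auto
  then have "(\<phi> \<longlongrightarrow> \<phi> 1) (at_left 1)" unfolding isCont_def by (rule tendsto_mono[OF at_le[OF subset_UNIV]])
  then have "eventually (\<lambda>u. \<phi> u < \<rho>) (at_left 1)" using \<rho>(1) by (rule order_tendstoD)
  moreover have "eventually (\<lambda>u. u \<in> {max (1 - \<delta>) (1 / 2)<..<1}) (at_left (1::real))"
    by (rule eventually_at_left_real) (use assms in auto)
  ultimately have "eventually (\<lambda>u. \<phi> u < \<rho> \<and> u \<in> {max (1 - \<delta>) (1 / 2)<..<1}) (at_left (1::real))"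
    by (rule eventually_conj)
  then obtain u where "\<phi> u < \<rho>" "u \<in> {max (1 - \<delta>) (1 / 2)<..<1}"
    using eventually_happens[of _ "at_left (1::real)"] by auto
  then show thesis using that[of u \<rho>] \<rho> by (auto simp: \<phi>_def)
qed

text \<open>If the rung weight behaves like \<open>u powr \<beta>\<close> at time \<open>u\<close>, in units of \<open>L\<close>, then it lies above the diagonal for
\<open>0 < u < 1\<close>, below it for \<open>u > 1\<close>, and has slope less than 1 near 1 and beyond. This is the picture required by
\<open>peels_found_by_dominant\<close> with \<open>t0\<close> near 0 and \<open>t1\<close>, \<open>t2\<close> near \<open>L\<close>. As the number of rung clocks at \<open>u * L\<close> is about
\<open>u * p * L\<close>, the dominant component has about \<open>p * L\<close> vertices. All variances are of
relative order at most \<open>l / (p * L\<^sup>2)\<close>. The hypothesis \<open>early\<close> bounds the number of roots that precede the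
dominant component.\<close>

theorem dominant_class_limit:
  fixes w :: "nat \<Rightarrow> nat \<Rightarrow> real" and p L W :: "nat \<Rightarrow> real" and \<beta> e :: real
  defines "l \<equiv> \<lambda>n. total_weight n (w n)"
  defines "f \<equiv> \<lambda>n. mean_weight_rung (p n / l n) (w n) n"
  assumes \<beta>: "0 < \<beta>" "\<beta> < 1" and e: "0 < e" "e < 1"
    and w: "\<And>n j. 0 \<le> w n j" "eventually (\<lambda>n. \<forall>i\<in>{1..n}. 0 < w n i \<and> w n i \<le> W n) sequentially"
    and p: "eventually (\<lambda>n. 0 < p n \<and> p n \<le> 1) sequentially" and L: "eventually (\<lambda>n. 0 < L n) sequentially"
    and lim_f: "\<And>u. 0 < u \<Longrightarrow> (\<lambda>n. f n (u * L n) / L n) \<longlonglongrightarrow> u powr \<beta>"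
    and lim_W: "(\<lambda>n. W n / L n) \<longlonglongrightarrow> 0" and lim_L: "(\<lambda>n. L n / l n) \<longlonglongrightarrow> 0"
    and lim_N: "(\<lambda>n. l n / (p n * (L n)\<^sup>2)) \<longlonglongrightarrow> 0"
    and early: "\<And>\<delta>. 0 < \<delta> \<Longrightarrow> eventually (\<lambda>n. \<exists>q\<le>n. real q \<le> \<delta> * (p n * L n) \<and> L n \<le> sum (w n) {1..q}) sequentially"
  shows "(\<lambda>n. measure_pmf.prob (MNR_percolated n (w n) (p n))
     {E. \<not> dominant_class ((1 - e) * (p n * L n)) ((1 + e) * (p n * L n)) (e * (p n * L n)) (components n E)}) \<longlonglongrightarrow> 0"
proof -
  define g where "g = (\<lambda>n. mean_card_rung (p n / l n) (w n) n)"
  have ev_l: "eventually (\<lambda>n. 0 < l n) sequentially"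
    using w(2) eventually_gt_at_top[of 0]
  proof eventually_elim
    case (elim n)
    then show ?case unfolding l_def total_weight_def by (intro sum_pos) auto
  qed
  have ev_pos: "eventually (\<lambda>n. 0 < p n \<and> 0 < L n \<and> 0 < l n) sequentially"
    using p L ev_l by eventually_elim simp
  have lim_pL: "(\<lambda>n. 1 / (p n * L n)) \<longlonglongrightarrow> 0"
  proof -
    have "(\<lambda>n. l n / (p n * (L n)\<^sup>2) * (L n / l n)) \<longlonglongrightarrow> 0 * 0"
      by (intro tendsto_mult lim_N lim_L)
    moreover have "eventually (\<lambda>n. l n / (p n * (L n)\<^sup>2) * (L n / l n) = 1 / (p n * L n)) sequentially"
      using ev_pos by eventually_elim (simp add: power2_eq_square)
    ultimately have "(\<lambda>n. 1 / (p n * L n)) \<longlonglongrightarrow> 0 * 0" by (rule Lim_transform_eventually)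
    then show ?thesis by simp
  qed
  have lim_g: "(\<lambda>n. g n (u * L n) / (p n * L n)) \<longlonglongrightarrow> u" if u: "0 < u" for u
  proof (rule tendsto_sandwich)
    have "(\<lambda>n. u - u * (f n (u * L n) / L n * (L n / l n))) \<longlonglongrightarrow> u - u * (u powr \<beta> * 0)"
      by (intro tendsto_intros lim_f lim_L u)
    then show "(\<lambda>n. u - u * (f n (u * L n) / L n * (L n / l n))) \<longlonglongrightarrow> u" by simp
    show "(\<lambda>n. u) \<longlonglongrightarrow> u" by simp
    show "eventually (\<lambda>n. u - u * (f n (u * L n) / L n * (L n / l n)) \<le> g n (u * L n) / (p n * L n)) sequentially"
      using ev_pos
    proof eventually_elim
      case (elim n)
      then have "p n / l n * l n * (u * L n) - p n / l n * (u * L n) * f n (u * L n) \<le> g n (u * L n)"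
        unfolding f_def g_def l_def by (intro mean_card_rung_ge)
      then have "(p n / l n * l n * (u * L n) - p n / l n * (u * L n) * f n (u * L n)) / (p n * L n) \<le> g n (u * L n) / (p n * L n)"
        using elim by (intro divide_right_mono) auto
      moreover have "(p n / l n * l n * (u * L n) - p n / l n * (u * L n) * f n (u * L n)) / (p n * L n)
         = u - u * (f n (u * L n) / L n * (L n / l n))"
        using elim by (simp add: field_simps)
      ultimately show ?case by simp
    qed
    show "eventually (\<lambda>n. g n (u * L n) / (p n * L n) \<le> u) sequentially"
      using ev_pos
    proof eventually_elim
      case (elim n)
      have "g n (u * L n) \<le> p n / l n * l n * (u * L n)"
        unfolding g_def l_def by (rule mean_card_rung_le)
      then show ?case using elim by (simp add: field_simps)
    qed
  qed

  \<comment> \<open>Order of the choices: \<open>u1\<close> fixes the slope bound \<open>\<rho>\<close>, which fixes \<open>M\<close>; then the margin \<open>\<gamma>\<close> of \<open>u powr \<beta>\<close> above the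
      diagonal on \<open>[u0, u1]\<close> fixes the mesh \<open>\<eta>\<close> and the tolerance \<open>tol\<close>.\<close>
  obtain u1 \<rho> where u1: "1 - e / 8 < u1" "1 / 2 < u1" "u1 < 1" and \<rho>: "0 < \<rho>" "\<rho> < 1"
    and slope: "(u1 powr \<beta> - (u1 / 2) powr \<beta>) / (u1 / 2) < \<rho>"
    using powr_secant_less_one[of \<beta> "e / 8"] \<beta> e by auto
  define u0 where "u0 = (1 - \<beta>) * e / 16"
  define u2 where "u2 = 1 + e / 8"
  have be: "0 < (1 - \<beta>) * e" "(1 - \<beta>) * e \<le> e" using \<beta> e by (auto simp: mult_le_cancel_right1)
  have u0: "0 < u0" "u0 \<le> e / 16" "u0 < u1" using be e u1 unfolding u0_def by linarith+
  obtain M :: nat where M': "(\<rho> + 1) / (1 - \<rho>) < real M" using reals_Archimedean2 by blast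
  then have M: "real (Suc M) * \<rho> + 1 \<le> real M" using \<rho> by (simp add: field_simps)
  have M0: "0 < M" using M \<rho> by (cases M) auto
  define \<gamma> where "\<gamma> = (1 - \<beta>) * u0 * (1 - u1)"
  have \<gamma>: "0 < \<gamma>" using \<beta> u0 u1 by (simp add: \<gamma>_def)
  have \<gamma>_le: "\<gamma> \<le> (1 - \<beta>) * e / 16"
  proof -
    have "u0 * (1 - u1) \<le> e / 16 * 1" using u0 u1 by (intro mult_mono) auto
    then have "(1 - \<beta>) * (u0 * (1 - u1)) \<le> (1 - \<beta>) * (e / 16 * 1)" using \<beta> by (intro mult_left_mono) auto
    then show ?thesis by (simp add: \<gamma>_def mult.assoc)
  qed
  define \<eta> where "\<eta> = min (\<gamma> / 4) (e / (8 * real (Suc M)))"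
  define tol where "tol = \<eta> / 4"
  have \<eta>: "0 < \<eta>" "\<eta> \<le> \<gamma> / 4" "real (Suc M) * \<eta> \<le> e / 8"
  proof -
    show "0 < \<eta>" using \<gamma> e by (simp add: \<eta>_def)
    show "\<eta> \<le> \<gamma> / 4" unfolding \<eta>_def by (rule min.cobounded1)
    have "real (Suc M) * \<eta> \<le> real (Suc M) * (e / (8 * real (Suc M)))" unfolding \<eta>_def by (intro mult_left_mono min.cobounded2) simp
    also have "\<dots> = e / 8" by (simp del: of_nat_Suc)
    finally show "real (Suc M) * \<eta> \<le> e / 8" .
  qed
  have tol: "0 < tol" "tol \<le> \<gamma> / 16" "tol \<le> e / 256" using \<eta> \<gamma>_le be unfolding tol_def by linarith+
  define X where "X = {x \<in> (\<lambda>k. u0 + real k * \<eta>) ` {..nat \<lfloor>(u1 - u0) / \<eta>\<rfloor>}. x < u1}"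
  have X: "finite X" "X \<subseteq> {0<..}" "\<And>x. x \<in> X \<Longrightarrow> u0 \<le> x \<and> x < u1"
    using u0 \<eta> by (auto simp: X_def add_pos_nonneg)
  have Xcover: "\<exists>y\<in>X. y \<le> x \<and> x < y + \<eta>" if x: "u0 \<le> x" "x < u1" for x
  proof -
    define k where "k = nat \<lfloor>(x - u0) / \<eta>\<rfloor>"
    have "0 \<le> \<lfloor>(x - u0) / \<eta>\<rfloor>" using x \<eta> by simp
    then have k: "real k \<le> (x - u0) / \<eta>" "(x - u0) / \<eta> < real k + 1" unfolding k_def by linarith+
    have "\<lfloor>(x - u0) / \<eta>\<rfloor> \<le> \<lfloor>(u1 - u0) / \<eta>\<rfloor>" using x \<eta> by (intro floor_mono divide_right_mono) auto
    then have "k \<le> nat \<lfloor>(u1 - u0) / \<eta>\<rfloor>" unfolding k_def by (rule nat_mono)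
    moreover have "u0 + real k * \<eta> \<le> x" "x < u0 + real k * \<eta> + \<eta>" using k \<eta> by (simp_all add: field_simps)
    ultimately show ?thesis using x by (intro bexI[of _ "u0 + real k * \<eta>"]) (auto simp: X_def)
  qed

  have ev1: "eventually (\<lambda>n. \<forall>x\<in>X. (x + \<eta> + tol) * L n \<le> f n (x * L n)) sequentially"
  proof (rule eventually_ball_finite[OF X(1)], rule ballI)
    fix x assume x: "x \<in> X"
    have x01: "0 < x" "x < 1" using X(3)[OF x] u0 u1 by auto
    have "u0 * (1 - u1) \<le> x * (1 - x)" using X(3)[OF x] u0 u1 by (intro mult_mono) auto
    then have "\<gamma> \<le> (1 - \<beta>) * (x * (1 - x))" unfolding \<gamma>_def mult.assoc using \<beta> by (intro mult_left_mono) auto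
    then have "\<gamma> \<le> x powr \<beta> - x" using powr_minus_self_ge[OF x01 \<beta>(2)] by (simp add: mult.assoc)
    then have "x + \<eta> + tol < x powr \<beta>" using \<eta> tol \<gamma> by linarith
    then have "eventually (\<lambda>n. x + \<eta> + tol < f n (x * L n) / L n) sequentially"
      by (rule order_tendstoD(1)[OF lim_f[OF x01(1)]])
    then show "eventually (\<lambda>n. (x + \<eta> + tol) * L n \<le> f n (x * L n)) sequentially"
      using ev_pos by eventually_elim (simp add: field_simps)
  qed
  have u2: "0 < u2" using e by (simp add: u2_def)
  have ev2: "eventually (\<lambda>n. f n (u2 * L n) + tol * L n + u0 * L n + W n \<le> u2 * L n) sequentially"
  proof -
    have "u2 powr \<beta> \<le> 1 + \<beta> * (e / 8)" using powr_le_tangent[OF u2 \<beta>] by (simp add: u2_def)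
    moreover have "tol + u0 < (1 - \<beta>) * e / 8" using tol \<gamma>_le be unfolding u0_def by linarith
    moreover have "(1 - \<beta>) * e / 8 = e / 8 - \<beta> * (e / 8)" by (simp add: algebra_simps diff_divide_distrib)
    ultimately have less: "u2 powr \<beta> + tol + u0 + 0 < u2" by (simp add: u2_def)
    have "(\<lambda>n. f n (u2 * L n) / L n + tol + u0 + W n / L n) \<longlonglongrightarrow> u2 powr \<beta> + tol + u0 + 0"
      by (intro tendsto_intros lim_f u2 lim_W)
    then have "eventually (\<lambda>n. f n (u2 * L n) / L n + tol + u0 + W n / L n < u2) sequentially"
      using less by (rule order_tendstoD(2))
    then show ?thesis using ev_pos by eventually_elim (simp add: field_simps)
  qed
  have ev3: "eventually (\<lambda>n. \<forall>s\<ge>u1 * L n. f n (s + real (Suc M) * (\<eta> * L n)) - f n s + tol * L n + W n \<le> real M * (\<eta> * L n)) sequentially"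
  proof -
    have "(\<lambda>n. (f n (u1 * L n) / L n - f n (u1 / 2 * L n) / L n) / (u1 / 2)) \<longlonglongrightarrow> (u1 powr \<beta> - (u1 / 2) powr \<beta>) / (u1 / 2)"
      by (intro tendsto_intros lim_f) (use u1 in auto)
    then have e1: "eventually (\<lambda>n. (f n (u1 * L n) / L n - f n (u1 / 2 * L n) / L n) / (u1 / 2) < \<rho>) sequentially"
      using slope by (rule order_tendstoD(2))
    have e2: "eventually (\<lambda>n. W n / L n < \<eta> / 2) sequentially"
      by (rule order_tendstoD(2)[OF lim_W]) (use \<eta> in simp)
    show ?thesis using e1 e2 ev_pos
    proof eventually_elim
      case (elim n)
      show ?case
      proof (intro allI impI)
        fix s assume s: "u1 * L n \<le> s"
        define h where "h = real (Suc M) * (\<eta> * L n)"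
        have h: "0 \<le> h" using elim \<eta> by (simp add: h_def)
        have "f n (s + h) - f n s \<le> h / (u1 * L n / 2) * (f n (u1 * L n) - f n (u1 * L n / 2))"
          unfolding f_def by (rule mean_weight_rung_secant) (use elim w s h u1 in auto)
        also have "\<dots> = h * ((f n (u1 * L n) / L n - f n (u1 / 2 * L n) / L n) / (u1 / 2))"
          using elim u1 by (simp add: field_simps)
        also have "\<dots> \<le> h * \<rho>" using h elim by (intro mult_left_mono) auto
        also have "\<dots> = (real (Suc M) * \<rho>) * (\<eta> * L n)" by (simp add: h_def mult_ac)
        also have "\<dots> \<le> (real M - 1) * (\<eta> * L n)" using M \<eta> elim by (intro mult_right_mono) auto
        finally have "f n (s + h) - f n s \<le> real M * (\<eta> * L n) - \<eta> * L n" by (simp add: algebra_simps)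
        moreover have "W n \<le> \<eta> * L n / 2" using elim by (simp add: field_simps)
        moreover have "tol * L n = \<eta> * L n / 4" by (simp add: tol_def)
        moreover have "0 < \<eta> * L n" using \<eta> elim by simp
        ultimately show "f n (s + real (Suc M) * (\<eta> * L n)) - f n s + tol * L n + W n \<le> real M * (\<eta> * L n)"
          unfolding h_def by linarith
      qed
    qed
  qed
  have ev4: "eventually (\<lambda>n. g n (u * L n) + tol * (p n * L n) + 1 \<le> B * (p n * L n)) sequentially"
    if "0 < u" "u + tol < B" for u B
  proof -
    have "(\<lambda>n. g n (u * L n) / (p n * L n) + tol + 1 / (p n * L n)) \<longlonglongrightarrow> u + tol + 0"
      by (intro tendsto_intros lim_g lim_pL that)
    then have "eventually (\<lambda>n. g n (u * L n) / (p n * L n) + tol + 1 / (p n * L n) < B) sequentially"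
      by (rule order_tendstoD(2)) (use that in simp)
    then show ?thesis using ev_pos
    proof eventually_elim
      case (elim n)
      define y where "y = p n * L n"
      have "0 < y" using elim by (simp add: y_def)
      then show ?case using elim(1) unfolding y_def[symmetric] by (simp add: field_simps)
    qed
  qed
  have ev5: "eventually (\<lambda>n. real (Suc M) * \<eta> * (p n * L n) + tol * (p n * L n) + 1 \<le> e * (p n * L n)) sequentially"
  proof -
    have "(\<lambda>n. real (Suc M) * \<eta> + tol + 1 / (p n * L n)) \<longlonglongrightarrow> real (Suc M) * \<eta> + tol + 0"
      by (intro tendsto_intros lim_pL)
    then have "eventually (\<lambda>n. real (Suc M) * \<eta> + tol + 1 / (p n * L n) < e) sequentially"
      by (rule order_tendstoD(2)) (use \<eta> tol e in simp)
    then show ?thesis using ev_pos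
    proof eventually_elim
      case (elim n)
      define y where "y = p n * L n"
      have "0 < y" using elim by (simp add: y_def)
      then show ?case using elim(1) unfolding y_def[symmetric] by (simp add: field_simps)
    qed
  qed
  have ev6: "eventually (\<lambda>n. (1 - e) * (p n * L n) + g n (u0 * L n) + 2 * tol * (p n * L n) + e / 8 * (p n * L n) \<le> g n (u1 * L n)) sequentially"
  proof -
    have "(\<lambda>n. g n (u1 * L n) / (p n * L n) - g n (u0 * L n) / (p n * L n)) \<longlonglongrightarrow> u1 - u0"
      by (intro tendsto_intros lim_g) (use u0 u1 in auto)
    then have "eventually (\<lambda>n. (1 - e) + 2 * tol + e / 8 < g n (u1 * L n) / (p n * L n) - g n (u0 * L n) / (p n * L n)) sequentially"
      by (rule order_tendstoD(1)) (use u0 u1 tol e in simp)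
    then show ?thesis using ev_pos
    proof eventually_elim
      case (elim n)
      define y where "y = p n * L n"
      have "0 < y" using elim by (simp add: y_def)
      then show ?case using elim(1) unfolding y_def[symmetric] by (simp add: field_simps)
    qed
  qed

  define var where "var = (\<lambda>n x. f n (x * L n) / (p n / l n * (x * L n)) / (tol * L n)\<^sup>2)"
  define bound where "bound = (\<lambda>n. sum (var n) X + var n u2 + real (Suc M) * var n u1
       + p n * ((u0 + u1 + u2) * L n) / (tol * (p n * L n))\<^sup>2
       + real (Suc M) * (p n * (u1 * L n + l n + real (M + 2) * (\<eta> * L n))) / (tol * (p n * L n))\<^sup>2)"
  have tendsto_eq_rhs: "(h \<longlonglongrightarrow> x) \<Longrightarrow> x = y \<Longrightarrow> h \<longlonglongrightarrow> y" for h :: "nat \<Rightarrow> real" and x y by simp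
  have limA: "(\<lambda>n. var n x) \<longlonglongrightarrow> 0" if x: "0 < x" for x
  proof -
    have "(\<lambda>n. 1 / (x * tol\<^sup>2) * (f n (x * L n) / L n * (l n / (p n * (L n)\<^sup>2)))) \<longlonglongrightarrow> 0"
      by (rule tendsto_eq_rhs[where x = "1 / (x * tol\<^sup>2) * (x powr \<beta> * 0)"], intro tendsto_mult tendsto_const lim_f lim_N x) simp
    moreover have "eventually (\<lambda>n. 1 / (x * tol\<^sup>2) * (f n (x * L n) / L n * (l n / (p n * (L n)\<^sup>2)))
       = var n x) sequentially"
      using ev_pos by eventually_elim (use x tol in \<open>simp add: var_def field_simps power2_eq_square power_mult_distrib\<close>)
    ultimately show ?thesis by (rule Lim_transform_eventually)
  qed
  have limB: "(\<lambda>n. p n * ((u0 + u1 + u2) * L n) / (tol * (p n * L n))\<^sup>2) \<longlonglongrightarrow> 0"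
  proof -
    have "(\<lambda>n. (u0 + u1 + u2) / tol\<^sup>2 * (1 / (p n * L n))) \<longlonglongrightarrow> 0"
      by (rule tendsto_eq_rhs[where x = "(u0 + u1 + u2) / tol\<^sup>2 * 0"], intro tendsto_mult tendsto_const lim_pL) simp
    moreover have "eventually (\<lambda>n. (u0 + u1 + u2) / tol\<^sup>2 * (1 / (p n * L n))
       = p n * ((u0 + u1 + u2) * L n) / (tol * (p n * L n))\<^sup>2) sequentially"
      using ev_pos by eventually_elim (use tol in \<open>simp add: field_simps power2_eq_square power_mult_distrib\<close>)
    ultimately show ?thesis by (rule Lim_transform_eventually)
  qed
  have limC: "(\<lambda>n. real (Suc M) * (p n * (u1 * L n + l n + real (M + 2) * (\<eta> * L n))) / (tol * (p n * L n))\<^sup>2) \<longlonglongrightarrow> 0"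
  proof -
    have "(\<lambda>n. real (Suc M) / tol\<^sup>2 * ((u1 + real (M + 2) * \<eta>) * (1 / (p n * L n)) + l n / (p n * (L n)\<^sup>2))) \<longlonglongrightarrow> 0"
      by (rule tendsto_eq_rhs[where x = "real (Suc M) / tol\<^sup>2 * ((u1 + real (M + 2) * \<eta>) * 0 + 0)"],
          intro tendsto_mult tendsto_add tendsto_const lim_pL lim_N) simp
    moreover have "eventually (\<lambda>n. real (Suc M) / tol\<^sup>2 * ((u1 + real (M + 2) * \<eta>) * (1 / (p n * L n)) + l n / (p n * (L n)\<^sup>2))
       = real (Suc M) * (p n * (u1 * L n + l n + real (M + 2) * (\<eta> * L n))) / (tol * (p n * L n))\<^sup>2) sequentially"
      using ev_pos
    proof eventually_elim
      case (elim n)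
      define y z where "y = real (Suc M)" and "z = u1 + real (M + 2) * \<eta>"
      have "u1 * L n + l n + real (M + 2) * (\<eta> * L n) = z * L n + l n" by (simp add: z_def algebra_simps)
      then show ?case unfolding y_def[symmetric] z_def[symmetric] using elim tol by (simp add: field_simps power2_eq_square power_mult_distrib)
    qed
    ultimately show ?thesis by (rule Lim_transform_eventually)
  qed
  have "bound \<longlonglongrightarrow> (\<Sum>x\<in>X. 0) + 0 + real (Suc M) * 0 + 0 + 0"
    unfolding bound_def
    by (intro tendsto_add tendsto_sum tendsto_mult tendsto_const limA limB limC) (use X(2) u1 u2 in auto)
  then have bound_0: "bound \<longlonglongrightarrow> 0" by simp
  have eps: "u0 + tol < e" "u2 + tol < 1 + e" "0 < e / 8" using u0 tol e by (auto simp: u2_def)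
  have "eventually (\<lambda>n. measure_pmf.prob (MNR_percolated n (w n) (p n))
     {E. \<not> dominant_class ((1 - e) * (p n * L n)) ((1 + e) * (p n * L n)) (e * (p n * L n)) (components n E)} \<le> bound n) sequentially"
    using eventually_gt_at_top[of 0] w(2) p ev_pos ev1 ev2 ev3 ev4[OF u0(1) eps(1)] ev4[OF u2 eps(2)] ev5 ev6 early[OF eps(3)]
  proof eventually_elim
    case (elim n)
    obtain q where q: "q \<le> n" "real q \<le> e / 8 * (p n * L n)" "L n \<le> sum (w n) {1..q}"
      using elim(12) by auto
    have feq: "mean_weight_rung (p n / total_weight n (w n)) (w n) n = f n"
      and geq: "mean_card_rung (p n / total_weight n (w n)) (w n) n = g n"
      by (simp_all add: f_def g_def l_def)
    have "u0 * L n \<le> 1 * L n" using u0 u1 elim(4) by (intro mult_right_mono) auto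
    then have q3: "u0 * L n \<le> sum (w n) {1..q}" using q(3) by linarith
    show ?case
      unfolding bound_def var_def f_def l_def
    proof (rule dominant_class_prob_bound[where w = "w n" and n = n and p = "p n" and L = "L n" and M = M and X = X and tol = tol and W = "W n" and q = q and ?u0.0 = u0 and ?u1.0 = u1 and ?u2.0 = u2 and \<eta> = \<eta>,
          OF elim(1) w(1)], unfold feq geq)
      show "0 < w n i" "w n i \<le> W n" if "i \<in> {1..n}" for i using elim(2) that by auto
      show "0 < p n" "p n \<le> 1" "0 < L n" "0 < \<eta>" "0 < tol" "0 < u0" "u0 < u1" "0 < u2" "0 < M" "finite X" "X \<subseteq> {0<..}"
        using elim(3,4) \<eta> tol u0 u2 M0 X by auto
      show "\<exists>y\<in>X. y \<le> x \<and> x < y + \<eta>" if "u0 \<le> x" "x < u1" for x using Xcover that by blast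
      show "(x + \<eta> + tol) * L n \<le> f n (x * L n)" if "x \<in> X" for x using elim(5) that by blast
      show "f n (u2 * L n) + tol * L n + u0 * L n + W n \<le> u2 * L n" by (rule elim(6))
      show "f n (s + real (Suc M) * (\<eta> * L n)) - f n s + tol * L n + W n \<le> real M * (\<eta> * L n)" if "u1 * L n \<le> s" for s
        using elim(7) that by blast
      show "g n (u0 * L n) + tol * (p n * L n) + 1 \<le> e * (p n * L n)" by (rule elim(8))
      show "g n (u2 * L n) + tol * (p n * L n) + 1 \<le> (1 + e) * (p n * L n)" by (rule elim(9))
      show "real (Suc M) * \<eta> * (p n * L n) + tol * (p n * L n) + 1 \<le> e * (p n * L n)" by (rule elim(10))
      show "(1 - e) * (p n * L n) + g n (u0 * L n) + 2 * tol * (p n * L n) + real q \<le> g n (u1 * L n)"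
        using elim(11) q(2) by linarith
      show "u0 * L n \<le> sum (w n) {1..q}" "q \<le> n" by (fact q3, fact q(1))
    qed
  qed
  from tendsto_sandwich[OF _ this tendsto_const bound_0] show ?thesis by simp
qed

section \<open>Riemann sums of the power-law weights\<close>

lemma sum_scaled_bounds:
  fixes h F :: "real \<Rightarrow> real" and N :: real
  assumes N: "0 < N" and deriv: "\<And>y. 0 < y \<Longrightarrow> (F has_real_derivative h y) (at y)"
    and anti: "\<And>x y. 0 < x \<Longrightarrow> x \<le> y \<Longrightarrow> h y \<le> h x"
  shows "F (real (Suc n) / N) - F (1 / N) \<le> (\<Sum>j=1..n. h (real j / N) / N)"
    and "1 \<le> n \<Longrightarrow> (\<Sum>j=1..n. h (real j / N) / N) \<le> h (1 / N) / N + F (real n / N) - F (1 / N)"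
proof -
  have mv: "h (real (Suc j) / N) / N \<le> F (real (Suc j) / N) - F (real j / N) \<and> F (real (Suc j) / N) - F (real j / N) \<le> h (real j / N) / N"
    if "1 \<le> j" for j
  proof -
    have lt: "real j / N < real (Suc j) / N" using N by (simp add: divide_strict_right_mono)
    have j0: "0 < real j / N" using that N by simp
    have "\<exists>z>real j / N. z < real (Suc j) / N \<and> F (real (Suc j) / N) - F (real j / N) = (real (Suc j) / N - real j / N) * h z"
      by (rule MVT2[OF lt]) (use deriv j0 in auto)
    then obtain z where z: "real j / N < z" "z < real (Suc j) / N"
      "F (real (Suc j) / N) - F (real j / N) = (real (Suc j) / N - real j / N) * h z" by blast
    have "real (Suc j) / N - real j / N = 1 / N" by (simp add: diff_divide_distrib[symmetric])
    then have "F (real (Suc j) / N) - F (real j / N) = h z / N" using z(3) by simp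
    moreover have "h (real (Suc j) / N) \<le> h z" "h z \<le> h (real j / N)" using anti z j0 by auto
    ultimately show ?thesis using N by (simp add: divide_right_mono)
  qed
  show "F (real (Suc n) / N) - F (1 / N) \<le> (\<Sum>j=1..n. h (real j / N) / N)"
  proof (induction n)
    case (Suc n)
    then show ?case using mv[of "Suc n"] by simp
  qed simp
  show "(\<Sum>j=1..n. h (real j / N) / N) \<le> h (1 / N) / N + F (real n / N) - F (1 / N)" if "1 \<le> n"
    using that
  proof (induction n rule: dec_induct)
    case base
    then show ?case by simp
  next
    case (step n)
    then show ?case using mv[of n] by simp
  qed
qed

text \<open>The lower incomplete gamma function. Integration by parts raises the exponent by one, which makes the
integrand continuous at 0.\<close>

lemma incomplete_Gamma_exists:
  fixes z :: real
  assumes z: "0 < z"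
  obtains P :: "real \<Rightarrow> real" where "\<And>x. 0 < x \<Longrightarrow> (P has_real_derivative x powr (z - 1) * exp (- x)) (at x)"
    "(P \<longlongrightarrow> Gamma z) at_top" "(P \<longlongrightarrow> 0) (at_right 0)"
proof -
  define k where "k = (\<lambda>t::real. t powr z / exp t)"
  define Q where "Q = (\<lambda>x. integral {0..x} k)"
  define P where "P = (\<lambda>x. (Q x + x powr z * exp (- x)) / z)"
  have contk: "continuous_on {0..b} k" for b
    unfolding k_def by (intro continuous_on_divide continuous_on_powr' continuous_intros) (use z in auto)
  have Q': "(Q has_real_derivative k x) (at x)" if "0 < x" for x
  proof -
    have "(Q has_real_derivative k x) (at x within {0..x + 1})"
      unfolding Q_def by (rule integral_has_real_derivative[OF contk]) (use that in auto)
    then show ?thesis using that by (subst (asm) at_within_Icc_at) auto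
  qed
  have "(P has_real_derivative x powr (z - 1) * exp (- x)) (at x)" if "0 < x" for x
  proof -
    have "(P has_real_derivative (k x + (z * x powr (z - 1) * exp (- x) + x powr z * (- exp (- x)))) / z) (at x)"
      unfolding P_def using that z by (auto intro!: derivative_eq_intros Q')
    moreover have "k x = x powr z * exp (- x)" by (simp add: k_def exp_minus divide_inverse)
    ultimately show ?thesis using z by simp
  qed
  moreover have "(P \<longlongrightarrow> Gamma z) at_top"
  proof -
    have int: "(k has_integral Gamma (z + 1)) {0..}"
      using Gamma_integral_real[of "z + 1"] z by (simp add: k_def)
    have abs: "k absolutely_integrable_on {0..}"
      by (rule nonnegative_absolutely_integrable_1) (use int in \<open>auto simp: k_def\<close>)
    have eq: "set_lebesgue_integral lebesgue {0..b} k = Q b" for b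
      unfolding Q_def by (rule set_lebesgue_integral_eq_integral) (rule set_integrable_subset[OF abs], auto)
    have "((\<lambda>b. set_lebesgue_integral lebesgue {0..b} k) \<longlongrightarrow> set_lebesgue_integral lebesgue {0..} k) at_top"
      by (rule tendsto_set_lebesgue_integral_at_top[OF _ abs]) auto
    moreover have "set_lebesgue_integral lebesgue {0..} k = Gamma (z + 1)"
      using set_lebesgue_integral_eq_integral(2)[OF abs] int by (simp add: integral_unique)
    ultimately have Q: "(Q \<longlongrightarrow> Gamma (z + 1)) at_top" unfolding eq by simp
    have "((\<lambda>x::real. x powr z * exp (- x)) \<longlongrightarrow> 0) at_top" by real_asymp
    from tendsto_divide[OF tendsto_add[OF Q this] tendsto_const[of z]] z
    have "(P \<longlongrightarrow> (Gamma (z + 1) + 0) / z) at_top" unfolding P_def by simp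
    moreover have "Gamma (z + 1) = z * Gamma z" using Gamma_plus1[of z] z by (auto simp: nonpos_Ints_def)
    ultimately show ?thesis using z by simp
  qed
  moreover have "(P \<longlongrightarrow> 0) (at_right 0)"
  proof -
    have "continuous_on {0..1} Q" unfolding Q_def
      by (rule indefinite_integral_continuous_1) (rule integrable_continuous_interval[OF contk])
    then have "continuous_on {0..1} P" unfolding P_def
      by (intro continuous_on_divide continuous_on_add continuous_on_mult continuous_on_powr' continuous_intros) (use z in auto)
    then have "(P \<longlongrightarrow> P 0) (at_right 0)"
      by (rule continuous_on_Icc_at_rightD) simp
    then show ?thesis using z by (simp add: P_def Q_def)
  qed
  ultimately show thesis using that by blast
qed

lemma weight_profile_antimono:
  fixes a \<alpha> :: real
  assumes "0 < a" "0 < \<alpha>" "0 < x" "x \<le> y"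
  shows "y powr (- \<alpha>) * (1 - exp (- (a * y powr (- \<alpha>)))) \<le> x powr (- \<alpha>) * (1 - exp (- (a * x powr (- \<alpha>))))"
proof -
  have "y powr (- \<alpha>) \<le> x powr (- \<alpha>)" using assms by (intro powr_mono2') auto
  then show ?thesis using assms by (intro mult_mono) auto
qed

text \<open>The limit is \<open>\<integral>y powr (- \<alpha>) * (1 - exp (- (a0 * y powr (- \<alpha>))))\<close> over the positive reals. Integration by parts and the
substitution \<open>x = a0 * y powr (- \<alpha>)\<close> turn it into a gamma integral; accordingly the function \<open>F\<close> in the
proof is an antiderivative written with the incomplete gamma function \<open>P\<close>. The parameter \<open>a\<close> may vary with
\<open>n\<close>, because total weight and number of vertices are only asymptotically proportional.\<close>

lemma weight_profile_sum_limit: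
  fixes \<alpha> a0 :: real and a N :: "nat \<Rightarrow> real"
  assumes \<alpha>: "1 / 2 < \<alpha>" "\<alpha> < 1" and a0: "0 < a0" and a: "a \<longlonglongrightarrow> a0" and N: "filterlim N at_top sequentially"
    and nN: "filterlim (\<lambda>n. real n / N n) at_top sequentially"
  shows "(\<lambda>n. \<Sum>j=1..n. (real j / N n) powr (- \<alpha>) * (1 - exp (- (a n * (real j / N n) powr (- \<alpha>)))) / N n)
     \<longlonglongrightarrow> a0 powr (1 / \<alpha> - 1) * Gamma (2 - 1 / \<alpha>) / (1 - \<alpha>)"
proof -
  define z where "z = 2 - 1 / \<alpha>"
  have z: "0 < z" "1 / \<alpha> - 1 = 1 - z" using \<alpha> by (simp_all add: z_def field_simps)
  obtain P where P': "\<And>x. 0 < x \<Longrightarrow> (P has_real_derivative x powr (z - 1) * exp (- x)) (at x)"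
    and P_inf: "(P \<longlongrightarrow> Gamma z) at_top" and P_0: "(P \<longlongrightarrow> 0) (at_right 0)"
    using incomplete_Gamma_exists[OF z(1)] by metis
  define h where "h = (\<lambda>a y. y powr (- \<alpha>) * (1 - exp (- (a * y powr (- \<alpha>)))))"
  \<comment> \<open>The first term comes from the integration by parts; it vanishes at both ends because \<open>1 / 2 < \<alpha> < 1\<close>.\<close>
  define F where "F = (\<lambda>a y. (y powr (1 - \<alpha>) * (1 - exp (- (a * y powr (- \<alpha>)))) - a powr (1 - z) * P (a * y powr (- \<alpha>))) / (1 - \<alpha>))"
  have deriv: "(F a has_real_derivative h a y) (at y)" if a: "0 < a" and y: "0 < y" for a y
  proof -
    define u where "u = y powr (- \<alpha>)"
    have u: "0 < u" using y by (simp add: u_def)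
    have du: "((\<lambda>y. y powr (- \<alpha>)) has_real_derivative (- \<alpha>) * y powr (- \<alpha> - 1)) (at y)"
      using y by (auto intro!: derivative_eq_intros)
    have dP: "((\<lambda>y. P (a * y powr (- \<alpha>))) has_real_derivative
        ((a * u) powr (z - 1) * exp (- (a * u))) * (a * ((- \<alpha>) * y powr (- \<alpha> - 1)))) (at y)"
      unfolding u_def
      by (rule DERIV_chain2[OF P']) (use a y in \<open>auto intro!: derivative_eq_intros du\<close>)
    have dv: "((\<lambda>y. y powr (1 - \<alpha>)) has_real_derivative (1 - \<alpha>) * y powr (- \<alpha>)) (at y)"
      using y by (auto intro!: derivative_eq_intros)
    have de: "((\<lambda>y. 1 - exp (- (a * y powr (- \<alpha>)))) has_real_derivative exp (- (a * u)) * (a * ((- \<alpha>) * y powr (- \<alpha> - 1)))) (at y)"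
      unfolding u_def using y by (auto intro!: derivative_eq_intros du)
    have D: "(F a has_real_derivative (((1 - \<alpha>) * y powr (- \<alpha>) * (1 - exp (- (a * y powr (- \<alpha>)))) + exp (- (a * u)) * (a * ((- \<alpha>) * y powr (- \<alpha> - 1))) * y powr (1 - \<alpha>))
       - a powr (1 - z) * (((a * u) powr (z - 1) * exp (- (a * u))) * (a * ((- \<alpha>) * y powr (- \<alpha> - 1))))) / (1 - \<alpha>)) (at y)"
      unfolding F_def by (intro DERIV_cdivide DERIV_diff DERIV_cmult DERIV_mult dv de dP)
    have "a powr (1 - z) * ((a * u) powr (z - 1)) = y powr (1 - \<alpha>)"
    proof -
      have "(a * u) powr (z - 1) = a powr (z - 1) * u powr (z - 1)" using a u by (simp add: powr_mult)
      moreover have "a powr (1 - z) * a powr (z - 1) = 1" using a by (simp add: powr_add[symmetric])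
      moreover have "u powr (z - 1) = y powr (1 - \<alpha>)"
        using \<alpha> by (simp add: u_def powr_powr z_def algebra_simps)
      ultimately show ?thesis by (metis mult.assoc mult_1)
    qed
    then have cancel: "a powr (1 - z) * (((a * u) powr (z - 1) * exp (- (a * u))) * (a * ((- \<alpha>) * y powr (- \<alpha> - 1))))
      = exp (- (a * u)) * (a * ((- \<alpha>) * y powr (- \<alpha> - 1))) * y powr (1 - \<alpha>)"
      by (metis mult.assoc mult.commute)
    show ?thesis using D unfolding cancel h_def using \<alpha> by simp
  qed
  have anti: "h a y \<le> h a x" if "0 < a" "0 < x" "x \<le> y" for a x y
    unfolding h_def using weight_profile_antimono that \<alpha> by simp
  have apos: "eventually (\<lambda>n. 0 < a n) sequentially" by (rule order_tendstoD(1)[OF a a0])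
  have Npos: "eventually (\<lambda>n. 0 < N n) sequentially" using N by (simp add: filterlim_at_top_dense)
  have F_0: "(\<lambda>n. F (a n) (y n)) \<longlonglongrightarrow> - (a0 powr (1 - z) * Gamma z / (1 - \<alpha>))"
    if y: "filterlim y (at_right 0) sequentially" for y
  proof -
    have "filterlim (\<lambda>x::real. x powr (- \<alpha>)) at_top (at_right 0)" using \<alpha> by real_asymp
    from filterlim_compose[OF this y]
    have "filterlim (\<lambda>n. a n * y n powr (- \<alpha>)) at_top sequentially"
      by (rule filterlim_tendsto_pos_mult_at_top[OF a a0])
    then have 1: "(\<lambda>n. P (a n * y n powr (- \<alpha>))) \<longlonglongrightarrow> Gamma z" by (rule filterlim_compose[OF P_inf])
    have "((\<lambda>x::real. x powr (1 - \<alpha>)) \<longlongrightarrow> 0) (at_right 0)" using \<alpha> by real_asymp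
    from filterlim_compose[OF this y] have 2: "(\<lambda>n. y n powr (1 - \<alpha>)) \<longlonglongrightarrow> 0" .
    have 3: "(\<lambda>n. y n powr (1 - \<alpha>) * (1 - exp (- (a n * y n powr (- \<alpha>))))) \<longlonglongrightarrow> 0"
    proof (rule tendsto_sandwich[OF _ _ tendsto_const 2])
      show "eventually (\<lambda>n. 0 \<le> y n powr (1 - \<alpha>) * (1 - exp (- (a n * y n powr (- \<alpha>))))) sequentially"
        using apos by eventually_elim simp
      show "eventually (\<lambda>n. y n powr (1 - \<alpha>) * (1 - exp (- (a n * y n powr (- \<alpha>)))) \<le> y n powr (1 - \<alpha>)) sequentially"
        by (intro always_eventually allI mult_left_le) auto
    qed
    have "(\<lambda>n. (y n powr (1 - \<alpha>) * (1 - exp (- (a n * y n powr (- \<alpha>)))) - a n powr (1 - z) * P (a n * y n powr (- \<alpha>))) / (1 - \<alpha>))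
       \<longlonglongrightarrow> (0 - a0 powr (1 - z) * Gamma z) / (1 - \<alpha>)"
      by (intro tendsto_intros 1 3 a) (use \<alpha> a0 in auto)
    then show ?thesis unfolding F_def by simp
  qed
  have F_inf: "(\<lambda>n. F (a n) (y n)) \<longlonglongrightarrow> 0" if y: "filterlim y at_top sequentially" for y
  proof -
    have ypos: "eventually (\<lambda>n. 0 < y n) sequentially" using y unfolding filterlim_at_top_dense by blast
    have "((\<lambda>x::real. x powr (- \<alpha>)) \<longlongrightarrow> 0) at_top" using \<alpha> by real_asymp
    from filterlim_compose[OF this y] have "(\<lambda>n. a n * y n powr (- \<alpha>)) \<longlonglongrightarrow> a0 * 0" by (intro tendsto_mult a)
    moreover have "eventually (\<lambda>n. a n * y n powr (- \<alpha>) > 0) sequentially"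
      using apos ypos by eventually_elim (auto simp: zero_less_mult_iff)
    ultimately have "filterlim (\<lambda>n. a n * y n powr (- \<alpha>)) (at_right 0) sequentially"
      by (intro tendsto_imp_filterlim_at_right) auto
    then have 1: "(\<lambda>n. P (a n * y n powr (- \<alpha>))) \<longlonglongrightarrow> 0" by (rule filterlim_compose[OF P_0])
    have "((\<lambda>x::real. x powr (1 - \<alpha>) * x powr (- \<alpha>)) \<longlongrightarrow> 0) at_top" using \<alpha> by real_asymp
    from tendsto_mult[OF a filterlim_compose[OF this y]]
    have 2: "(\<lambda>n. a n * (y n powr (1 - \<alpha>) * y n powr (- \<alpha>))) \<longlonglongrightarrow> 0" by simp
    have 3: "(\<lambda>n. y n powr (1 - \<alpha>) * (1 - exp (- (a n * y n powr (- \<alpha>))))) \<longlonglongrightarrow> 0"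
    proof (rule tendsto_sandwich[OF _ _ tendsto_const 2])
      show "eventually (\<lambda>n. 0 \<le> y n powr (1 - \<alpha>) * (1 - exp (- (a n * y n powr (- \<alpha>))))) sequentially"
        using apos by eventually_elim simp
      have "(1 - exp (- x)) \<le> x" for x :: real using exp_ge_add_one_self[of "- x"] by linarith
      then have "y n powr (1 - \<alpha>) * (1 - exp (- (a n * y n powr (- \<alpha>)))) \<le> y n powr (1 - \<alpha>) * (a n * y n powr (- \<alpha>))" for n
        by (intro mult_left_mono) auto
      then show "eventually (\<lambda>n. y n powr (1 - \<alpha>) * (1 - exp (- (a n * y n powr (- \<alpha>))))
         \<le> a n * (y n powr (1 - \<alpha>) * y n powr (- \<alpha>))) sequentially"
        by (simp add: mult_ac)
    qed
    have "(\<lambda>n. (y n powr (1 - \<alpha>) * (1 - exp (- (a n * y n powr (- \<alpha>)))) - a n powr (1 - z) * P (a n * y n powr (- \<alpha>))) / (1 - \<alpha>))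
       \<longlonglongrightarrow> (0 - a0 powr (1 - z) * 0) / (1 - \<alpha>)"
      by (intro tendsto_intros 1 3 a) (use \<alpha> a0 in auto)
    then show ?thesis unfolding F_def by simp
  qed
  have inv_N: "filterlim (\<lambda>n. 1 / N n) (at_right 0) sequentially"
  proof -
    have "filterlim (\<lambda>x::real. 1 / x) (at_right 0) at_top" by real_asymp
    from filterlim_compose[OF this N] show ?thesis .
  qed
  have h_0: "(\<lambda>n. h (a n) (1 / N n) / N n) \<longlonglongrightarrow> 0"
  proof -
    have "((\<lambda>x::real. (1 / x) powr (- \<alpha>) / x) \<longlongrightarrow> 0) at_top" using \<alpha> by real_asymp
    from filterlim_compose[OF this N] have 2: "(\<lambda>n. (1 / N n) powr (- \<alpha>) / N n) \<longlonglongrightarrow> 0" by simp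
    show ?thesis
    proof (rule tendsto_sandwich[OF _ _ tendsto_const 2])
      show "eventually (\<lambda>n. 0 \<le> h (a n) (1 / N n) / N n) sequentially"
        using apos Npos by eventually_elim (simp add: h_def)
      show "eventually (\<lambda>n. h (a n) (1 / N n) / N n \<le> (1 / N n) powr (- \<alpha>) / N n) sequentially"
        using Npos by eventually_elim (auto simp: h_def intro!: divide_right_mono mult_left_le)
    qed
  qed
  have nN': "filterlim (\<lambda>n. real (Suc n) / N n) at_top sequentially"
    by (rule filterlim_at_top_mono[OF nN]) (use Npos in \<open>eventually_elim, auto intro!: divide_right_mono\<close>)
  define G where "G = a0 powr (1 - z) * Gamma z / (1 - \<alpha>)"
  have "(\<lambda>n. \<Sum>j=1..n. h (a n) (real j / N n) / N n) \<longlonglongrightarrow> G"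
  proof (rule tendsto_sandwich)
    show "eventually (\<lambda>n. F (a n) (real (Suc n) / N n) - F (a n) (1 / N n) \<le> (\<Sum>j=1..n. h (a n) (real j / N n) / N n)) sequentially"
      using apos Npos
    proof eventually_elim
      case (elim n)
      show ?case by (rule sum_scaled_bounds(1)[OF elim(2)]) (use deriv anti elim(1) in auto)
    qed
    show "eventually (\<lambda>n. (\<Sum>j=1..n. h (a n) (real j / N n) / N n) \<le> h (a n) (1 / N n) / N n + F (a n) (real n / N n) - F (a n) (1 / N n)) sequentially"
      using apos Npos eventually_ge_at_top[of 1]
    proof eventually_elim
      case (elim n)
      show ?case by (rule sum_scaled_bounds(2)[OF elim(2) _ _ elim(3)]) (use deriv anti elim(1) in auto)
    qed
    have "(\<lambda>n. F (a n) (real (Suc n) / N n) - F (a n) (1 / N n)) \<longlonglongrightarrow> 0 - (- G)"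
      unfolding G_def by (intro tendsto_diff F_inf nN' F_0 inv_N)
    then show "(\<lambda>n. F (a n) (real (Suc n) / N n) - F (a n) (1 / N n)) \<longlonglongrightarrow> G" by simp
    have "(\<lambda>n. h (a n) (1 / N n) / N n + F (a n) (real n / N n) - F (a n) (1 / N n)) \<longlonglongrightarrow> 0 + 0 - (- G)"
      unfolding G_def by (intro tendsto_diff tendsto_add h_0 F_inf nN F_0 inv_N)
    then show "(\<lambda>n. h (a n) (1 / N n) / N n + F (a n) (real n / N n) - F (a n) (1 / N n)) \<longlonglongrightarrow> G" by simp
  qed
  then show ?thesis unfolding h_def G_def z(2) by (simp add: z_def)
qed

lemma weight_profile_mean:
  fixes \<alpha> :: real
  assumes \<alpha>: "0 < \<alpha>" "\<alpha> < 1"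
  shows "(\<lambda>n. \<Sum>j=1..n. (real j / real n) powr (- \<alpha>) / real n) \<longlonglongrightarrow> inverse (1 - \<alpha>)"
proof -
  define F where "F = (\<lambda>y::real. y powr (1 - \<alpha>) / (1 - \<alpha>))"
  have deriv: "(F has_real_derivative y powr (- \<alpha>)) (at y)" if "0 < y" for y
    unfolding F_def using that \<alpha> by (auto intro!: derivative_eq_intros)
  have anti: "y powr (- \<alpha>) \<le> x powr (- \<alpha>)" if "0 < x" "x \<le> y" for x y
    using that \<alpha> by (intro powr_mono2') auto
  have pos: "eventually (\<lambda>n. 1 \<le> n) (sequentially)" by (rule eventually_ge_at_top)
  show ?thesis
  proof (rule tendsto_sandwich)
    show "eventually (\<lambda>n. F (real (Suc n) / real n) - F (1 / real n) \<le> (\<Sum>j=1..n. (real j / real n) powr (- \<alpha>) / real n)) sequentially"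
      using pos by eventually_elim (rule sum_scaled_bounds(1), use deriv anti in auto)
    show "eventually (\<lambda>n. (\<Sum>j=1..n. (real j / real n) powr (- \<alpha>) / real n) \<le> (1 / real n) powr (- \<alpha>) / real n + F (real n / real n) - F (1 / real n)) sequentially"
      using pos by eventually_elim (rule sum_scaled_bounds(2), use deriv anti in auto)
    show "(\<lambda>n. F (real (Suc n) / real n) - F (1 / real n)) \<longlonglongrightarrow> inverse (1 - \<alpha>)"
      unfolding F_def using \<alpha> by real_asymp
    show "(\<lambda>n. (1 / real n) powr (- \<alpha>) / real n + F (real n / real n) - F (1 / real n)) \<longlonglongrightarrow> inverse (1 - \<alpha>)"
      unfolding F_def using \<alpha> by real_asymp
  qed
qed

section \<open>The largest components of the percolated graph\<close>

theorem theorem1p2: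
  fixes \<tau> C :: real and lam p :: "nat \<Rightarrow> real"
  assumes "2 < \<tau>" and "\<tau> < 3" and "C > 0"
    and "filterlim lam at_top sequentially"
    and "lam \<in> o(\<lambda>n. real n powr ((3 - \<tau>) / (\<tau> - 1)))"
    and "\<And>n. p n = lam n * real n powr (- ((3 - \<tau>) / (\<tau> - 1)))"
  shows "converges_in_probability
           (\<lambda>n. measure_pmf (MNR_percolated n (weight \<tau> C n) (p n)))
           (\<lambda>n E. real (component_size n E 1) / (real n * p n powr (1 / (3 - \<tau>))))
           (mean_weight \<tau> C * kappa \<tau> C powr (1 / (3 - \<tau>)))
       \<and> (\<forall>j\<ge>2. converges_in_probability
           (\<lambda>n. measure_pmf (MNR_percolated n (weight \<tau> C n) (p n)))
           (\<lambda>n E. real (component_size n E j) / (real n * p n powr (1 / (3 - \<tau>))))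
           0)"
proof -
  define \<alpha> where "\<alpha> = 1 / (\<tau> - 1)"
  define \<beta> where "\<beta> = \<tau> - 2"
  define z where "z = 3 - \<tau>"
  define cF where "cF = c_F \<tau> C"
  define w where "w = weight \<tau> C"
  have \<tau>: "2 < \<tau>" "\<tau> < 3" by fact+
  have \<alpha>: "1 / 2 < \<alpha>" "\<alpha> < 1" using \<tau> by (simp_all add: \<alpha>_def field_simps)
  have \<beta>: "0 < \<beta>" "\<beta> < 1" using \<tau> by (simp_all add: \<beta>_def)
  have z: "0 < z" "\<beta> + z = 1" using \<tau> by (simp_all add: z_def \<beta>_def)
  have \<alpha>z: "1 / \<alpha> - 1 = \<beta>" "2 - 1 / \<alpha> = z" using \<tau> by (simp_all add: \<alpha>_def \<beta>_def z_def)
  have cF: "0 < cF" using \<open>0 < C\<close> by (simp add: cF_def c_F_def)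
  have w_def': "w n j = cF * (real n / real j) powr \<alpha>" for n j by (simp add: w_def weight_def cF_def \<alpha>_def)
  have w0: "0 \<le> w n j" for n j using cF by (simp add: w_def')

  define \<mu> where "\<mu> = cF * inverse (1 - \<alpha>)"
  have \<mu>: "0 < \<mu>" using cF \<alpha> by (simp add: \<mu>_def)
  have lim_\<mu>: "(\<lambda>n. total_weight n (w n) / real n) \<longlonglongrightarrow> \<mu>"
  proof -
    have "total_weight n (w n) / real n = cF * (\<Sum>j=1..n. (real j / real n) powr (- \<alpha>) / real n)" for n
      unfolding total_weight_def w_def' sum_distrib_left sum_divide_distrib
      by (intro sum.cong refl) (simp add: powr_minus powr_divide field_simps)
    then show ?thesis unfolding \<mu>_def
      using tendsto_mult[OF tendsto_const[of cF] weight_profile_mean[of \<alpha>]] \<alpha> by simp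
  qed
  then have mean: "mean_weight \<tau> C = \<mu>" unfolding mean_weight_def w_def[symmetric] by (rule limI)

  define \<kappa> where "\<kappa> = kappa \<tau> C"
  have \<kappa>_eq: "\<kappa> = cF powr \<beta> * Gamma z" by (simp add: \<kappa>_def kappa_def cF_def \<beta>_def z_def)
  have \<kappa>: "0 < \<kappa>" using cF z by (simp add: \<kappa>_eq Gamma_real_pos)
  define X where "X = \<mu> * \<kappa> powr (1 / z)"
  have X: "0 < X" using \<mu> \<kappa> by (simp add: X_def)

  have lam_pos: "eventually (\<lambda>n. 0 < lam n) sequentially" using assms(4) by (simp add: filterlim_at_top_dense)
  have npos: "eventually (\<lambda>n::nat. 0 < n) sequentially" by (rule eventually_gt_at_top)
  have p_pos: "eventually (\<lambda>n. 0 < p n) sequentially"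
    using lam_pos npos by eventually_elim (simp add: assms(6))
  have pos: "eventually (\<lambda>n. 0 < p n \<and> 0 < n) sequentially" using p_pos npos by (rule eventually_conj)
  have p_0: "p \<longlonglongrightarrow> 0"
  proof -
    have "(\<lambda>n. lam n / real n powr ((3 - \<tau>) / (\<tau> - 1))) \<longlonglongrightarrow> 0" using assms(5) by (rule smalloD_tendsto)
    moreover have "p = (\<lambda>n. lam n / real n powr ((3 - \<tau>) / (\<tau> - 1)))"
      by (rule ext) (simp add: assms(6) powr_minus divide_inverse)
    ultimately show ?thesis by simp
  qed
  have p_at: "filterlim p (at_right 0) sequentially" by (rule tendsto_imp_filterlim_at_right[OF p_0 p_pos])
  have p_powr: "(\<lambda>n. p n powr e) \<longlonglongrightarrow> 0" if "0 < e" for e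
  proof -
    have "((\<lambda>x::real. x powr e) \<longlongrightarrow> 0) (at_right 0)" using that by real_asymp
    from filterlim_compose[OF this p_at] show ?thesis by simp
  qed

  \<comment> \<open>The vertices that matter for the connectivity of the giant have weight of order \<open>b\<close>; there are about \<open>N\<close>
      of them, with indices of order \<open>N\<close>. So \<open>L\<close> is the order of their total weight, and \<open>X\<close> is chosen such
      that the rung weight meets the diagonal at \<open>L\<close>.\<close>
  define b where "b = (\<lambda>n. p n powr (- 1 / z))"
  define N where "N = (\<lambda>n. real n * p n powr ((\<tau> - 1) / z))"
  define L where "L = (\<lambda>n. X * real n * p n powr (\<beta> / z))"
  define l where "l = (\<lambda>n. total_weight n (w n))"
  have R: "0 < b n" "0 < N n" "p n * (b n)\<^sup>2 * N n = real n" "L n = X * b n * N n" "(real n / N n) powr \<alpha> = b n"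
      "p n * L n = X * (real n * p n powr (1 / z))" "N n = real n * p n powr ((\<tau> - 1) / z)" "0 < L n" "0 < p n * L n"
    if "0 < p n \<and> 0 < n" for n
  proof -
    have pn: "0 < p n" "0 < real n" using that by auto
    show b: "0 < b n" and N: "0 < N n" using pn by (simp_all add: b_def N_def)
    have "p n * (b n)\<^sup>2 * N n = real n * (p n powr 1 * p n powr (2 * (- 1 / z)) * p n powr ((\<tau> - 1) / z))"
      using pn by (simp add: b_def N_def powr_power mult_ac)
    also have "\<dots> = real n * p n powr (1 + 2 * (- 1 / z) + (\<tau> - 1) / z)" by (simp only: powr_add)
    also have "1 + 2 * (- 1 / z) + (\<tau> - 1) / z = 0" using \<tau> by (simp add: z_def field_simps)
    finally show "p n * (b n)\<^sup>2 * N n = real n" using pn by simp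
    have "b n * N n = real n * (p n powr (- 1 / z) * p n powr ((\<tau> - 1) / z))" by (simp add: b_def N_def mult_ac)
    also have "p n powr (- 1 / z) * p n powr ((\<tau> - 1) / z) = p n powr (\<beta> / z)"
    proof -
      have "- 1 / z + (\<tau> - 1) / z = \<beta> / z" by (simp add: \<beta>_def diff_divide_distrib)
      then show ?thesis unfolding powr_add[symmetric] by simp
    qed
    finally show L: "L n = X * b n * N n" by (simp add: L_def)
    have "(real n / N n) powr \<alpha> = (p n powr (- ((\<tau> - 1) / z))) powr \<alpha>"
    proof -
      have "real n / N n = p n powr (- ((\<tau> - 1) / z))" using pn by (simp add: N_def powr_minus field_simps)
      then show ?thesis by simp
    qed
    also have "\<dots> = b n" unfolding powr_powr b_def using \<tau> by (simp add: \<alpha>_def)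
    finally show "(real n / N n) powr \<alpha> = b n" .
    have "p n * L n = X * (real n * (p n powr 1 * p n powr (\<beta> / z)))" using pn by (simp add: L_def mult_ac)
    also have "p n powr 1 * p n powr (\<beta> / z) = p n powr (1 / z)"
    proof -
      have "1 + \<beta> / z = 1 / z" using z by (simp add: field_simps)
      then show ?thesis unfolding powr_add[symmetric] by simp
    qed
    finally show "p n * L n = X * (real n * p n powr (1 / z))" .
    show "N n = real n * p n powr ((\<tau> - 1) / z)" by (simp add: N_def)
    show "0 < L n" "0 < p n * L n" using pn b N X L by simp_all
  qed
  have up: "filterlim (\<lambda>x::real. x powr e) at_top at_top" and down: "filterlim (\<lambda>x::real. x powr (- e)) at_top (at_right 0)"
    if "0 < e" for e
    using that by real_asymp+
  \<comment> \<open>\<open>N\<close> is a positive power of \<open>lam\<close>, so it tends to infinity because \<open>lam\<close> does.\<close>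
  have N_top: "filterlim N at_top sequentially"
  proof -
    have "filterlim (\<lambda>x::real. x powr ((\<tau> - 1) / z)) at_top at_top"
      using up[of "(\<tau> - 1) / z"] \<tau> z by simp
    from filterlim_compose[OF this assms(4)] have "filterlim (\<lambda>n. lam n powr ((\<tau> - 1) / z)) at_top sequentially" by simp
    moreover have "eventually (\<lambda>n. lam n powr ((\<tau> - 1) / z) = N n) sequentially"
      using lam_pos npos
    proof eventually_elim
      case (elim n)
      have "p n powr ((\<tau> - 1) / z) = lam n powr ((\<tau> - 1) / z) * (real n powr (- (z / (\<tau> - 1)))) powr ((\<tau> - 1) / z)"
        using elim by (simp add: assms(6) powr_mult z_def)
      also have "(real n powr (- (z / (\<tau> - 1)))) powr ((\<tau> - 1) / z) = real n powr (- 1)"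
        unfolding powr_powr using \<tau> z by simp
      finally show ?case using elim by (simp add: N_def powr_minus)
    qed
    ultimately show ?thesis by (rule filterlim_mono_eventually[OF _ order_refl order_refl])
  qed
  have nN_top: "filterlim (\<lambda>n. real n / N n) at_top sequentially"
  proof -
    have "filterlim (\<lambda>x::real. x powr (- ((\<tau> - 1) / z))) at_top (at_right 0)"
      using down[of "(\<tau> - 1) / z"] \<tau> z by simp
    from filterlim_compose[OF this p_at] have "filterlim (\<lambda>n. p n powr (- ((\<tau> - 1) / z))) at_top sequentially" by simp
    moreover have "eventually (\<lambda>n. p n powr (- ((\<tau> - 1) / z)) = real n / N n) sequentially"
      using pos by eventually_elim (simp add: N_def powr_minus field_simps)
    ultimately show ?thesis by (rule filterlim_mono_eventually[OF _ order_refl order_refl])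
  qed
  have l_ratio: "(\<lambda>n. l n / real n) \<longlonglongrightarrow> \<mu>" using lim_\<mu> by (simp add: l_def)
  have l_pos: "eventually (\<lambda>n. 0 < l n) sequentially"
    using order_tendstoD(1)[OF l_ratio \<mu>] npos by eventually_elim (simp add: zero_less_divide_iff)
  have inv_N: "(\<lambda>n. 1 / N n) \<longlonglongrightarrow> 0"
    using tendsto_inverse_0_at_top[OF N_top] by (simp add: inverse_eq_divide)

  have lim_f: "(\<lambda>n. mean_weight_rung (p n / l n) (w n) n (u * L n) / L n) \<longlonglongrightarrow> u powr \<beta>" if u: "0 < u" for u
  proof -
    define a where "a = (\<lambda>n. cF * u * X / (l n / real n))"
    define a0 where "a0 = cF * u * X / \<mu>"
    have a0: "0 < a0" using cF u X \<mu> by (simp add: a0_def)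
    have a: "a \<longlonglongrightarrow> a0" unfolding a_def a0_def by (intro tendsto_intros l_ratio) (use \<mu> in auto)
    have "(\<lambda>n. cF / X * (\<Sum>j=1..n. (real j / N n) powr (- \<alpha>) * (1 - exp (- (a n * (real j / N n) powr (- \<alpha>)))) / N n))
       \<longlonglongrightarrow> cF / X * (a0 powr \<beta> * Gamma z / (1 - \<alpha>))"
      using tendsto_mult[OF tendsto_const weight_profile_sum_limit[OF \<alpha> a0 a N_top nN_top], of "cF / X"] unfolding \<alpha>z .
    moreover have "eventually (\<lambda>n. cF / X * (\<Sum>j=1..n. (real j / N n) powr (- \<alpha>) * (1 - exp (- (a n * (real j / N n) powr (- \<alpha>)))) / N n)
       = mean_weight_rung (p n / l n) (w n) n (u * L n) / L n) sequentially"
      using pos l_pos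
    proof eventually_elim
      case (elim n)
      note r = R[OF elim(1)]
      have wj: "w n j = cF * b n * (real j / N n) powr (- \<alpha>)" if "j \<in> {1..n}" for j
      proof -
        have "real n / real j = (real n / N n) * inverse (real j / N n)" using r(2) that by (simp add: field_simps)
        then have "(real n / real j) powr \<alpha> = (real n / N n) powr \<alpha> * (inverse (real j / N n)) powr \<alpha>"
          using r(2) by (simp only: powr_mult)
        moreover have "inverse (real j / N n) powr \<alpha> = (real j / N n) powr (- \<alpha>)"
          unfolding powr_minus by (rule inverse_powr)
        ultimately show ?thesis unfolding w_def' r(5) by simp
      qed
      have an: "p n / l n * (cF * b n * y) * (u * L n) = a n * y" for y
      proof -
        have "p n / l n * (cF * b n * y) * (u * L n) = cF * u * X * (p n * (b n)\<^sup>2 * N n) / l n * y"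
          unfolding r(4) by (simp add: power2_eq_square mult_ac)
        then show ?thesis unfolding r(3) by (simp add: a_def)
      qed
      have "mean_weight_rung (p n / l n) (w n) n (u * L n) / L n
         = (\<Sum>j=1..n. cF / X * ((real j / N n) powr (- \<alpha>) * (1 - exp (- (a n * (real j / N n) powr (- \<alpha>)))) / N n))"
        unfolding mean_weight_rung_def sum_divide_distrib
      proof (intro sum.cong refl)
        fix j assume j: "j \<in> {1..n}"
        show "w n j * (1 - exp (- (p n / l n * w n j * (u * L n)))) / L n
           = cF / X * ((real j / N n) powr (- \<alpha>) * (1 - exp (- (a n * (real j / N n) powr (- \<alpha>)))) / N n)"
          unfolding wj[OF j] an unfolding r(4) using r(1,2) X by (simp add: field_simps)
      qed
      then show ?case by (simp add: sum_distrib_left)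
    qed
    ultimately have "(\<lambda>n. mean_weight_rung (p n / l n) (w n) n (u * L n) / L n) \<longlonglongrightarrow> cF / X * (a0 powr \<beta> * Gamma z / (1 - \<alpha>))"
      by (rule Lim_transform_eventually)
    moreover have "cF / X * (a0 powr \<beta> * Gamma z / (1 - \<alpha>)) = u powr \<beta>"
    proof -
      have "a0 powr \<beta> = u powr \<beta> * cF powr \<beta> * (X / \<mu>) powr \<beta>"
        using cF u X \<mu> by (simp add: a0_def powr_mult powr_divide mult_ac)
      then have "cF / X * (a0 powr \<beta> * Gamma z / (1 - \<alpha>)) = u powr \<beta> * (\<kappa> * (X / \<mu>) powr \<beta> / (X / \<mu>))"
        by (simp add: \<kappa>_eq \<mu>_def divide_inverse mult_ac)
      also have "(X / \<mu>) powr \<beta> / (X / \<mu>) = (X / \<mu>) powr (- z)"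
      proof -
        have "- z = \<beta> - 1" using z by simp
        then show ?thesis using X \<mu> by (simp add: powr_diff)
      qed
      then have "\<kappa> * (X / \<mu>) powr \<beta> / (X / \<mu>) = \<kappa> * (X / \<mu>) powr (- z)"
        by (simp only: times_divide_eq_right[symmetric])
      also have "X / \<mu> = \<kappa> powr (1 / z)" using \<mu> by (simp add: X_def)
      also have "(\<kappa> powr (1 / z)) powr (- z) = inverse \<kappa>" unfolding powr_powr using z \<kappa> by (simp add: powr_minus)
      finally show ?thesis using \<kappa> by simp
    qed
    ultimately show ?thesis by simp
  qed

  define W where "W = (\<lambda>n. cF * real n powr \<alpha>)"
  have lim_W: "(\<lambda>n. W n / L n) \<longlonglongrightarrow> 0"
  proof -
    have "((\<lambda>x::real. x powr \<alpha> / x) \<longlongrightarrow> 0) at_top" using \<alpha> by real_asymp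
    from filterlim_compose[OF this N_top] have "(\<lambda>n. N n powr \<alpha> / N n) \<longlonglongrightarrow> 0" by simp
    from tendsto_mult[OF tendsto_const this, of "cF / X"] have "(\<lambda>n. cF / X * (N n powr \<alpha> / N n)) \<longlonglongrightarrow> 0" by simp
    moreover have "eventually (\<lambda>n. cF / X * (N n powr \<alpha> / N n) = W n / L n) sequentially"
      using pos
    proof eventually_elim
      case (elim n)
      note r = R[OF elim]
      have "real n powr \<alpha> = b n * N n powr \<alpha>"
        using r(1,2) unfolding r(5)[symmetric] by (simp add: powr_divide)
      then show ?case unfolding W_def r(4) using r(1,2) X by (simp add: field_simps)
    qed
    ultimately show ?thesis by (rule Lim_transform_eventually)
  qed
  have inv_l: "(\<lambda>n. real n / l n) \<longlonglongrightarrow> 1 / \<mu>"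
    using tendsto_divide[OF tendsto_const l_ratio, of 1] \<mu> by simp
  have lim_L: "(\<lambda>n. L n / l n) \<longlonglongrightarrow> 0"
  proof -
    have "(\<lambda>n. X * (p n powr (\<beta> / z)) * (real n / l n)) \<longlonglongrightarrow> X * 0 * (1 / \<mu>)"
      by (intro tendsto_mult tendsto_const p_powr inv_l) (use \<beta> z in simp)
    then show ?thesis by (simp add: L_def mult_ac)
  qed
  have lim_N: "(\<lambda>n. l n / (p n * (L n)\<^sup>2)) \<longlonglongrightarrow> 0"
  proof -
    have "(\<lambda>n. l n / real n * (1 / N n) * (1 / X\<^sup>2)) \<longlonglongrightarrow> \<mu> * 0 * (1 / X\<^sup>2)"
      by (intro tendsto_mult tendsto_const l_ratio inv_N)
    then have "(\<lambda>n. l n / real n * (1 / N n) * (1 / X\<^sup>2)) \<longlonglongrightarrow> 0" by simp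
    moreover have "eventually (\<lambda>n. l n / real n * (1 / N n) * (1 / X\<^sup>2) = l n / (p n * (L n)\<^sup>2)) sequentially"
      using pos
    proof eventually_elim
      case (elim n)
      note r = R[OF elim]
      have "p n * (L n)\<^sup>2 = X\<^sup>2 * (p n * (b n)\<^sup>2 * N n) * N n" unfolding r(4) by (simp add: power2_eq_square mult_ac)
      then have "p n * (L n)\<^sup>2 = X\<^sup>2 * real n * N n" unfolding r(3) .
      then show ?case by (simp add: mult_ac)
    qed
    ultimately show ?thesis by (rule Lim_transform_eventually)
  qed

  \<comment> \<open>The first \<open>D * N\<close> vertices weigh at least \<open>L\<close>, and \<open>N\<close> is negligible compared with \<open>p * L\<close>.\<close>
  define D where "D = (X / cF) powr (1 / (1 - \<alpha>))"
  have D: "0 < D" "cF * D powr (1 - \<alpha>) = X"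
  proof -
    show "0 < D" using X cF by (simp add: D_def)
    have "D powr (1 - \<alpha>) = X / cF" unfolding D_def powr_powr using \<alpha> X cF by simp
    then show "cF * D powr (1 - \<alpha>) = X" using cF by simp
  qed
  have early: "eventually (\<lambda>n. \<exists>q\<le>n. real q \<le> \<delta> * (p n * L n) \<and> L n \<le> sum (w n) {1..q}) sequentially"
    if \<delta>: "0 < \<delta>" for \<delta>
  proof -
    have "(\<lambda>n. 1 / X * p n powr (\<beta> / z) * (D + 1 / N n)) \<longlonglongrightarrow> 1 / X * 0 * (D + 0)"
      by (intro tendsto_mult tendsto_const tendsto_add p_powr inv_N) (use \<beta> z in simp)
    then have "(\<lambda>n. 1 / X * p n powr (\<beta> / z) * (D + 1 / N n)) \<longlonglongrightarrow> 0" by simp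
    then have e1: "eventually (\<lambda>n. 1 / X * p n powr (\<beta> / z) * (D + 1 / N n) < \<delta>) sequentially"
      using \<delta> by (rule order_tendstoD(2))
    have "(\<lambda>n. \<delta> * X * p n powr (1 / z)) \<longlonglongrightarrow> \<delta> * X * 0" by (intro tendsto_mult tendsto_const p_powr) (use z in simp)
    then have "(\<lambda>n. \<delta> * X * p n powr (1 / z)) \<longlonglongrightarrow> 0" by simp
    then have e2: "eventually (\<lambda>n. \<delta> * X * p n powr (1 / z) < 1) sequentially"
      by (rule order_tendstoD(2)) simp
    show ?thesis using e1 e2 pos
    proof eventually_elim
      case (elim n)
      note r = R[OF elim(3)]
      have n: "0 < real n" using elim by simp
      define q where "q = nat \<lceil>D * N n\<rceil>"
      have DN: "0 < D * N n" using D r(2) by simp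
      then have q: "D * N n \<le> real q" "real q \<le> D * N n + 1" "1 \<le> q" unfolding q_def by linarith+
      have NX: "p n * L n * (p n powr (\<beta> / z) / X) = N n"
      proof -
        have "1 / z + \<beta> / z = (\<tau> - 1) / z" by (simp add: \<beta>_def diff_divide_distrib)
        then have "p n powr (1 / z) * p n powr (\<beta> / z) = p n powr ((\<tau> - 1) / z)" unfolding powr_add[symmetric] by simp
        then show ?thesis unfolding r(6,7) using X by (simp add: mult_ac)
      qed
      have "D * N n + 1 = N n * (D + 1 / N n)" using r(2) by (simp add: field_simps)
      also have "\<dots> = p n * L n * (1 / X * p n powr (\<beta> / z) * (D + 1 / N n))"
        by (subst NX[symmetric]) (simp add: mult_ac)
      also have "\<dots> \<le> p n * L n * \<delta>" using elim(1) r(9) by (intro mult_left_mono) auto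
      finally have q\<delta>: "real q \<le> \<delta> * (p n * L n)" using q(2) by (simp add: mult_ac)
      also have "\<dots> = real n * (\<delta> * X * p n powr (1 / z))" unfolding r(6) by (simp add: mult_ac)
      also have "\<dots> \<le> real n * 1" using elim(2) n by (intro mult_left_mono) auto
      finally have qn: "q \<le> n" by simp
      have "L n = (cF * D powr (1 - \<alpha>)) * b n * N n" unfolding r(4) D(2) ..
      also have "\<dots> = cF * (b n * N n powr \<alpha>) * (D * N n) powr (1 - \<alpha>)"
      proof -
        have "N n = N n powr \<alpha> * N n powr (1 - \<alpha>)" using r(2) unfolding powr_add[symmetric] by simp
        then show ?thesis using D r(2) by (simp add: powr_mult mult_ac)
      qed
      also have "b n * N n powr \<alpha> = real n powr \<alpha>" using r(1,2) unfolding r(5)[symmetric] by (simp add: powr_divide)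
      also have "cF * real n powr \<alpha> * (D * N n) powr (1 - \<alpha>) \<le> cF * real n powr \<alpha> * real q powr (1 - \<alpha>)"
        using q DN cF \<alpha> by (intro mult_left_mono powr_mono2) auto
      also have "\<dots> = real q * w n q"
      proof -
        have "real q powr (1 - \<alpha>) = real q / real q powr \<alpha>" using q by (simp add: powr_diff)
        then show ?thesis unfolding w_def' using n q by (simp add: powr_divide)
      qed
      also have "\<dots> = (\<Sum>j=1..q. w n q)" by simp
      also have "\<dots> \<le> sum (w n) {1..q}"
      proof (intro sum_mono)
        fix j assume "j \<in> {1..q}"
        then show "w n q \<le> w n j"
          unfolding w_def' using cF \<alpha> n by (intro mult_left_mono powr_mono2 divide_left_mono) auto
      qed
      finally show ?case using qn q\<delta> by blast
    qed
  qed

  have w_bounds: "eventually (\<lambda>n. \<forall>i\<in>{1..n}. 0 < w n i \<and> w n i \<le> W n) sequentially"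
  proof (rule always_eventually, intro allI ballI)
    fix n i :: nat assume i: "i \<in> {1..n}"
    have "(real n / real i) powr \<alpha> \<le> real n powr \<alpha>" using i \<alpha> by (intro powr_mono2) (auto simp: divide_le_eq mult_le_cancel_left1)
    then show "0 < w n i \<and> w n i \<le> W n" using i cF by (auto simp: w_def' W_def)
  qed
  have p_ev: "eventually (\<lambda>n. 0 < p n \<and> p n \<le> 1) sequentially"
    using p_pos order_tendstoD(2)[OF p_0, of 1] by (auto elim: eventually_elim2)
  have L_ev: "eventually (\<lambda>n. 0 < L n) sequentially" using pos by eventually_elim (rule R(8))
  define M where "M = (\<lambda>n. MNR_percolated n (w n) (p n))"
  define Z where "Z = (\<lambda>n. real n * p n powr (1 / z))"
  define bad where "bad = (\<lambda>\<epsilon> n. {E. \<not> dominant_class ((1 - \<epsilon>) * (p n * L n)) ((1 + \<epsilon>) * (p n * L n)) (\<epsilon> * (p n * L n)) (components n E)})"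
  have bad_0: "(\<lambda>n. measure_pmf.prob (M n) (bad \<epsilon> n)) \<longlonglongrightarrow> 0" if "0 < \<epsilon>" "\<epsilon> < 1" for \<epsilon>
    unfolding M_def bad_def
    by (rule dominant_class_limit[OF \<beta> that w0 w_bounds p_ev L_ev lim_f[unfolded l_def] lim_W lim_L[unfolded l_def] lim_N[unfolded l_def] early])
  have conv: "converges_in_probability (\<lambda>n. measure_pmf (M n)) (\<lambda>n E. real (component_size n E j) / Z n) x"
    if main: "\<And>\<epsilon> n E. 0 < \<epsilon> \<Longrightarrow> \<epsilon> \<le> 1 / 2 \<Longrightarrow> 0 < p n \<and> 0 < n \<Longrightarrow> E \<notin> bad \<epsilon> n \<Longrightarrow>
        \<bar>real (component_size n E j) / Z n - x\<bar> \<le> \<epsilon> * X" for j x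
    unfolding converges_in_probability_def
  proof (intro allI impI)
    fix e :: real assume e: "0 < e"
    define \<epsilon> where "\<epsilon> = min (1 / 2) (e / X)"
    have \<epsilon>: "0 < \<epsilon>" "\<epsilon> \<le> 1 / 2" "\<epsilon> < 1" "\<epsilon> * X \<le> e"
    proof -
      show "0 < \<epsilon>" using e X by (simp add: \<epsilon>_def)
      show "\<epsilon> \<le> 1 / 2" unfolding \<epsilon>_def by (rule min.cobounded1)
      then show "\<epsilon> < 1" by simp
      have "\<epsilon> \<le> e / X" unfolding \<epsilon>_def by (rule min.cobounded2)
      then show "\<epsilon> * X \<le> e" using X by (simp add: field_simps)
    qed
    have ev: "eventually (\<lambda>n. measure_pmf.prob (M n) {E \<in> space (measure_pmf (M n)). \<bar>real (component_size n E j) / Z n - x\<bar> > e}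
       \<le> measure_pmf.prob (M n) (bad \<epsilon> n)) sequentially"
      using pos
    proof eventually_elim
      case (elim n)
      have "E \<in> bad \<epsilon> n" if "\<bar>real (component_size n E j) / Z n - x\<bar> > e" for E
        using main[OF \<epsilon>(1,2) elim, of E] \<epsilon>(4) that by force
      then show ?case by (intro measure_pmf.finite_measure_mono) auto
    qed
    from tendsto_sandwich[OF _ ev tendsto_const bad_0[OF \<epsilon>(1,3)]]
    show "(\<lambda>n. measure_pmf.prob (M n) {E \<in> space (measure_pmf (M n)). \<bar>real (component_size n E j) / Z n - x\<bar> > e}) \<longlonglongrightarrow> 0"
      by simp
  qed
  have Zpos: "0 < Z n" "p n * L n = X * Z n" if "0 < p n \<and> 0 < n" for n
    using that R(6)[OF that] by (auto simp: Z_def)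
  have sizes: "(1 - \<epsilon>) * X \<le> real (component_size n E 1) / Z n" "real (component_size n E 1) / Z n \<le> (1 + \<epsilon>) * X"
    "2 \<le> j \<Longrightarrow> real (component_size n E j) / Z n \<le> \<epsilon> * X"
    if "0 < \<epsilon>" "\<epsilon> \<le> 1 / 2" "0 < p n \<and> 0 < n" "E \<notin> bad \<epsilon> n" for \<epsilon> n E j
  proof -
    note Zn = Zpos[OF that(3)]
    have dom: "dominant_class ((1 - \<epsilon>) * (X * Z n)) ((1 + \<epsilon>) * (X * Z n)) (\<epsilon> * (X * Z n)) (components n E)"
      using that(4) by (simp add: bad_def Zn(2))
    have le: "\<epsilon> * (X * Z n) \<le> (1 - \<epsilon>) * (X * Z n)" using that Zn X by (intro mult_right_mono) auto
    have "0 \<le> \<epsilon> * (X * Z n)" using that Zn X by simp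
    note dominant = component_size_dominant[OF dom le this]
    from dominant(1,2) dominant(3)[of j] show
      "(1 - \<epsilon>) * X \<le> real (component_size n E 1) / Z n" "real (component_size n E 1) / Z n \<le> (1 + \<epsilon>) * X"
      "2 \<le> j \<Longrightarrow> real (component_size n E j) / Z n \<le> \<epsilon> * X"
      using Zn by (simp_all add: field_simps)
  qed
  have "converges_in_probability (\<lambda>n. measure_pmf (M n)) (\<lambda>n E. real (component_size n E 1) / Z n) X"
  proof (rule conv)
    fix \<epsilon> :: real and n :: nat and E :: "edge set" assume *: "0 < \<epsilon>" "\<epsilon> \<le> 1 / 2" "0 < p n \<and> 0 < n" "E \<notin> bad \<epsilon> n"
    show "\<bar>real (component_size n E 1) / Z n - X\<bar> \<le> \<epsilon> * X" using sizes(1,2)[OF *] by (simp add: algebra_simps abs_le_iff)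
  qed
  moreover have "converges_in_probability (\<lambda>n. measure_pmf (M n)) (\<lambda>n E. real (component_size n E j) / Z n) 0" if j: "2 \<le> j" for j
  proof (rule conv)
    fix \<epsilon> :: real and n :: nat and E :: "edge set" assume *: "0 < \<epsilon>" "\<epsilon> \<le> 1 / 2" "0 < p n \<and> 0 < n" "E \<notin> bad \<epsilon> n"
    show "\<bar>real (component_size n E j) / Z n - 0\<bar> \<le> \<epsilon> * X" using sizes(3)[OF * j] Zpos[OF *(3)] by simp
  qed
  ultimately show ?thesis
    unfolding M_def Z_def w_def z_def mean[symmetric] X_def \<kappa>_def by (simp add: mean)
qed

end
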